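(* Let $p\ge1$. Assume: (i) for some $K>0$ there is a sequence of Borel maps $T_n:\Omega\to V_n$ with $T_n\#\mu=\mu_n$ and $\sup_{x\in\Omega}|T_n(x)-x|\le K\varepsilon_n$ for every $n\in\mathbb N$; (ii) $\eta$ is continuous at $0$, non-increasing, and $\eta(0)>0$; (iii) there is $D>0$ with $\frac1D\le\rho(x)\le D$ for all $x\in\Omega$; and that for some $q>p$, $\aleph_\eta^q<+\infty$. Then there exist the following. (1) An open set $\Sigma\supset\Omega$ and $\delta>0$ such that $\bigcup_{x\in\Omega}B_\delta(x)\subset\Sigma$. (2) For each $n\in\mathbb N$, a finite subset $\widetilde V_n\subset\Sigma$ such that $\widetilde V_n\cap\Omega=V_n$ and a discrete probability measure $\widetilde\mu_n$ on $\widetilde V_n$ such that: (2.i) there is a constant $\alpha\in(0,1)$ (independent of $n$) such that, for any $n\in\mathbb N$ and any $x\in\Omega$, $\widetilde\mu_n(x)=\alpha\mu_n(x)$; in other words, $\widetilde\mu_n(V_n)$ is a constant independent of $n$ and $\widetilde\mu_n|_{V_n}/\widetilde\mu_n(V_n)=\mu_n$; (2.ii) with $\widetilde\Lambda_n^-:=\min_{x\in\widetilde V_n}\widetilde\mu_n(x)$, there is a constant $\beta>0$ (independent of $n$) such that $\frac1\beta\Lambda_n^-\le\widetilde\Lambda_n^-\le\beta\Lambda_n^-$ for any $n\in\mathbb N$; (2.iii) with $\widetilde\Lambda_n^+:=\max_{x\in\widetilde V_n}\widetilde\mu_n(x)$, there is a constant $\gamma>0$ (independent of $n$) such that $\frac1\gamma\Lambda_n^+\le\widetilde\Lambda_n^+\le\gamma\Lambda_n^+$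 for any $n\in\mathbb N$. (3) A probability measure $\widetilde\mu$ with density $\widetilde\rho$ on $\Sigma$ such that there exists $\kappa>0$ with $\frac1\kappa\le\widetilde\rho\le\kappa$. Additionally, $\widetilde\rho|_\Omega$ is proportional to $\rho$. (4) For each $n\in\mathbb N$, a Borel map $\widetilde T_n:\Sigma\to\Sigma$ such that $\widetilde T_n\#\widetilde\mu=\widetilde\mu_n$ and $\widetilde T_n|_\Omega=T_n$, and a constant $\theta\ge1$ (independent of $K$ and $n$) such that $\sup_{x\in\Sigma}|\widetilde T_n(x)-x|\le\theta K\varepsilon_n$ for every $n\in\mathbb N$. (5) For each $n\in\mathbb N$, an extension operator $\mathfrak X_n:L^p(V_n;\mu_n)\to L^p(\widetilde V_n;\widetilde\mu_n)$ such that, for any $u:V_n\to\mathbb R$, $\mathfrak X_nu|_{V_n}=u$. Moreover, there exist constants $A',C'>0$, $B'\ge1$ (independent of both $K$ and $n$) such that, for any $s\ge K$, any $n\in\mathbb N$ and any $u:V_n\to\mathbb R$, $$\frac1{\varepsilon_n^{d+p}}\sum_{x\in\widetilde V_n}\sum_{y\in\widetilde V_n}\mathbf 1_{|x-y|\le s\varepsilon_n}|\mathfrak X_nu(x)-\mathfrak X_nu(y)|^p\widetilde\mu_n(x)\widetilde\mu_n(y)$$ $$\le A'\left(\|u\|_{L^p(V_n;\mu_n)}^p+\frac1{\varepsilon_n^{d+p}}\sum_{x\in V_n}\sum_{y\in V_n}\mathbf 1_{|x-y|\le sB'\varepsilon_n}|u(x)-u(y)|^p\mu_n(x)\mu_n(y)\right)$$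 and $$\|\mathfrak X_nu\|_{L^p(\widetilde V_n;\widetilde\mu_n)}\le C'\|u\|_{L^p(V_n;\mu_n)}.$$ (6) If additionally there is $\mathfrak D>0$ such that $\frac1{\mathfrak D|V_n|}\le\mu_n(x)\le\frac{\mathfrak D}{|V_n|}$ for all $n\in\mathbb N$, $x\in V_n$, then there exists $\widetilde{\mathfrak D}>0$ such that $\frac1{\widetilde{\mathfrak D}|\widetilde V_n|}\le\widetilde\mu_n(x)\le\frac{\widetilde{\mathfrak D}}{|\widetilde V_n|}$ for all $n\in\mathbb N$, $x\in\widetilde V_n$. (7) If additionally $\frac1{\varepsilon_n}\sup_{x\in\Omega}|T_n(x)-x|\to0$ as $n\to\infty$, then $\frac1{\varepsilon_n}\sup_{x\in\Sigma}|\widetilde T_n(x)-x|\to0$ as $n\to\infty$.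
   Context: $\mathbb N=\{1,2,\dots\}$; $d\in\mathbb N$; $\Omega\subset\mathbb R^d$ is open and bounded with Lipschitz boundary (near each boundary point, in suitable orthonormal coordinates, $\Omega$ is the region on one side of the graph of a Lipschitz function). $\mu$ is a probability measure on $\Omega$ with continuous density $\rho:\Omega\to\mathbb R$ with respect to Lebesgue measure. For $n\in\mathbb N$, $V_n\subset\Omega$ is a finite set, $\mu_n$ is a probability measure on $V_n$ (also regarded as a measure on $\Omega$), $\mu_n(x):=\mu_n(\{x\})$ and likewise $\widetilde\mu_n(x):=\widetilde\mu_n(\{x\})$, $\Lambda_n^-:=\min_{x\in V_n}\mu_n(x)$, $\Lambda_n^+:=\max_{x\in V_n}\mu_n(x)$. $(\varepsilon_n)_{n\in\mathbb N}$ is a sequence of positive reals with $\varepsilon_n\to0$. The kernel is a function $\eta:[0,\infty)\to[0,\infty)$; $\aleph_\eta^t:=\int_0^\infty\eta(r)r^{d+t-1}\,dr$ for $t\ge0$. The push-forward is $T\#\mu(A):=\mu(T^{-1}(A))$. $B_r(x)$ is the open ball of radius $r$ centred at $x$. $\mathbf 1_P$ equals $1$ if the statement $P$ holds and $0$ otherwise. For a finite set $V$ with probability measure $\nu$, $L^p(V;\nu)$ is the set of functions $u:V\to\mathbb R$ with $\|u\|_{L^p(V;\nu)}:=\big(\sum_{x\in V}|u(x)|^p\nu(\{x\})\big)^{1/p}$. *)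

theory Defs
  imports "HOL-Probability.Probability"
begin

text \<open>
  Orthonormal coordinates near a boundary point are given by a unit vector \<open>e\<close> (the vertical axis)
  and its orthogonal hyperplane: a point \<open>y\<close> has height \<open>e \<bullet> y\<close> and horizontal part
  \<open>y - (e \<bullet> y) *\<^sub>R e\<close>, and the graph function \<open>g\<close> lives on the hyperplane.
\<close>

definition lipschitz_boundary :: "(real ^ 'd) set \<Rightarrow> bool" where
  "lipschitz_boundary \<Omega> \<longleftrightarrow>
     (\<forall>x\<in>frontier \<Omega>. \<exists>e (g :: real ^ 'd \<Rightarrow> real) L r.
        norm e = 1 \<and> r > 0 \<and> L-lipschitz_on {z. e \<bullet> z = 0} g \<and>
        \<Omega> \<inter> ball x r = {y \<in> ball x r. e \<bullet> y > g (y - (e \<bullet> y) *\<^sub>R e)})"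

text \<open>
  A probability measure on the finite set \<open>V\<close>, regarded as a Borel measure on \<open>X \<supseteq> V\<close>.
  Individual atoms may have mass zero.
\<close>

definition discrete_prob_on :: "(real ^ 'd) set \<Rightarrow> (real ^ 'd) set \<Rightarrow> (real ^ 'd) measure \<Rightarrow> bool" where
  "discrete_prob_on X V \<nu> \<longleftrightarrow>
     finite V \<and> V \<subseteq> X \<and> sets \<nu> = sets (restrict_space borel X) \<and> prob_space \<nu> \<and> emeasure \<nu> V = 1"

definition min_atom :: "'a set \<Rightarrow> 'a measure \<Rightarrow> real" where
  "min_atom V \<nu> = Min ((\<lambda>x. measure \<nu> {x}) ` V)"

definition max_atom :: "'a set \<Rightarrow> 'a measure \<Rightarrow> real" where
  "max_atom V \<nu> = Max ((\<lambda>x. measure \<nu> {x}) ` V)"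

definition kernel_moment :: "nat \<Rightarrow> (real \<Rightarrow> real) \<Rightarrow> real \<Rightarrow> ennreal" where
  "kernel_moment d \<eta> t = (\<integral>\<^sup>+r\<in>{0<..}. ennreal (\<eta> r * r powr (real d + t - 1)) \<partial>lborel)"

text \<open>
  On a finite set \<open>V\<close> the space \<open>L\<^sup>p(V; \<nu>)\<close> consists of all functions \<open>V \<rightarrow> \<real>\<close>; they are
  represented by the functions that are \<^term>\<open>undefined\<close> outside \<open>V\<close>.
\<close>

definition Lp_fun :: "'a set \<Rightarrow> ('a \<Rightarrow> real) set" where
  "Lp_fun V = (V \<rightarrow>\<^sub>E UNIV)"

definition Lp_norm :: "real \<Rightarrow> 'a set \<Rightarrow> 'a measure \<Rightarrow> ('a \<Rightarrow> real) \<Rightarrow> real" where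
  "Lp_norm p V \<nu> u = (\<Sum>x\<in>V. \<bar>u x\<bar> powr p * measure \<nu> {x}) powr (1 / p)"

definition nonlocal_energy ::
  "real \<Rightarrow> real \<Rightarrow> real \<Rightarrow> (real ^ 'd) set \<Rightarrow> (real ^ 'd) measure \<Rightarrow> (real ^ 'd \<Rightarrow> real) \<Rightarrow> real" where
  "nonlocal_energy p \<epsilon> s V \<nu> u =
     1 / \<epsilon> powr (real CARD('d) + p) *
     (\<Sum>x\<in>V. \<Sum>y\<in>V. of_bool (norm (x - y) \<le> s * \<epsilon>) * \<bar>u x - u y\<bar> powr p
                       * measure \<nu> {x} * measure \<nu> {y})"

end

theory Submission
  imports Defs
begin

text \<open>
  Only one length matters at step \<open>n\<close> of the sequence: the displacement \<open>r = sup |T\<^sub>n x - x|\<close>, which is at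
  most \<open>K * \<epsilon> n\<close>, and positive because \<open>T\<^sub>n\<close> has finite range.  The new atoms outside \<open>\<Omega>\<close> are not
  mirror images of the old ones but are placed independently of them.  A fixed collar around \<open>\<Omega>\<close> is taken as the larger domain, its exterior
  part carries a constant density, and at step \<open>n\<close> it is cut into Borel cells of diameter \<open>O(r)\<close>.  The
  extended transport map sends each cell to one of its own points, so its displacement is \<open>O(r)\<close> too; in
  particular it is \<open>o(\<epsilon> n)\<close> as soon as \<open>r\<close> is.

  The value of the extended function at a new atom is the average of \<open>u \<circ> T\<^sub>n\<close> over a reservoir in \<open>\<Omega>\<close> that
  is attached to the cell.  This is an average with respect to a Markov kernel from the new set of atoms to
  the old one.  Two properties of the kernel give both estimates through Jensen's inequality
  (\<open>markov_extension_norm_le\<close>, \<open>markov_extension_energy_le\<close>), with constants depending neither on \<open>K\<close> nor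
  on the range \<open>s\<close>: it carries the new masses to at most a multiple of the old ones (\<open>w_pull\<close>),
  and atoms at distance \<open>h \<ge> r\<close> are averaged over atoms at distance \<open>O(h)\<close> (\<open>w_near\<close>).

  Both properties reduce to a map from the exterior part of the collar into \<open>\<Omega>\<close> that is Lipschitz, so that
  distances between reservoirs are controlled, and expansive, so that reservoirs overlap boundedly.
  Lipschitz boundaries supply local cones of inward directions; inward directions can be superposed, which
  yields a Lipschitz field \<open>v\<close> pointing into \<open>\<Omega>\<close> uniformly (\<open>inward_field_exists\<close>).  The map
  \<open>x \<mapsto> x + \<lambda> (dist(x, \<Omega>) + r) v(x)\<close> lands deep enough in \<open>\<Omega>\<close> for large \<open>\<lambda>\<close> (\<open>cball_reflect_subset\<close>).  It is
  expansive because the distance to \<open>\<Omega>\<close> decreases along \<open>v\<close> at a definite rate, so that two points with equal images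
  would have to differ in their distance to \<open>\<Omega>\<close> by twice the actual difference (\<open>reflect_expansive_aux\<close>).

  Finally the masses of the new atoms must lie between multiples of the smallest and the largest old atom.
  A cell contains a ball of radius comparable to \<open>r\<close>, whereas the preimage of an old atom lies in a ball of radius
  \<open>r\<close>; this is the lower bound.  Cells heavier than the largest old atom are subdivided into parts of equal
  mass (\<open>cell_system_refine\<close>); this is the upper bound.
\<close>

section \<open>Cones pointing into a Lipschitz domain\<close>

text \<open>
  From every point \<open>y\<close> of \<open>\<Omega>\<close> in the window \<open>U\<close>, the truncated cone with axis \<open>w\<close>, height \<open>\<tau>\<close> and opening
  \<open>c\<close> stays inside \<open>\<Omega>\<close>.  The cone is cut into closed balls of radius \<open>c * t\<close> about \<open>y + t *\<^sub>R w\<close>, and \<open>w\<close>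
  may have any length: this makes pairs \<open>(w, c)\<close> additive.
\<close>

definition inward_cone ::
  "'a::real_normed_vector set \<Rightarrow> 'a set \<Rightarrow> real \<Rightarrow> 'a \<Rightarrow> real \<Rightarrow> bool" where
  "inward_cone \<Omega> U \<tau> w c \<longleftrightarrow>
     (\<forall>y\<in>\<Omega> \<inter> U. \<forall>t. 0 \<le> t \<longrightarrow> t \<le> \<tau> \<longrightarrow> (\<forall>z. norm z \<le> c * t \<longrightarrow> y + t *\<^sub>R w + z \<in> \<Omega>))"

lemma inward_coneD:
  assumes "inward_cone \<Omega> U \<tau> w c" "y \<in> \<Omega>" "y \<in> U" "0 \<le> t" "t \<le> \<tau>" "norm z \<le> c * t"
  shows "y + t *\<^sub>R w + z \<in> \<Omega>"
  using assms unfolding inward_cone_def by blast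

lemma norm_horizontal_le:
  fixes e w :: "'a::real_inner"
  assumes "norm e = 1"
  shows "norm (w - (e \<bullet> w) *\<^sub>R e) \<le> norm w"
proof -
  have ee: "e \<bullet> e = 1" using assms norm_eq_1 by blast
  have expand: "(w - a *\<^sub>R e) \<bullet> (w - a *\<^sub>R e) = w \<bullet> w - a * (w \<bullet> e) - a * (e \<bullet> w) + a * a * (e \<bullet> e)" for a
    by (simp only: inner_diff_left inner_diff_right inner_scaleR_left inner_scaleR_right) argo
  have "(w - (e \<bullet> w) *\<^sub>R e) \<bullet> (w - (e \<bullet> w) *\<^sub>R e) = w \<bullet> w - (e \<bullet> w) * (e \<bullet> w)"
    using expand[of "e \<bullet> w"] inner_commute[of w e] ee by simp
  then have "(norm (w - (e \<bullet> w) *\<^sub>R e))\<^sup>2 = (norm w)\<^sup>2 - (e \<bullet> w)\<^sup>2"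
    unfolding power2_norm_eq_inner by (simp only: power2_eq_square)
  then have "(norm (w - (e \<bullet> w) *\<^sub>R e))\<^sup>2 \<le> (norm w)\<^sup>2"
    by simp
  then show ?thesis
    by (rule power2_le_imp_le) simp
qed

lemma inward_cone_interior:
  fixes \<Omega> :: "'a::real_normed_vector set"
  assumes "open \<Omega>" "x \<in> \<Omega>"
  shows "\<exists>c r. 0 < c \<and> c \<le> 1 \<and> 0 < r \<and> inward_cone \<Omega> (ball x r) r 0 c"
proof -
  obtain \<rho> where \<rho>: "\<rho> > 0" "ball x \<rho> \<subseteq> \<Omega>"
    using assms open_contains_ball by blast
  have "inward_cone \<Omega> (ball x (\<rho>/2)) (\<rho>/2) 0 1"
    unfolding inward_cone_def
  proof clarsimp
    fix y z :: 'a and t assume y: "dist x y * 2 < \<rho>" and t: "t * 2 \<le> \<rho>" "norm z \<le> t"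
    have "dist x (y + z) \<le> dist x y + norm z"
      by (metis dist_add_cancel dist_norm dist_triangle add.right_neutral add_diff_cancel_left' norm_minus_commute)
    then have "y + z \<in> ball x \<rho>"
      using y t by simp
    then show "y + z \<in> \<Omega>" using \<rho> by blast
  qed
  then show ?thesis
    using \<rho>(1) by (intro exI[of _ 1] exI[of _ "\<rho>/2"]) simp
qed

text \<open>
  Going up by \<open>t\<close> along the vertical axis and deviating by at most \<open>c * t\<close> gains height at least
  \<open>t - c * t\<close>, while the graph rises by at most \<open>L * c * t\<close>.  With \<open>c = 1 / (1 + L)\<close> the two balance, and
  the strict inequality at the starting point is preserved.
\<close>

lemma inward_cone_frontier:
  fixes \<Omega> :: "(real ^ 'd) set"
  assumes "lipschitz_boundary \<Omega>" "x \<in> frontier \<Omega>"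
  shows "\<exists>e c r. norm e = 1 \<and> 0 < c \<and> c \<le> 1 \<and> 0 < r \<and> inward_cone \<Omega> (ball x r) r e c"
proof -
  obtain e and g :: "real ^ 'd \<Rightarrow> real" and L R where e: "norm e = 1" and R: "R > 0"
    and g: "L-lipschitz_on {z. e \<bullet> z = 0} g"
    and graph: "\<Omega> \<inter> ball x R = {y \<in> ball x R. e \<bullet> y > g (y - (e \<bullet> y) *\<^sub>R e)}"
    using assms unfolding lipschitz_boundary_def by meson
  have L: "L \<ge> 0" using g by (rule lipschitz_on_nonneg)
  define c where "c = 1 / (1 + L)"
  have c: "0 < c" "c \<le> 1" "c + L * c = 1"
    using L by (auto simp: c_def field_simps)
  have ee: "e \<bullet> e = 1" using e norm_eq_1 by blast
  have horiz: "y - (e \<bullet> y) *\<^sub>R e \<in> {z. e \<bullet> z = 0}" for y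
    by (simp only: mem_Collect_eq inner_diff_right inner_scaleR_right ee mult_1_right diff_self)
  have "inward_cone \<Omega> (ball x (R/4)) (R/4) e c"
    unfolding inward_cone_def
  proof (intro ballI allI impI)
    fix y z :: "real ^ 'd" and t
    assume y: "y \<in> \<Omega> \<inter> ball x (R/4)" and t: "0 \<le> t" "t \<le> R/4" and z: "norm z \<le> c * t"
    define q where "q = y + t *\<^sub>R e + z"
    have z': "norm z \<le> t"
      using z c(2) t(1) mult_right_mono[of c 1 t] by linarith
    have "norm (q - y) \<le> norm (t *\<^sub>R e) + norm z"
      unfolding q_def using norm_triangle_ineq[of "t *\<^sub>R e" z] by (simp add: algebra_simps)
    then have "dist q y \<le> R/4 + R/4"
      using t z' e by (simp add: dist_norm)
    then have qB: "q \<in> ball x R"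
      using y R dist_triangle[of x q y] by (simp add: dist_commute)
    have gy: "g (y - (e \<bullet> y) *\<^sub>R e) < e \<bullet> y"
    proof -
      have "y \<in> \<Omega> \<inter> ball x R" using y R by auto
      then show ?thesis unfolding graph by simp
    qed
    have "dist (g (q - (e \<bullet> q) *\<^sub>R e)) (g (y - (e \<bullet> y) *\<^sub>R e))
        \<le> L * dist (q - (e \<bullet> q) *\<^sub>R e) (y - (e \<bullet> y) *\<^sub>R e)"
      using g horiz horiz by (rule lipschitz_onD)
    also have "dist (q - (e \<bullet> q) *\<^sub>R e) (y - (e \<bullet> y) *\<^sub>R e) = norm (z - (e \<bullet> z) *\<^sub>R e)"
      unfolding dist_norm q_def using ee by (simp add: algebra_simps inner_add_right)
    also have "L * \<dots> \<le> L * (c * t)"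
      using norm_horizontal_le[OF e, of z] z L by (intro mult_left_mono) auto
    finally have "g (q - (e \<bullet> q) *\<^sub>R e) \<le> g (y - (e \<bullet> y) *\<^sub>R e) + L * c * t"
      by (simp add: dist_real_def abs_le_iff algebra_simps)
    moreover have "e \<bullet> q \<ge> e \<bullet> y + t - c * t"
    proof -
      have "\<bar>e \<bullet> z\<bar> \<le> norm z"
        using Cauchy_Schwarz_ineq2[of e z] e by simp
      then show ?thesis
        unfolding q_def using ee z by (simp add: inner_add_right abs_le_iff)
    qed
    moreover have "L * c * t + c * t = t"
      using c(3) by (metis add.commute distrib_right mult_1)
    ultimately have "g (q - (e \<bullet> q) *\<^sub>R e) < e \<bullet> q"
      using gy by linarith
    then show "y + t *\<^sub>R e + z \<in> \<Omega>"
      using graph qB unfolding q_def[symmetric] by blast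
  qed
  then show ?thesis
    using e c R by (intro exI[of _ e] exI[of _ c] exI[of _ "R/4"]) simp
qed

text \<open>
  Inward directions may be superposed: a displacement inside the summed cone is split proportionally
  to the openings and performed one summand after the other, each time starting from a point of
  \<open>\<Omega>\<close>.  The assumption on \<open>U\<close> keeps the intermediate points in the window of the next summand.
\<close>

lemma inward_cone_sum:
  fixes \<Omega> :: "'a::real_normed_vector set"
  assumes "finite F"
    and "\<And>i. i \<in> F \<Longrightarrow> inward_cone \<Omega> (ball (x i) (r i)) (r i) (e i) (c i)"
    and "\<And>i. i \<in> F \<Longrightarrow> norm (e i) \<le> 1 \<and> 0 < c i \<and> c i \<le> 1 \<and> 0 < h i \<and> \<tau> * h i \<le> r i"
    and "\<tau> \<ge> 0"
    and "\<And>i. i \<in> F \<Longrightarrow> U \<subseteq> ball (x i) (r i - 2 * \<tau> * (\<Sum>j\<in>F. h j))"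
  shows "inward_cone \<Omega> U \<tau> (\<Sum>i\<in>F. h i *\<^sub>R e i) (\<Sum>i\<in>F. h i * c i)"
proof -
  have "\<forall>y\<in>\<Omega> \<inter> U. \<forall>t. 0 \<le> t \<longrightarrow> t \<le> \<tau> \<longrightarrow> (\<forall>z. norm z \<le> (\<Sum>i\<in>H. h i * c i) * t
          \<longrightarrow> y + t *\<^sub>R (\<Sum>i\<in>H. h i *\<^sub>R e i) + z \<in> \<Omega>)" if "H \<subseteq> F" for H
    using finite_subset[OF that assms(1)] that
  proof (induction H rule: finite_induct)
    case empty
    then show ?case by simp
  next
    case (insert i H)
    define c1 where "c1 = (\<Sum>j\<in>H. h j * c j)"
    define c2 where "c2 = h i * c i"
    define w1 where "w1 = (\<Sum>j\<in>H. h j *\<^sub>R e j)"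
    define X where "X = (\<Sum>j\<in>F. h j)"
    have HF: "H \<subseteq> F" "i \<in> F" using insert by auto
    have pos: "0 \<le> h j" if "j \<in> F" for j using assms(3)[OF that] by simp
    have HX: "(\<Sum>j\<in>H. h j) \<le> X"
      unfolding X_def using HF pos assms(1) by (intro sum_mono2) auto
    have "c1 \<le> (\<Sum>j\<in>H. h j)"
      unfolding c1_def using HF assms(3) pos
      by (intro sum_mono) (metis mult.right_neutral mult_left_mono subsetD)
    then have c1X: "c1 \<le> X" using HX by simp
    have "norm w1 \<le> (\<Sum>j\<in>H. norm (h j *\<^sub>R e j))"
      unfolding w1_def by (rule norm_sum)
    also have "\<dots> \<le> (\<Sum>j\<in>H. h j)"
      using HF assms(3) pos
      by (intro sum_mono) (simp, metis abs_of_nonneg mult.right_neutral mult_left_mono subsetD)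
    finally have w1X: "norm w1 \<le> X" using HX by simp
    have c1: "c1 \<ge> 0"
      unfolding c1_def using HF assms(3) by (intro sum_nonneg mult_nonneg_nonneg) (auto simp: less_imp_le)
    have c2: "c2 > 0" unfolding c2_def using assms(3)[OF HF(2)] by simp
    show ?case
    proof (intro ballI allI impI)
      fix y z :: 'a and t
      assume y: "y \<in> \<Omega> \<inter> U" and t: "0 \<le> t" "t \<le> \<tau>"
        and z: "norm z \<le> (\<Sum>i\<in>insert i H. h i * c i) * t"
      have z: "norm z \<le> (c1 + c2) * t"
        using z insert.hyps by (simp add: c1_def c2_def add.commute)
      \<comment> \<open>the part \<open>z1\<close> is spent in the cone of the first summands, \<open>z2\<close> in the cone of \<open>e i\<close>\<close>
      define z1 where "z1 = (c1 / (c1 + c2)) *\<^sub>R z"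
      define z2 where "z2 = (c2 / (c1 + c2)) *\<^sub>R z"
      have zz: "z = z1 + z2"
        unfolding z1_def z2_def using c1 c2
        by (simp add: scaleR_left_distrib[symmetric] add_divide_distrib[symmetric])
      have n1: "norm z1 \<le> c1 * t"
      proof -
        have "norm z1 = c1 / (c1 + c2) * norm z" unfolding z1_def using c1 c2 by simp
        also have "\<dots> \<le> c1 / (c1 + c2) * ((c1 + c2) * t)"
          using z c1 c2 by (intro mult_left_mono) auto
        also have "\<dots> = c1 * t" using c1 c2 by simp
        finally show ?thesis .
      qed
      have n2: "norm z2 \<le> c2 * t"
      proof -
        have "norm z2 = c2 / (c1 + c2) * norm z" unfolding z2_def using c1 c2 by simp
        also have "\<dots> \<le> c2 / (c1 + c2) * ((c1 + c2) * t)"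
          using z c1 c2 by (intro mult_left_mono) auto
        also have "\<dots> = c2 * t" using c1 c2 by simp
        finally show ?thesis .
      qed
      define q where "q = y + t *\<^sub>R w1 + z1"
      have q\<Omega>: "q \<in> \<Omega>"
        using insert.IH HF y t n1 unfolding q_def c1_def w1_def by blast
      have "norm (q - y) \<le> t * norm w1 + norm z1"
        unfolding q_def using norm_triangle_ineq[of "t *\<^sub>R w1" z1] t by (simp add: algebra_simps)
      also have "\<dots> \<le> \<tau> * X + \<tau> * X"
        using n1 mult_mono[OF t(2) w1X] mult_mono[OF t(2) c1X] t c1 by (simp add: mult.commute)
      finally have "dist q y \<le> 2 * \<tau> * X" by (simp add: dist_norm mult_ac)
      moreover have "y \<in> ball (x i) (r i - 2 * \<tau> * X)"
        using assms(5)[OF HF(2)] y X_def by blast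
      ultimately have qB: "q \<in> ball (x i) (r i)"
        using dist_triangle[of "x i" q y] by (simp add: dist_commute)
      have ti: "t * h i \<le> r i"
        using assms(3)[OF HF(2)] mult_right_mono[OF t(2), of "h i"] by linarith
      have "q + (t * h i) *\<^sub>R e i + z2 \<in> \<Omega>"
        using n2 t ti pos[OF HF(2)] unfolding c2_def
        by (intro inward_coneD[OF assms(2)[OF HF(2)] q\<Omega> qB]) (auto simp: mult_ac)
      then show "y + t *\<^sub>R (\<Sum>i\<in>insert i H. h i *\<^sub>R e i) + z \<in> \<Omega>"
        using insert.hyps unfolding q_def zz w1_def by (simp add: algebra_simps)
    qed
  qed
  then show ?thesis
    unfolding inward_cone_def by blast
qed

lemma infdist_lessE:
  assumes "A \<noteq> {}" "infdist x A < r"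
  obtains y where "y \<in> A" "dist x y < r"
  using assms cInf_lessD[of "(\<lambda>a. dist x a) ` A" r] unfolding infdist_def by auto

text \<open>
  The axes of the local cones are glued with the Lipschitz bumps \<open>max 0 (r i / 2 - dist x i)\<close> of a finite
  cover of the closure.  The bumps are not normalised: a sum of inward directions is inward, and it
  is enough that near \<open>\<Omega>\<close> at least one bump exceeds a fixed threshold, which bounds the opening of the
  combined cone from below.
\<close>

lemma inward_field_exists:
  fixes \<Omega> :: "'a::euclidean_space set"
  assumes "bounded \<Omega>"
    and loc: "\<And>x. x \<in> closure \<Omega> \<Longrightarrow> \<exists>e c r. norm e \<le> 1 \<and> 0 < c \<and> c \<le> 1 \<and> 0 < r \<and>
                                             inward_cone \<Omega> (ball x r) r e c"
  obtains v c \<tau> L M where "0 < c" "c \<le> 1" "0 < \<tau>" "1 \<le> M" "0 \<le> L" "\<And>x y. norm (v x - v y) \<le> L * norm (x - y)"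
    "\<And>x. norm (v x) \<le> M" 
    "\<And>x. infdist x \<Omega> < \<tau> \<Longrightarrow> inward_cone \<Omega> (ball x \<tau>) \<tau> (v x) c"
proof (cases "\<Omega> = {}")
  case True
  show ?thesis
    by (rule that[of 1 1 1 0 "\<lambda>_. 0"]) (auto simp: True inward_cone_def)
next
  case ne: False
  obtain e c r where ecr: "\<And>x. x \<in> closure \<Omega> \<Longrightarrow> norm (e x) \<le> 1 \<and> 0 < c x \<and> c x \<le> 1 \<and> 0 < r x \<and>
                              inward_cone \<Omega> (ball x (r x)) (r x) (e x) (c x)"
    using loc by metis
  have "compact (closure \<Omega>)" using assms(1) by (simp add: compact_closure)
  moreover have "closure \<Omega> \<subseteq> (\<Union>x\<in>closure \<Omega>. ball x (r x / 4))"
    using ecr by fastforce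
  ultimately obtain I where I: "I \<subseteq> closure \<Omega>" "finite I" "closure \<Omega> \<subseteq> (\<Union>x\<in>I. ball x (r x / 4))"
    by (elim compactE_image[where f = "\<lambda>x. ball x (r x / 4)"]) auto
  have Ine: "I \<noteq> {}" using I(3) ne closure_subset by fastforce
  have r: "0 < r i" if "i \<in> I" for i using ecr that I(1) by auto
  define \<rho> where "\<rho> = Min (r ` I)"
  have \<rho>: "\<rho> > 0" "\<And>i. i \<in> I \<Longrightarrow> \<rho> \<le> r i"
    unfolding \<rho>_def using I(2) Ine r by auto
  define c0 where "c0 = Min (c ` I)"
  have c0: "c0 > 0" "\<And>i. i \<in> I \<Longrightarrow> c0 \<le> c i"
    unfolding c0_def using I(1,2) Ine ecr by auto
  have c01: "c0 \<le> 1" using c0(2) ecr I(1) Ine by (meson all_not_in_conv order_trans subsetD)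
  define h where "h x i = max 0 (r i / 2 - dist x i)" for x i
  define v where "v x = (\<Sum>i\<in>I. h x i *\<^sub>R e i)" for x
  define X where "X = (\<Sum>i\<in>I. r i)"
  have X: "X > 0" unfolding X_def using I(2) Ine r by (intro sum_pos) auto
  have hnn: "h x i \<ge> 0" for x i by (simp add: h_def)
  have hr: "h x i \<le> r i / 2" if "i \<in> I" for x i using r[OF that] by (simp add: h_def max_def)
  have hL: "\<bar>h x i - h y i\<bar> \<le> norm (x - y)" for x y i
    unfolding h_def using dist_triangle[of x i y] dist_triangle[of y i x]
    by (auto simp: max_def dist_norm norm_minus_commute)
  \<comment> \<open>intermediate points move by at most \<open>2 * \<tau> * X \<le> \<rho> / 4\<close>, half of the margin \<open>r i / 2\<close> left by the bumps\<close>
  define \<tau> where "\<tau> = min (\<rho> / 8) (\<rho> / (8 * X))"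
  have \<tau>: "\<tau> > 0" "\<tau> \<le> \<rho> / 8" "\<tau> * X \<le> \<rho> / 8"
    using \<rho> X unfolding \<tau>_def by (auto simp: min_def field_simps)
  have \<tau>1: "\<tau> * h x i \<le> \<rho> / 8" if "i \<in> I" for x i
  proof -
    have "h x i \<le> r i" using hr[OF that, of x] r[OF that] by simp
    also have "\<dots> \<le> X" unfolding X_def using that I(2) r by (intro member_le_sum) (auto simp: less_imp_le)
    finally show ?thesis using \<tau> mult_left_mono[of "h x i" X \<tau>] by linarith
  qed
  have le1: "norm (e i) \<le> 1" and ci: "0 < c i" "c i \<le> 1"
    and cone_i: "inward_cone \<Omega> (ball i (r i)) (r i) (e i) (c i)" if "i \<in> I" for i
    using ecr[of i] that I(1) by blast+
  show ?thesis
  proof (rule that)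
    show "0 < min 1 (\<rho> * c0 / 8)" "min 1 (\<rho> * c0 / 8) \<le> 1" "0 < \<tau>" "0 \<le> real (card I)" "1 \<le> max 1 X"
      using \<rho> c0 \<tau> by auto
    fix x y
    have "norm (v x - v y) = norm (\<Sum>i\<in>I. (h x i - h y i) *\<^sub>R e i)"
      unfolding v_def by (simp add: sum_subtractf scaleR_left_diff_distrib)
    also have "\<dots> \<le> (\<Sum>i\<in>I. norm (x - y))"
    proof (rule sum_norm_le)
      fix i assume "i \<in> I"
      then show "norm ((h x i - h y i) *\<^sub>R e i) \<le> norm (x - y)"
        using mult_mono[OF hL[of x i y] le1[of i]] by simp
    qed
    finally show "norm (v x - v y) \<le> real (card I) * norm (x - y)" by simp
  next
    fix x
    have "norm (v x) \<le> (\<Sum>i\<in>I. r i)"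
      unfolding v_def
    proof (rule sum_norm_le)
      fix i assume i: "i \<in> I"
      have "norm (h x i *\<^sub>R e i) \<le> h x i * 1"
        using le1[OF i] hnn[of x i] by (simp add: mult_left_le)
      then show "norm (h x i *\<^sub>R e i) \<le> r i"
        using hr[OF i, of x] r[OF i] by simp
    qed
    then show "norm (v x) \<le> max 1 X" by (simp add: X_def)
  next
    fix x assume x: "infdist x \<Omega> < \<tau>"
    obtain b where b: "b \<in> \<Omega>" "dist x b < \<tau>"
      using infdist_lessE[OF ne x] .
    obtain k where k: "k \<in> I" "b \<in> ball k (r k / 4)" using b I(3) closure_subset by blast
    have hk: "h x k \<ge> \<rho> / 8"
    proof -
      have "dist x k \<le> \<tau> + r k / 4"
        using dist_triangle[of x k b] b k by (simp add: dist_commute)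
      then show ?thesis using \<tau> \<rho>(2)[OF k(1)] unfolding h_def by linarith
    qed
    define F where "F = {i\<in>I. h x i > 0}"
    have FI: "F \<subseteq> I" "finite F" using I(2) by (auto simp: F_def)
    have vF: "v x = (\<Sum>i\<in>F. h x i *\<^sub>R e i)"
      unfolding v_def
    proof (rule sum.mono_neutral_right)
      show "\<forall>i\<in>I - F. h x i *\<^sub>R e i = 0"
        using hnn[of x] unfolding F_def by (auto simp: not_less intro: antisym)
    qed (use FI I(2) in auto)
    have kF: "k \<in> F" using k(1) hk \<rho>(1) unfolding F_def by auto
    have cone: "inward_cone \<Omega> (ball x \<tau>) \<tau> (\<Sum>i\<in>F. h x i *\<^sub>R e i) (\<Sum>i\<in>F. h x i * c i)"
    proof (rule inward_cone_sum[where x = "\<lambda>i. i" and r = r and h = "h x" and e = e and c = c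
          and F = F and U = "ball x \<tau>" and \<tau> = \<tau> and \<Omega> = \<Omega>])
      fix i assume i: "i \<in> F"
      then have iI: "i \<in> I" using FI by auto
      show "inward_cone \<Omega> (ball i (r i)) (r i) (e i) (c i)"
        by (rule cone_i[OF iI])
      show "norm (e i) \<le> 1 \<and> 0 < c i \<and> c i \<le> 1 \<and> 0 < h x i \<and> \<tau> * h x i \<le> r i"
        using le1[OF iI] ci[OF iI] i \<tau>1[OF iI, of x] \<rho>(1) \<rho>(2)[OF iI] unfolding F_def by simp
      have "(\<Sum>j\<in>F. h x j) \<le> (\<Sum>j\<in>F. r j)"
      proof (rule sum_mono)
        fix j assume "j \<in> F"
        then have "j \<in> I" using FI by auto
        then show "h x j \<le> r j" using hr[of j x] r[of j] by simp
      qed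
      also have "\<dots> \<le> X"
        unfolding X_def
      proof (rule sum_mono2)
        show "0 \<le> r j" if "j \<in> I - F" for j using r[of j] that by simp
      qed (use FI I(2) in auto)
      finally have "2 * \<tau> * (\<Sum>j\<in>F. h x j) \<le> 2 * (\<tau> * X)"
        using mult_left_mono[of "\<Sum>j\<in>F. h x j" X "2 * \<tau>"] \<tau>(1) by (simp add: mult.assoc)
      then have A: "2 * \<tau> * (\<Sum>j\<in>F. h x j) \<le> \<rho> / 4"
        using \<tau>(3) by simp
      have "dist x i < r i / 2" using i unfolding F_def h_def by auto
      then show "ball x \<tau> \<subseteq> ball i (r i - 2 * \<tau> * (\<Sum>j\<in>F. h x j))"
        using A \<tau>(2) \<rho>(2)[OF iI] unfolding ball_subset_ball_iff dist_commute[of x i] by linarith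
    qed (use FI \<tau> in auto)
    have "\<rho> * c0 / 8 \<le> h x k * c k"
      using mult_mono[OF hk c0(2)[OF k(1)]] c0(1) hnn[of x k] by simp
    also have "\<dots> \<le> (\<Sum>i\<in>F. h x i * c i)"
    proof (rule member_le_sum)
      show "0 \<le> h x i * c i" if "i \<in> F - {k}" for i
        using hnn[of x i] ci(1)[of i] FI that by (auto intro!: mult_nonneg_nonneg)
    qed (use kF FI in auto)
    finally have C: "min 1 (\<rho> * c0 / 8) \<le> (\<Sum>i\<in>F. h x i * c i)" by simp
    show "inward_cone \<Omega> (ball x \<tau>) \<tau> (v x) (min 1 (\<rho> * c0 / 8))"
      unfolding inward_cone_def vF
    proof (intro ballI allI impI)
      fix y z :: 'a and t
      assume "y \<in> \<Omega> \<inter> ball x \<tau>" "0 \<le> t" "t \<le> \<tau>" "norm z \<le> min 1 (\<rho> * c0 / 8) * t"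
      then show "y + t *\<^sub>R (\<Sum>i\<in>F. h x i *\<^sub>R e i) + z \<in> \<Omega>"
        using mult_right_mono[OF C, of t] by (intro inward_coneD[OF cone]) auto
    qed
  qed
qed

section \<open>Reflection across the boundary along an inward field\<close>

text \<open>
  A Lipschitz vector field that points uniformly into \<open>\<Omega>\<close> at all points near \<open>\<Omega>\<close>.  It replaces the
  normal direction, which a Lipschitz boundary does not have.
\<close>

locale inward_field =
  fixes \<Omega> :: "'a::euclidean_space set" and v :: "'a \<Rightarrow> 'a" and c \<tau> L M :: real
  assumes open_dom: "open \<Omega>" and bounded_dom: "bounded \<Omega>" and nonempty_dom: "\<Omega> \<noteq> {}"
    and c_pos: "0 < c" and c_le_1: "c \<le> 1" and \<tau>_pos: "0 < \<tau>" and M_ge_1: "1 \<le> M" and L_nonneg: "0 \<le> L"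
    and v_lipschitz: "norm (v x - v y) \<le> L * norm (x - y)"
    and v_bound: "norm (v x) \<le> M"
    and cone: "infdist x \<Omega> < \<tau> \<Longrightarrow> inward_cone \<Omega> (ball x \<tau>) \<tau> (v x) c"
begin

abbreviation d :: "'a \<Rightarrow> real" where "d x \<equiv> infdist x \<Omega>"

text \<open>
  Moving by \<open>t\<close> along \<open>v\<close> brings a point closer to \<open>\<Omega>\<close> by \<open>c * t\<close>; the gain is chosen so that a
  displacement by \<open>gain * d x\<close> is worth twice the distance to \<open>\<Omega>\<close>.
\<close>

definition gain :: real where "gain = 2 / c"

text \<open>
  The width of the collar.  The first bound keeps all displacements within the range of the cones; the
  second makes the variation of \<open>v\<close> over a displacement negligible against the expansion of
  the reflection.
\<close>

definition \<delta> :: real where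
  "\<delta> = min (\<tau> / (2 * gain)) (1 / (4 * gain * (gain * M + 1) * (L + 1)))"

definition collar :: "'a set" where "collar = {x. d x < \<delta>}"

text \<open>
  A substitute for the reflection across the boundary.  The distance is augmented by the scale \<open>r\<close>, so
  that the image of every point of the collar is the centre of a ball of radius \<open>r\<close> contained in \<open>\<Omega>\<close>.
\<close>

definition reflect :: "real \<Rightarrow> 'a \<Rightarrow> 'a" where
  "reflect r x = x + (gain * (d x + r)) *\<^sub>R v x"

lemma lam: "2 \<le> gain" "c * gain = 2" "0 < gain"
  using c_pos c_le_1 by (auto simp: gain_def field_simps)

lemma \<delta>_pos: "0 < \<delta>"
  using lam \<tau>_pos M_ge_1 L_nonneg unfolding \<delta>_def by (auto intro!: mult_pos_pos add_nonneg_pos)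

lemma \<delta>_le: "2 * gain * \<delta> \<le> \<tau>" "4 * \<delta> \<le> \<tau>"
proof -
  have "\<delta> \<le> \<tau> / (2 * gain)" unfolding \<delta>_def by simp
  then show *: "2 * gain * \<delta> \<le> \<tau>" using lam by (simp add: field_simps)
  show "4 * \<delta> \<le> \<tau>" using * lam mult_right_mono[of 2 "gain" "2 * \<delta>"] \<delta>_pos by linarith
qed

lemma \<delta>_small: "2 * (gain * M + 1) * (2 * gain * \<delta> * L) \<le> 1"
proof -
  have p: "0 < 4 * gain * (gain * M + 1) * (L + 1)"
    using lam M_ge_1 L_nonneg by (intro mult_pos_pos add_nonneg_pos) auto
  have "\<delta> \<le> 1 / (4 * gain * (gain * M + 1) * (L + 1))" unfolding \<delta>_def by simp
  then have "4 * gain * (gain * M + 1) * (L + 1) * \<delta> \<le> 1"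
    using p by (simp add: pos_le_divide_eq mult.commute)
  moreover have "4 * gain * (gain * M + 1) * L * \<delta> \<le> 4 * gain * (gain * M + 1) * (L + 1) * \<delta>"
    using lam M_ge_1 L_nonneg \<delta>_pos by (intro mult_right_mono mult_left_mono) auto
  moreover have "2 * (gain * M + 1) * (2 * gain * \<delta> * L) = 4 * gain * (gain * M + 1) * L * \<delta>" by algebra
  ultimately show ?thesis by linarith
qed

lemma d_triangle: "d x \<le> d y + norm (x - y)"
  using infdist_triangle[of x \<Omega> y] by (simp add: dist_norm)

lemma d_le: "y \<in> \<Omega> \<Longrightarrow> d x \<le> norm (x - y)"
  using infdist_le[of y \<Omega> x] by (simp add: dist_norm)

lemma infdist_closure: "infdist x (closure \<Omega>) = d x"
  by (simp add: infdist_eq_setdist)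

lemma near_point:
  assumes "0 < r"
  obtains y where "y \<in> \<Omega>" "norm (x - y) < d x + r"
  using infdist_lessE[OF nonempty_dom, of x "d x + r"] assms by (auto simp: dist_norm)

lemma open_collar: "open collar"
  unfolding collar_def by (intro open_Collect_less continuous_intros)

lemma dom_subset_collar: "\<Omega> \<subseteq> collar"
  using \<delta>_pos unfolding collar_def by auto

lemma bounded_collar: "bounded collar"
proof -
  obtain R where R: "\<And>y. y \<in> \<Omega> \<Longrightarrow> norm y \<le> R"
    using bounded_dom bounded_iff by blast
  show ?thesis
    unfolding bounded_iff
  proof (intro exI ballI)
    fix x assume "x \<in> collar"
    obtain y where y: "y \<in> \<Omega>" "norm (x - y) < d x + 1" using near_point[of 1 x] by auto
    have "norm x \<le> norm (x - y) + norm y" using norm_triangle_ineq[of "x - y" y] by simp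
    then show "norm x \<le> R + \<delta> + 1" using R[OF y(1)] y(2) \<open>x \<in> collar\<close> unfolding collar_def by simp
  qed
qed

text \<open>
  Start from a point \<open>y\<close> of \<open>\<Omega>\<close> at distance less than \<open>d x + r\<close> from \<open>x\<close>.  The reflection follows the axis
  of the cone at \<open>y\<close>, and at this height the cone is \<open>2 * (d x + r)\<close> wide, which absorbs both the offset
  \<open>x - y\<close> and a ball of radius \<open>r\<close>.
\<close>

lemma cball_reflect_subset:
  assumes x: "x \<in> collar" and r: "0 < r" "r \<le> \<delta>"
  shows "cball (reflect r x) r \<subseteq> \<Omega>"
proof
  fix a assume a: "a \<in> cball (reflect r x) r"
  have dx: "d x < \<delta>" using x by (simp add: collar_def)
  obtain y where y: "y \<in> \<Omega>" "norm (x - y) < d x + r" using near_point[OF r(1)] .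
  have "y \<in> ball x \<tau>" using y(2) dx r \<delta>_le(2) \<delta>_pos by (simp add: dist_norm)
  moreover have "gain * (d x + r) \<le> \<tau>"
    using mult_left_mono[of "d x + r" "2 * \<delta>" "gain"] dx r lam \<delta>_le(1) by linarith
  moreover have "norm ((x - y) + (a - reflect r x)) \<le> c * (gain * (d x + r))"
  proof -
    have "norm ((x - y) + (a - reflect r x)) \<le> (d x + r) + r"
      using norm_triangle_ineq[of "x - y" "a - reflect r x"] y a by (simp add: dist_norm norm_minus_commute)
    also have "\<dots> \<le> 2 * (d x + r)" using infdist_nonneg[of x \<Omega>] by simp
    also have "\<dots> = c * (gain * (d x + r))" using lam(2) by (metis mult.assoc)
    finally show ?thesis .
  qed
  moreover have "d x < \<tau>" using dx \<delta>_le(2) \<delta>_pos by linarith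
  ultimately have "y + (gain * (d x + r)) *\<^sub>R v x + ((x - y) + (a - reflect r x)) \<in> \<Omega>"
    using y(1) lam r infdist_nonneg[of x \<Omega>] by (intro inward_coneD[OF cone]) auto
  then show "a \<in> \<Omega>" by (simp add: reflect_def algebra_simps)
qed

lemma norm_reflect_diff:
  assumes "0 \<le> r"
  shows "norm (reflect r x - x) \<le> gain * M * (d x + r)"
proof -
  have "norm (reflect r x - x) = gain * (d x + r) * norm (v x)"
    using assms lam infdist_nonneg[of x \<Omega>] by (simp add: reflect_def)
  also have "\<dots> \<le> gain * (d x + r) * M"
    using assms lam infdist_nonneg[of x \<Omega>] v_bound by (intro mult_left_mono) auto
  finally show ?thesis by (simp add: mult_ac)
qed

lemma reflect_diff_decomp:
  "reflect r x - reflect r y = (x - y) + (gain * (d x - d y)) *\<^sub>R v x + (gain * (d y + r)) *\<^sub>R (v x - v y)"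
  by (simp add: reflect_def algebra_simps)

lemma reflect_field_error:
  assumes "y \<in> collar" "0 < r" "r \<le> \<delta>"
  shows "norm ((gain * (d y + r)) *\<^sub>R (v x - v y)) \<le> 2 * gain * \<delta> * L * norm (x - y)"
proof -
  have "norm ((gain * (d y + r)) *\<^sub>R (v x - v y)) = gain * (d y + r) * norm (v x - v y)"
    using assms lam infdist_nonneg[of y \<Omega>] by simp
  also have "\<dots> \<le> gain * (2 * \<delta>) * (L * norm (x - y))"
    using assms lam infdist_nonneg[of y \<Omega>] v_lipschitz \<delta>_pos
    by (intro mult_mono) (auto simp: collar_def)
  finally show ?thesis by (simp add: mult_ac)
qed

lemma reflect_lipschitz:
  assumes "y \<in> collar" "0 < r" "r \<le> \<delta>"
  shows "norm (reflect r x - reflect r y) \<le> (2 + gain * M) * norm (x - y)"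
proof -
  have "\<bar>d x - d y\<bar> \<le> norm (x - y)"
    using d_triangle[of x y] d_triangle[of y x] by (simp add: norm_minus_commute abs_le_iff)
  then have "norm ((gain * (d x - d y)) *\<^sub>R v x) \<le> gain * norm (x - y) * M"
    using lam v_bound[of x] by (simp add: abs_mult mult_mono)
  moreover have "2 * gain * \<delta> * L * norm (x - y) \<le> 1 * norm (x - y)"
  proof (rule mult_right_mono)
    have "1 * (2 * gain * \<delta> * L) \<le> 2 * (gain * M + 1) * (2 * gain * \<delta> * L)"
      using lam M_ge_1 \<delta>_pos L_nonneg by (intro mult_right_mono) auto
    then show "2 * gain * \<delta> * L \<le> 1" using \<delta>_small by linarith
  qed simp
  ultimately have "norm (reflect r x - reflect r y) \<le> norm (x - y) + gain * norm (x - y) * M + 1 * norm (x - y)"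
    unfolding reflect_diff_decomp
    using norm_triangle_ineq[of "x - y + (gain * (d x - d y)) *\<^sub>R v x" "(gain * (d y + r)) *\<^sub>R (v x - v y)"]
      norm_triangle_ineq[of "x - y" "(gain * (d x - d y)) *\<^sub>R v x"] reflect_field_error[OF assms, of x]
    by linarith
  then show ?thesis by (simp add: algebra_simps)
qed

text \<open>
  If \<open>x\<close> and \<open>y\<close> have close images, then up to a small error \<open>E\<close> the point \<open>y\<close> lies on the ray from \<open>x\<close>
  along \<open>v x\<close>, at parameter \<open>\<sigma> = gain * (d x - d y)\<close>.  But a step of length \<open>\<sigma>\<close> along the field lowers the
  distance to \<open>\<Omega>\<close> by \<open>c * \<sigma> = 2 * (d x - d y)\<close>, twice the actual difference.  Hence \<open>d x - d y\<close>, and with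
  it \<open>\<sigma>\<close> and \<open>x - y\<close>, is controlled by the error.
\<close>

lemma reflect_expansive_aux:
  assumes x: "x \<in> collar" and y: "y \<in> collar - \<Omega>" and r: "0 < r" "r \<le> \<delta>" and le: "d y \<le> d x"
  shows "norm (x - y) \<le> 2 * (gain * M + 1) * norm (reflect r x - reflect r y)"
proof -
  define \<sigma> where "\<sigma> = gain * (d x - d y)"
  define E where "E = reflect r x - reflect r y - (gain * (d y + r)) *\<^sub>R (v x - v y)"
  have xy: "x - y = E - \<sigma> *\<^sub>R v x"
    unfolding E_def \<sigma>_def reflect_diff_decomp by simp
  have dx: "d x < \<delta>" using x by (simp add: collar_def)
  have \<sigma>0: "0 \<le> \<sigma>" unfolding \<sigma>_def using lam le by simp
  have "\<sigma> \<le> gain * \<delta>"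
    unfolding \<sigma>_def using lam dx infdist_nonneg[of y \<Omega>] by (intro mult_left_mono) auto
  then have \<sigma>\<tau>: "\<sigma> \<le> \<tau>" using \<delta>_le(1) lam \<delta>_pos mult_nonneg_nonneg[of "gain" \<delta>] by linarith
  \<comment> \<open>the point reached from \<open>x\<close> is at depth \<open>c * \<sigma> - d x\<close> inside \<open>\<Omega>\<close>, while \<open>y\<close> is at distance \<open>d y\<close> outside\<close>
  have key: "c * \<sigma> + d y \<le> d x + norm E"
  proof (rule field_le_epsilon)
    fix e :: real assume e: "0 < e"
    define e' where "e' = min e \<delta>"
    have e': "0 < e'" "e' \<le> e" "e' \<le> \<delta>" using e \<delta>_pos by (auto simp: e'_def)
    obtain y' where y': "y' \<in> \<Omega>" "norm (x - y') < d x + e'" using near_point[OF e'(1)] .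
    have y'B: "y' \<in> ball x \<tau>" using y'(2) dx e' \<delta>_le(2) \<delta>_pos by (simp add: dist_norm)
    have push: "y' + \<sigma> *\<^sub>R v x + w \<in> \<Omega>" if "norm w \<le> c * \<sigma>" for w
      using dx \<delta>_le(2) \<delta>_pos that by (intro inward_coneD[OF cone _ y'B \<sigma>0 \<sigma>\<tau>] y'(1)) auto
    define z where "z = y - (y' + \<sigma> *\<^sub>R v x)"
    have zpos: "norm z > c * \<sigma>"
    proof (rule ccontr)
      assume "\<not> norm z > c * \<sigma>"
      then have "y' + \<sigma> *\<^sub>R v x + z \<in> \<Omega>" by (intro push) simp
      then show False using y by (simp add: z_def)
    qed
    have c\<sigma>: "0 \<le> c * \<sigma>" using c_pos \<sigma>0 by simp
    \<comment> \<open>\<open>w\<close> leads to the point of the pushed ball nearest to \<open>y\<close>\<close>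
    define w where "w = (c * \<sigma> / norm z) *\<^sub>R z"
    have nz: "norm z > 0" using zpos c\<sigma> by linarith
    have nw: "norm w = c * \<sigma>" unfolding w_def using nz c\<sigma> by simp
    have "norm (z - w) = norm z - c * \<sigma>"
    proof -
      have "z - w = (1 - c * \<sigma> / norm z) *\<^sub>R z" by (simp add: w_def scaleR_left_diff_distrib)
      then have "norm (z - w) = \<bar>1 - c * \<sigma> / norm z\<bar> * norm z" by simp
      also have "\<dots> = (1 - c * \<sigma> / norm z) * norm z" using zpos nz by simp
      also have "\<dots> = norm z - c * \<sigma>" using nz by (simp add: left_diff_distrib)
      finally show ?thesis .
    qed
    moreover have "d y \<le> norm (y - (y' + \<sigma> *\<^sub>R v x + w))"
      using nw by (intro d_le push) simp
    moreover have "y - (y' + \<sigma> *\<^sub>R v x + w) = z - w" by (simp add: z_def)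
    ultimately have "d y \<le> norm z - c * \<sigma>" by simp
    moreover have "z = (x - y') - E"
    proof -
      have "y = x - (E - \<sigma> *\<^sub>R v x)" using xy by (metis diff_diff_eq2 add_diff_cancel_left')
      then show ?thesis unfolding z_def by (simp only:) simp
    qed
    ultimately show "c * \<sigma> + d y \<le> d x + norm E + e"
      using norm_triangle_ineq4[of "x - y'" E] y'(2) e' by simp
  qed
  have "\<sigma> \<le> gain * norm E"
  proof -
    have "c * \<sigma> = 2 * (d x - d y)" unfolding \<sigma>_def using lam(2) by (metis mult.assoc)
    then have "d x - d y \<le> norm E" using key by simp
    then show ?thesis unfolding \<sigma>_def using lam by simp
  qed
  then have "\<sigma> * norm (v x) \<le> gain * norm E * M"
    using v_bound[of x] lam by (intro mult_mono) auto
  then have A: "norm (x - y) \<le> (gain * M + 1) * norm E"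
    unfolding xy using norm_triangle_ineq4[of E "\<sigma> *\<^sub>R v x"] \<sigma>0 by (simp add: algebra_simps)
  have "norm E \<le> norm (reflect r x - reflect r y) + 2 * gain * \<delta> * L * norm (x - y)"
    unfolding E_def using norm_triangle_ineq4[of "reflect r x - reflect r y" "(gain * (d y + r)) *\<^sub>R (v x - v y)"]
      reflect_field_error[of y r x] y r by simp
  then have "2 * (gain * M + 1) * norm E
      \<le> 2 * (gain * M + 1) * (norm (reflect r x - reflect r y) + 2 * gain * \<delta> * L * norm (x - y))"
    using lam M_ge_1 by (intro mult_left_mono) auto
  also have "\<dots> = 2 * (gain * M + 1) * norm (reflect r x - reflect r y)
      + 2 * (gain * M + 1) * (2 * gain * \<delta> * L) * norm (x - y)"
    by (simp only: distrib_left mult.assoc)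
  also have "2 * (gain * M + 1) * (2 * gain * \<delta> * L) * norm (x - y) \<le> 1 * norm (x - y)"
    by (rule mult_right_mono[OF \<delta>_small]) simp
  finally show ?thesis using A by linarith
qed

lemma reflect_expansive:
  assumes "x \<in> collar - \<Omega>" "y \<in> collar - \<Omega>" "0 < r" "r \<le> \<delta>"
  shows "norm (x - y) \<le> 2 * (gain * M + 1) * norm (reflect r x - reflect r y)"
  using reflect_expansive_aux[of x y r] reflect_expansive_aux[of y x r] assms
  by (cases "d y \<le> d x") (auto simp: norm_minus_commute)

text \<open>
  The exterior part of the collar has positive volume density at each of its points.  In its inner half
  a ball is found by moving against the field: if the ball met \<open>\<Omega>\<close>, the cone at the common point
  would contain \<open>x\<close>.  In its outer half one moves towards a nearest point of the closure instead, in order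
  not to leave the collar.
\<close>

lemma exterior_ball:
  assumes x: "x \<in> collar - \<Omega>" and r: "0 < r" "r \<le> \<delta> / 2"
  obtains z where "ball z (c / (M + c) * r) \<subseteq> (collar - \<Omega>) \<inter> ball x r"
proof (cases "d x < \<delta> / 2")
  case True
  define t where "t = r / (M + c)"
  have Mc: "1 \<le> M + c" using M_ge_1 c_pos by simp
  have t: "0 < t" "t \<le> r" "t * (M + c) = r"
    using r Mc mult_left_mono[OF Mc, of r] unfolding t_def by (auto simp: divide_le_eq)
  define z where "z = x - t *\<^sub>R v x"
  have "ball z (c * t) \<subseteq> (collar - \<Omega>) \<inter> ball x r"
  proof
    fix q assume q: "q \<in> ball z (c * t)"
    have zx: "norm (z - x) \<le> t * M" unfolding z_def using t v_bound[of x] by simp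
    have qz: "norm (z - q) < c * t" using q by (simp add: dist_norm)
    have "norm (x - q) \<le> norm (z - x) + norm (z - q)"
      using norm_triangle_ineq4[of "z - q" "z - x"] by (simp add: algebra_simps)
    then have xq: "norm (x - q) < r" using zx qz t(3) by (simp add: algebra_simps)
    have "d q < \<delta>" using d_triangle[of q x] xq True r by (simp add: norm_minus_commute)
    moreover have "q \<notin> \<Omega>"
    proof
      assume "q \<in> \<Omega>"
      moreover have "q \<in> ball x \<tau>" using xq r \<delta>_le(2) \<delta>_pos by (simp add: dist_norm)
      moreover have "t \<le> \<tau>" using t(2) r \<delta>_le(2) \<delta>_pos by linarith
      moreover have "d x < \<tau>" using True \<delta>_le(2) \<delta>_pos by linarith
      ultimately have "q + t *\<^sub>R v x + (z - q) \<in> \<Omega>"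
        using t qz by (intro inward_coneD[OF cone]) auto
      then show False using x by (simp add: z_def)
    qed
    ultimately show "q \<in> (collar - \<Omega>) \<inter> ball x r" using xq by (simp add: collar_def dist_norm)
  qed
  moreover have "c * t = c / (M + c) * r" by (simp add: t_def)
  ultimately show ?thesis using that by simp
next
  case False
  obtain b where b: "b \<in> closure \<Omega>" "d x = dist x b"
    using infdist_attains_inf[of "closure \<Omega>" x] nonempty_dom by (auto simp: infdist_closure)
  define z where "z = x + ((r/2) / d x) *\<^sub>R (b - x)"
  have dx: "d x > 0" "r \<le> d x" using False \<delta>_pos r by auto
  have bx: "norm (b - x) = d x" using b by (simp add: dist_norm norm_minus_commute)
  have zx: "norm (z - x) = r / 2" unfolding z_def using dx r bx by simp
  have zb: "norm (z - b) = d x - r / 2"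
  proof -
    have "z - b = ((r/2) / d x - 1) *\<^sub>R (b - x)" by (simp add: z_def algebra_simps)
    then have "norm (z - b) = \<bar>(r/2) / d x - 1\<bar> * d x" using bx by simp
    also have "\<dots> = (1 - (r/2) / d x) * d x" using dx r by (simp add: abs_if field_simps)
    also have "\<dots> = d x - r / 2" using dx by (simp add: field_simps)
    finally show ?thesis .
  qed
  have "ball z (r / 2) \<subseteq> (collar - \<Omega>) \<inter> ball x r"
  proof
    fix q assume q: "q \<in> ball z (r / 2)"
    then have qz: "norm (q - z) < r / 2" by (simp add: dist_norm norm_minus_commute)
    have "d q \<le> norm (q - b)"
      using infdist_le[OF b(1), of q] by (simp add: infdist_closure dist_norm)
    also have "\<dots> < d x" using norm_triangle_ineq[of "q - z" "z - b"] qz zb by simp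
    finally have "d q < \<delta>" using x by (simp add: collar_def)
    moreover have xq: "norm (x - q) < r"
      using norm_triangle_ineq4[of "z - x" "z - q"] qz zx by (simp add: norm_minus_commute)
    moreover have "0 < d q" using d_triangle[of x q] xq False r by simp
    then have "q \<notin> \<Omega>" by auto
    ultimately show "q \<in> (collar - \<Omega>) \<inter> ball x r" by (simp add: collar_def dist_norm)
  qed
  moreover have "c / (M + c) * r \<le> r / 2"
  proof -
    have "c / (M + c) \<le> 1 / 2" using c_pos c_le_1 M_ge_1 by (simp add: field_simps)
    then show ?thesis using mult_right_mono[of _ "1/2" r] r by fastforce
  qed
  ultimately show ?thesis using that subset_ball by (meson order_trans)
qed

lemma exterior_nonempty: "collar - \<Omega> \<noteq> {}"
proof -
  have "\<Omega> \<noteq> UNIV" using bounded_dom not_bounded_UNIV by metis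
  then obtain b where b: "b \<in> frontier \<Omega>" using frontier_eq_empty nonempty_dom by blast
  then have "b \<in> closure \<Omega>" "b \<notin> \<Omega>" using open_dom by (auto simp: frontier_def interior_open)
  moreover from this have "d b = 0" using in_closure_iff_infdist_zero[OF nonempty_dom] by simp
  ultimately have "b \<in> collar - \<Omega>" using \<delta>_pos by (simp add: collar_def)
  then show ?thesis by blast
qed

end

lemma lipschitz_domain_inward_field:
  fixes \<Omega> :: "(real ^ 'd) set"
  assumes "open \<Omega>" "bounded \<Omega>" "lipschitz_boundary \<Omega>" "\<Omega> \<noteq> {}"
  obtains v c \<tau> L M where "inward_field \<Omega> v c \<tau> L M"
proof -
  have loc: "\<exists>e c r. norm e \<le> 1 \<and> 0 < c \<and> c \<le> 1 \<and> 0 < r \<and> inward_cone \<Omega> (ball x r) r e c"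
    if "x \<in> closure \<Omega>" for x
  proof (cases "x \<in> \<Omega>")
    case True
    then show ?thesis using inward_cone_interior[OF assms(1) True] by (metis norm_zero zero_le_one)
  next
    case False
    then have "x \<in> frontier \<Omega>" using that assms(1) by (simp add: frontier_def interior_open)
    then show ?thesis using inward_cone_frontier[OF assms(3)] by (metis order_refl)
  qed
  show ?thesis
  proof (rule inward_field_exists[OF assms(2) loc])
    fix v :: "real ^ 'd \<Rightarrow> real ^ 'd" and c \<tau> L M
    assume field: "0 < c" "c \<le> 1" "0 < \<tau>" "1 \<le> M" "0 \<le> L"
      "\<And>x y. norm (v x - v y) \<le> L * norm (x - y)" "\<And>x. norm (v x) \<le> M"
      "\<And>x. infdist x \<Omega> < \<tau> \<Longrightarrow> inward_cone \<Omega> (ball x \<tau>) \<tau> (v x) c"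
    have "inward_field \<Omega> v c \<tau> L M"
      by unfold_locales (fact assms(1) assms(2) assms(4) field)+
    then show ?thesis by (rule that)
  qed
qed

section \<open>Nets and partitions into pieces of equal volume\<close>

lemma bounded_borel_fmeasurable:
  fixes A :: "'a::euclidean_space set"
  assumes "bounded A" "A \<in> sets borel"
  shows "A \<in> fmeasurable lborel"
  using emeasure_bounded_finite[OF assms(1)] assms(2) by (intro fmeasurableI) auto

text \<open>
  A separated set injects into a finite cover by balls of half the separation, so a separated set of
  maximal cardinality exists; by maximality it is a net.
\<close>

lemma separated_net_exists:
  fixes A :: "'a::euclidean_space set"
  assumes "bounded A" "0 < r"
  obtains P where "finite P" "P \<subseteq> A" "\<And>p q. p \<in> P \<Longrightarrow> q \<in> P \<Longrightarrow> p \<noteq> q \<Longrightarrow> 2 * r \<le> dist p q"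
    "A \<subseteq> (\<Union>p\<in>P. ball p (2 * r))"
proof -
  have "compact (closure A)" using assms(1) by (simp add: compact_closure)
  then obtain k where k: "finite k" "closure A \<subseteq> (\<Union>x\<in>k. ball x r)"
    using assms(2) unfolding compact_eq_totally_bounded by meson
  define sep where "sep P \<longleftrightarrow> finite P \<and> P \<subseteq> A \<and> (\<forall>p\<in>P. \<forall>q\<in>P. p \<noteq> q \<longrightarrow> 2 * r \<le> dist p q)" for P
  have bound: "card P \<le> card k" if P: "sep P" for P
  proof -
    have "\<exists>x\<in>k. p \<in> ball x r" if "p \<in> P" for p
      using k(2) closure_subset P that unfolding sep_def by blast
    then obtain f where f: "\<And>p. p \<in> P \<Longrightarrow> f p \<in> k" "\<And>p. p \<in> P \<Longrightarrow> dist (f p) p < r"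
      by (metis mem_ball)
    have "inj_on f P"
    proof (rule inj_onI, rule ccontr)
      fix p q assume pq: "p \<in> P" "q \<in> P" "f p = f q" "p \<noteq> q"
      then have "2 * r \<le> dist p q" using P unfolding sep_def by blast
      then show False
        using dist_triangle3[of p q "f p"] f(2)[OF pq(1)] f(2)[OF pq(2)] pq(3) by simp
    qed
    then show ?thesis using f(1) k(1) by (intro card_inj_on_le[of f]) auto
  qed
  have "sep {}" by (simp add: sep_def)
  then obtain P where P: "sep P" "\<And>P'. sep P' \<Longrightarrow> card P' \<le> card P"
    using ex_has_greatest_nat[of sep "{}" card "Suc (card k)"] bound by (auto simp: less_Suc_eq_le)
  have "A \<subseteq> (\<Union>p\<in>P. ball p (2 * r))"
  proof
    fix x assume x: "x \<in> A"
    show "x \<in> (\<Union>p\<in>P. ball p (2 * r))"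
    proof (rule ccontr)
      assume "x \<notin> (\<Union>p\<in>P. ball p (2 * r))"
      then have far: "\<And>p. p \<in> P \<Longrightarrow> 2 * r \<le> dist p x" by (auto simp: not_less)
      then have "x \<notin> P" using assms(2) by fastforce
      moreover have "sep (insert x P)"
        using P(1) far x unfolding sep_def by (auto simp: dist_commute)
      then have "card (insert x P) \<le> card P" by (rule P(2))
      ultimately show False using P(1) by (simp add: sep_def)
    qed
  qed
  then show ?thesis using that P(1) unfolding sep_def by blast
qed

text \<open>
  Each point goes to the centre of the core ball of radius \<open>r\<close> that contains it, if there is
  one, and otherwise to the first centre, in some enumeration \<open>f\<close> of the net, within distance
  \<open>2 * r\<close>.  This produces Borel pieces that are both small and not too thin.
\<close>

lemma net_partition:
  fixes A :: "'a::euclidean_space set"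
  assumes "bounded A" "A \<in> sets borel" "0 < r"
  obtains P G where "finite P" "P \<subseteq> A" "disjoint_family_on G P" "(\<Union>p\<in>P. G p) = A"
    "\<And>p. p \<in> P \<Longrightarrow> G p \<in> sets borel" "\<And>p. p \<in> P \<Longrightarrow> A \<inter> ball p r \<subseteq> G p"
    "\<And>p. p \<in> P \<Longrightarrow> G p \<subseteq> ball p (2 * r)"
proof -
  obtain P where P: "finite P" "P \<subseteq> A" "\<And>p q. p \<in> P \<Longrightarrow> q \<in> P \<Longrightarrow> p \<noteq> q \<Longrightarrow> 2 * r \<le> dist p q"
    "A \<subseteq> (\<Union>p\<in>P. ball p (2 * r))"
    by (rule separated_net_exists[OF assms(1,3)]) blast
  obtain f :: "'a \<Rightarrow> nat" where f: "inj_on f P"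
    using finite_imp_inj_to_nat_seg[OF P(1)] by blast
  define G where "G p = A \<inter> (ball p r \<union>
      (ball p (2 * r) - (\<Union>q\<in>P. ball q r) - (\<Union>q\<in>{q\<in>P. f q < f p}. ball q (2 * r))))" for p
  have disj_core: "p = q" if "p \<in> P" "q \<in> P" "x \<in> ball p r" "x \<in> ball q r" for p q x
    using P(3)[OF that(1,2)] that dist_triangle[of p q x] by (fastforce simp: dist_commute)
  have one: "p = q" if "p \<in> P" "q \<in> P" "x \<in> G p" "x \<in> G q" for p q x
  proof (cases "x \<in> ball p r \<or> x \<in> ball q r")
    case True
    then have "x \<in> ball p r" "x \<in> ball q r" using that unfolding G_def by blast+
    then show ?thesis using disj_core that by blast
  next
    case False
    then have "\<not> f q < f p" "\<not> f p < f q" using that unfolding G_def by blast+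
    then show ?thesis using f that by (simp add: inj_on_eq_iff)
  qed
  show ?thesis
  proof (rule that[OF P(1,2)])
    show "disjoint_family_on G P" unfolding disjoint_family_on_def using one by blast
    show "(\<Union>p\<in>P. G p) = A"
    proof
      show "A \<subseteq> (\<Union>p\<in>P. G p)"
      proof
        fix x assume x: "x \<in> A"
        show "x \<in> (\<Union>p\<in>P. G p)"
        proof (cases "\<exists>q\<in>P. x \<in> ball q r")
          case True
          then show ?thesis using x unfolding G_def by blast
        next
          case False
          define R where "R = {p\<in>P. x \<in> ball p (2 * r)}"
          obtain p0 where "p0 \<in> P" "x \<in> ball p0 (2 * r)" using P(4) x by blast
          then have R: "finite R" "R \<noteq> {}" using P(1) unfolding R_def by auto
          obtain p where p: "p \<in> R" "\<And>q. q \<in> R \<Longrightarrow> \<not> f q < f p"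
            using ex_is_arg_min_if_finite[OF R, of f] unfolding is_arg_min_def by blast
          then have "p \<in> P" "x \<in> ball p (2 * r)" by (auto simp: R_def)
          moreover have "x \<notin> ball q (2 * r)" if "q \<in> P" "f q < f p" for q
            using p(2)[of q] that by (auto simp: R_def)
          ultimately show ?thesis using x False unfolding G_def by blast
        qed
      qed
    qed (auto simp: G_def)
    fix p assume "p \<in> P"
    show "G p \<in> sets borel"
      unfolding G_def by (intro sets.Int[OF assms(2)] sets.Un sets.Diff borel_open open_UN) auto
    show "A \<inter> ball p r \<subseteq> G p" unfolding G_def by blast
    show "G p \<subseteq> ball p (2 * r)" unfolding G_def using subset_ball[of r "2 * r" p] assms(3) by auto
  qed
qed

text \<open>
  Lebesgue measure is non-atomic: hyperplanes are null, so the mass of \<open>A\<close> below a moving hyperplane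
  varies continuously, and the intermediate value theorem applies.
\<close>

lemma lborel_subset_of_measure:
  fixes A :: "'a::euclidean_space set"
  assumes A: "A \<in> fmeasurable lborel" and a: "0 \<le> a" "a \<le> measure lborel A"
  obtains B where "B \<in> sets borel" "B \<subseteq> A" "measure lborel B = a"
proof (cases "a = 0 \<or> a = measure lborel A")
  case True
  then show ?thesis using that[of "{}"] that[of A] A by auto
next
  case False
  with a have a: "0 < a" "a < measure lborel A" by auto
  obtain b :: 'a where b: "b \<in> Basis" using nonempty_Basis by blast
  define N where "N = density lborel (indicator A :: 'a \<Rightarrow> ennreal)"
  define M where "M = distr N borel (\<lambda>x. x \<bullet> b)"
  have Ab: "A \<in> sets borel" using A by auto
  have N: "measure N X = measure lborel (A \<inter> X)" if "X \<in> sets borel" for X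
    using that Ab unfolding N_def by (simp add: measure_def emeasure_restricted)
  have emN: "emeasure N UNIV = emeasure lborel A"
    unfolding N_def using Ab by (simp add: emeasure_density)
  have M: "measure M X = measure lborel (A \<inter> {x. x \<bullet> b \<in> X})" if "X \<in> sets borel" for X
  proof -
    have "{x::'a. x \<bullet> b \<in> X} \<in> sets borel"
      using measurable_sets[of "\<lambda>x::'a. x \<bullet> b" borel borel X] that by (simp add: vimage_def)
    then show ?thesis unfolding M_def using that N
      by (subst measure_distr) (auto simp: N_def vimage_def)
  qed
  have "finite_measure N"
    by (rule finite_measureI) (use emN A in \<open>auto simp: N_def fmeasurable_def\<close>)
  then have "finite_measure M"
    unfolding M_def by (intro finite_measure.finite_measure_distr) (auto simp: N_def)
  then interpret M: finite_borel_measure M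
    unfolding finite_borel_measure_def finite_borel_measure_axioms_def by (simp add: M_def)
  have "measure M {t} = 0" for t
  proof -
    have "{x::'a. x \<bullet> b = t} \<in> null_sets lebesgue"
      using negligible_standard_hyperplane[OF b, of t] by (simp add: negligible_iff_null_sets)
    moreover have "{x::'a. x \<bullet> b = t} \<in> sets borel" by (intro borel_closed closed_Collect_eq continuous_intros)
    ultimately have "{x::'a. x \<bullet> b = t} \<in> null_sets lborel"
      by (simp add: null_sets_completion_iff)
    then have "A \<inter> {x. x \<bullet> b = t} \<in> null_sets lborel"
      using Ab by (metis Int_commute null_set_Int1 sets_lborel)
    then show ?thesis by (simp add: M measure_eq_0_null_sets)
  qed
  then have cont: "continuous_on {x..y} (cdf M)" for x y
    using M.isCont_cdf by (simp add: continuous_at_imp_continuous_on)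
  have "measure M (space M) = measure lborel A"
    using M[of UNIV] by (simp add: M_def)
  then have "eventually (\<lambda>t. a < cdf M t) at_top"
    using order_tendstoD(1)[OF M.cdf_lim_at_top] a by simp
  then obtain t2 where t2: "a < cdf M t2" using eventually_happens by fastforce
  have "eventually (\<lambda>t. cdf M t < a) at_bot"
    using order_tendstoD(2)[OF M.cdf_lim_at_bot] a by simp
  then obtain t1 where t1: "cdf M t1 < a" using eventually_happens by fastforce
  have "t1 \<le> t2" using t1 t2 M.cdf_nondecreasing[of t2 t1] by linarith
  then obtain t where "cdf M t = a"
    using IVT'[of "cdf M" t1 a t2] t1 t2 cont by auto
  then have "measure lborel (A \<inter> {x. x \<bullet> b \<le> t}) = a"
    unfolding cdf_def by (simp add: M)
  moreover have "A \<inter> {x. x \<bullet> b \<le> t} \<in> sets borel"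
    by (intro sets.Int[OF Ab] borel_closed closed_Collect_le continuous_intros)
  ultimately show ?thesis using that by blast
qed

lemma lborel_equipartition:
  fixes A :: "'a::euclidean_space set"
  assumes "A \<in> fmeasurable lborel" "0 < a" "measure lborel A = real k * a" "0 < k"
  shows "\<exists>P B. finite P \<and> disjoint_family_on B P \<and> (\<Union>p\<in>P. B p) = A \<and>
           (\<forall>p\<in>P. p \<in> B p \<and> B p \<in> sets borel \<and> measure lborel (B p) = a)"
  using assms(4,1,3)
proof (induction k arbitrary: A rule: nat_induct_non_zero)
  case 1
  then have "A \<noteq> {}" using assms(2) by auto
  then obtain p where "p \<in> A" by blast
  then show ?case using 1
    by (intro exI[of _ "{p}"] exI[of _ "\<lambda>_. A"]) (auto simp: disjoint_family_on_def)
next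
  case (Suc k)
  obtain A1 where A1: "A1 \<in> sets borel" "A1 \<subseteq> A" "measure lborel A1 = a"
    using lborel_subset_of_measure[of A a] Suc.prems assms(2) by (auto simp: algebra_simps)
  have A1f: "A1 \<in> fmeasurable lborel"
    using fmeasurableI2[OF Suc.prems(1) A1(2)] A1(1) by simp
  have A2f: "A - A1 \<in> fmeasurable lborel"
    using Suc.prems(1) A1(1) by (simp add: fmeasurable_Diff)
  have "measure lborel (A - A1) = real k * a"
    using measurable_measure_Diff[OF Suc.prems(1) _ A1(2)] A1 Suc.prems(2) by (simp add: algebra_simps)
  then obtain P B where PB: "finite P" "disjoint_family_on B P" "(\<Union>p\<in>P. B p) = A - A1"
    "\<forall>p\<in>P. p \<in> B p \<and> B p \<in> sets borel \<and> measure lborel (B p) = a"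
    using Suc.IH[OF A2f] by auto
  obtain o1 where o1: "o1 \<in> A1" using A1(3) assms(2) by fastforce
  have "o1 \<notin> P" using PB(3,4) o1 by blast
  show ?case
  proof (intro exI[of _ "insert o1 P"] exI[of _ "B(o1 := A1)"] conjI)
    show "disjoint_family_on (B(o1 := A1)) (insert o1 P)"
      using PB(2,3) unfolding disjoint_family_on_def by (auto; blast)
    show "(\<Union>p\<in>insert o1 P. (B(o1 := A1)) p) = A"
      using PB(3) A1(2) \<open>o1 \<notin> P\<close> by (auto split: if_splits)
  qed (use PB A1 o1 \<open>o1 \<notin> P\<close> in auto)
qed

section \<open>Exterior cells and interior reservoirs\<close>

text \<open>
  The geometric data at scale \<open>r\<close>.  The set \<open>E\<close> is cut into cells \<open>G p\<close> of diameter \<open>O(r)\<close>, named by one of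
  their points, and to each cell belongs a reservoir \<open>Q p\<close> inside \<open>\<Omega>\<close>, over which functions on \<open>\<Omega>\<close> will be
  averaged.  Distances between reservoirs, and between reservoirs and points of \<open>\<Omega>\<close>, are controlled by the
  distances on the side of the cells, up to \<open>O(r)\<close>.  The last clause says that spreading the volume of
  each cell uniformly over its reservoir yields a density at most \<open>C\<close>.  All clauses persist when a cell
  is subdivided and its parts inherit the reservoir.
\<close>

definition cell_system ::
  "'a::euclidean_space set \<Rightarrow> 'a set \<Rightarrow> real \<Rightarrow> real \<Rightarrow> 'a set \<Rightarrow> ('a \<Rightarrow> 'a set) \<Rightarrow> ('a \<Rightarrow> 'a set) \<Rightarrow> bool" where
  "cell_system \<Omega> E C r P G Q \<longleftrightarrow>
     finite P \<and> disjoint_family_on G P \<and> (\<Union>p\<in>P. G p) = E \<and>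
     (\<forall>p\<in>P. p \<in> G p \<and> G p \<in> sets borel \<and> Q p \<in> sets borel \<and> Q p \<subseteq> \<Omega> \<and> 0 < measure lborel (Q p)) \<and>
     (\<forall>p\<in>P. \<forall>x\<in>G p. \<forall>y\<in>G p. norm (x - y) \<le> C * r) \<and>
     (\<forall>p\<in>P. \<forall>q\<in>P. \<forall>x\<in>G p. \<forall>y\<in>G q. \<forall>a\<in>Q p. \<forall>b\<in>Q q. norm (a - b) \<le> C * (norm (x - y) + r)) \<and>
     (\<forall>p\<in>P. \<forall>x\<in>G p. \<forall>a\<in>Q p. \<forall>y\<in>\<Omega>. norm (a - y) \<le> C * (norm (x - y) + r)) \<and>
     (\<forall>z\<in>\<Omega>. (\<Sum>p\<in>P. measure lborel (G p) / measure lborel (Q p) * indicator (Q p) z) \<le> C)"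

lemma cell_system_mono:
  assumes "cell_system \<Omega> E C r P G Q" "C \<le> C'" "0 < r"
  shows "cell_system \<Omega> E C' r P G Q"
proof -
  have "C * r \<le> C' * r"
    using assms by (intro mult_right_mono) auto
  moreover have "C * (norm w + r) \<le> C' * (norm w + r)" for w :: 'a
    using assms by (intro mult_right_mono) auto
  ultimately show ?thesis
    using assms(1,2) unfolding cell_system_def by (meson order_trans)
qed

lemma measure_cball_le:
  fixes \<Omega> :: "'a::euclidean_space set"
  assumes "0 \<le> r" "\<Omega> \<in> sets borel"
  shows "measure lborel (\<Omega> \<inter> cball y r) \<le> unit_ball_vol DIM('a) * r ^ DIM('a)"
proof -
  have "measure lborel (\<Omega> \<inter> cball y r) \<le> measure lborel (cball y r)"
    using assms(2) by (intro measure_mono_fmeasurable bounded_borel_fmeasurable) auto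
  then show ?thesis using assms(1) by (simp add: content_cball)
qed

context inward_field
begin

lemma dom_fmeasurable: "\<Omega> \<in> fmeasurable lborel"
  using bounded_dom open_dom by (intro bounded_borel_fmeasurable) auto

lemma exterior_borel: "collar - \<Omega> \<in> sets borel"
  using open_collar open_dom by auto

lemma exterior_fmeasurable: "collar - \<Omega> \<in> fmeasurable lborel"
  using bounded_collar exterior_borel by (intro bounded_borel_fmeasurable) (auto intro: bounded_subset)

lemma measure_dom_pos: "0 < measure lborel \<Omega>"
proof -
  obtain x e where "0 < e" "ball x e \<subseteq> \<Omega>"
    using nonempty_dom open_dom open_contains_ball by blast
  then show ?thesis
    using measure_mono_fmeasurable[of "ball x e" \<Omega> lborel] dom_fmeasurable content_ball_gt_0_iff[of x e]
    by (simp del: content_ball_gt_0_iff)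
qed

lemma measure_exterior_pos: "0 < measure lborel (collar - \<Omega>)"
proof -
  obtain x where x: "x \<in> collar - \<Omega>" using exterior_nonempty by blast
  obtain z where z: "ball z (c / (M + c) * (\<delta> / 2)) \<subseteq> (collar - \<Omega>) \<inter> ball x (\<delta> / 2)"
    by (rule exterior_ball[OF x, of "\<delta> / 2"]) (use \<delta>_pos in auto)
  have "0 < c / (M + c) * (\<delta> / 2)" using c_pos M_ge_1 \<delta>_pos by (auto intro!: divide_pos_pos mult_pos_pos)
  then have "0 < measure lborel (ball z (c / (M + c) * (\<delta> / 2)))" by (subst content_ball_gt_0_iff)
  also have "\<dots> \<le> measure lborel (collar - \<Omega>)"
    using z exterior_fmeasurable by (intro measure_mono_fmeasurable) auto
  finally show ?thesis .
qed

text \<open>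
  Above a fixed scale a single cell does, with \<open>\<Omega>\<close> itself as reservoir: every distance in
  the bounded collar is \<open>O(r)\<close>.
\<close>

lemma cells_large_scale:
  obtains C where "1 \<le> C"
    "\<And>r. \<delta> / 2 < r \<Longrightarrow> \<exists>P G Q. cell_system \<Omega> (collar - \<Omega>) C r P G Q \<and>
        (\<forall>p\<in>P. \<forall>y. measure lborel (\<Omega> \<inter> cball y r) \<le> C * measure lborel (G p))"
proof -
  define E where "E = collar - \<Omega>"
  obtain x0 where x0: "x0 \<in> E" using exterior_nonempty E_def by blast
  obtain R where R: "\<And>x. x \<in> collar \<Longrightarrow> norm x \<le> R" using bounded_collar bounded_iff by blast
  define C where "C = 1 + 4 * \<bar>R\<bar> / \<delta> + measure lborel E / measure lborel \<Omega> + measure lborel \<Omega> / measure lborel E"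
  have pos: "0 < measure lborel E" "0 < measure lborel \<Omega>"
    using measure_exterior_pos measure_dom_pos by (auto simp: E_def)
  have C: "1 \<le> C" "4 * \<bar>R\<bar> / \<delta> \<le> C" "measure lborel E / measure lborel \<Omega> \<le> C" "measure lborel \<Omega> / measure lborel E \<le> C"
    using pos \<delta>_pos unfolding C_def by (simp_all add: add_nonneg_nonneg)
  have diam: "norm (x - y) \<le> C * r" if "x \<in> collar" "y \<in> collar" "\<delta> / 2 < r" for x y r
  proof -
    have "norm (x - y) \<le> 2 * \<bar>R\<bar>"
      using norm_triangle_ineq4[of x y] R[OF that(1)] R[OF that(2)] by linarith
    also have "\<dots> = 4 * \<bar>R\<bar> / \<delta> * (\<delta> / 2)" using \<delta>_pos by simp
    also have "\<dots> \<le> C * r" using C that(3) \<delta>_pos by (intro mult_mono) auto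
    finally show ?thesis .
  qed
  have diam': "norm (x - y) \<le> C * (s + r)" if "x \<in> collar" "y \<in> collar" "\<delta> / 2 < r" "0 \<le> s" for x y r s
  proof -
    have "0 \<le> C * s" using C(1) that(4) by simp
    then show ?thesis using diam[OF that(1-3)] by (simp add: distrib_left)
  qed
  have E_sub: "E \<subseteq> collar" by (auto simp: E_def)
  show ?thesis
  proof (rule that[OF C(1)])
    fix r assume r: "\<delta> / 2 < r"
    have "cell_system \<Omega> E C r {x0} (\<lambda>_. E) (\<lambda>_. \<Omega>)"
      unfolding cell_system_def
    proof (intro conjI ballI)
      fix x y assume "x \<in> E" "y \<in> E"
      then show "norm (x - y) \<le> C * r" using diam[of x y r] r E_sub by auto
    next
      fix x y a b assume *: "x \<in> E" "y \<in> E" "a \<in> \<Omega>" "b \<in> \<Omega>"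
      show "norm (a - b) \<le> C * (norm (x - y) + r)"
        using * diam'[of a b r "norm (x - y)"] r dom_subset_collar by auto
    next
      fix x a y assume *: "x \<in> E" "a \<in> \<Omega>" "y \<in> \<Omega>"
      show "norm (a - y) \<le> C * (norm (x - y) + r)"
        using * diam'[of a y r "norm (x - y)"] r dom_subset_collar by auto
    qed (use x0 exterior_borel open_dom pos C(3) in \<open>auto simp: disjoint_family_on_def E_def[symmetric]\<close>)
    moreover have "measure lborel (\<Omega> \<inter> cball y r) \<le> C * measure lborel E" for y
    proof -
      have "measure lborel (\<Omega> \<inter> cball y r) \<le> measure lborel \<Omega>"
        using dom_fmeasurable open_dom by (intro measure_mono_fmeasurable) auto
      also have "\<dots> = measure lborel \<Omega> / measure lborel E * measure lborel E" using pos by simp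
      also have "\<dots> \<le> C * measure lborel E" using C pos by (intro mult_right_mono) auto
      finally show ?thesis .
    qed
    ultimately show "\<exists>P G Q. cell_system \<Omega> (collar - \<Omega>) C r P G Q \<and>
        (\<forall>p\<in>P. \<forall>y. measure lborel (\<Omega> \<inter> cball y r) \<le> C * measure lborel (G p))"
      unfolding E_def by blast
  qed
qed

text \<open>
  The cells come from a net partition of the exterior part of the collar, and the reservoir of a
  cell is the ball of radius \<open>r\<close> about the reflected centre.  The Lipschitz bound on the reflection gives
  the distance clauses.  Its expansivity gives the overlap clause: all cells whose reservoirs contain a given
  point lie in one ball of radius \<open>O(r)\<close>.  The density of the exterior gives the volume of the cells.
\<close>

lemma cells_small_scale:
  obtains C where "1 \<le> C"
    "\<And>r. 0 < r \<Longrightarrow> r \<le> \<delta> / 2 \<Longrightarrow> \<exists>P G Q. cell_system \<Omega> (collar - \<Omega>) C r P G Q \<and>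
        (\<forall>p\<in>P. \<forall>y. measure lborel (\<Omega> \<inter> cball y r) \<le> C * measure lborel (G p))"
proof -
  define E where "E = collar - \<Omega>"
  define \<omega> where "\<omega> = unit_ball_vol (real DIM('a))"
  have \<omega>: "0 < \<omega>" by (simp add: \<omega>_def)
  define K where "K = 2 + gain * M"
  \<comment> \<open>in units of \<open>r\<close>, a ball of this radius contains all cells whose reservoirs share a point\<close>
  define spread where "spread = 2 * (gain * M + 1) * (4 * K + 2)"
  define c2 where "c2 = c / (M + c)"
  have gM: "0 \<le> gain * M" using lam M_ge_1 by simp
  have K: "2 \<le> K" using gM by (simp add: K_def)
  have spread_nonneg: "0 \<le> spread" unfolding spread_def using gM K by simp
  have c2: "0 < c2" using c_pos M_ge_1 by (simp add: c2_def)
  define C where "C = 2 + 4 * K + 3 * (gain * M) + spread ^ DIM('a) + 1 / c2 ^ DIM('a)"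
  have C: "1 \<le> C" "2 + 4 * K \<le> C" "3 + 3 * (gain * M) \<le> C" "spread ^ DIM('a) \<le> C" "1 / c2 ^ DIM('a) \<le> C" "4 \<le> C"
  proof -
    have "0 \<le> spread ^ DIM('a)" "0 \<le> 1 / c2 ^ DIM('a)"
      using spread_nonneg c2 by simp_all
    then show "1 \<le> C" "2 + 4 * K \<le> C" "3 + 3 * (gain * M) \<le> C" "spread ^ DIM('a) \<le> C"
      "1 / c2 ^ DIM('a) \<le> C" "4 \<le> C"
      using K gM unfolding C_def by linarith+
  qed
  show ?thesis
  proof (rule that[OF C(1)])
    fix r assume r: "0 < r" "r \<le> \<delta> / 2"
    have r\<delta>: "r \<le> \<delta>" using r \<delta>_pos by simp
    obtain P G where P: "finite P" "P \<subseteq> E" and G: "disjoint_family_on G P" "(\<Union>p\<in>P. G p) = E"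
      and Gb: "\<And>p. p \<in> P \<Longrightarrow> G p \<in> sets borel" and Gin: "\<And>p. p \<in> P \<Longrightarrow> E \<inter> ball p r \<subseteq> G p"
      and Gout: "\<And>p. p \<in> P \<Longrightarrow> G p \<subseteq> ball p (2 * r)"
    proof (rule net_partition[of E r])
      show "bounded E" "E \<in> sets borel"
        using bounded_collar exterior_borel by (auto simp: E_def intro: bounded_subset)
    qed (use r in blast)+
    define Q where "Q p = cball (reflect r p) r" for p
    have PE: "p \<in> collar" "p \<in> collar - \<Omega>" if "p \<in> P" for p using P(2) that by (auto simp: E_def)
    have Gp: "norm (x - p) \<le> 2 * r" "x \<in> collar - \<Omega>" if "p \<in> P" "x \<in> G p" for p x
      using Gout[OF that(1)] G(2) that by (auto simp: E_def dist_norm norm_minus_commute)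
    have Qp: "norm (a - reflect r p) \<le> r" if "a \<in> Q p" for a p
      using that by (auto simp: Q_def dist_norm norm_minus_commute)
    have Qm: "measure lborel (Q p) = \<omega> * r ^ DIM('a)" for p
      unfolding Q_def \<omega>_def using r by (simp add: content_cball)
    have refl: "norm (reflect r p - reflect r q) \<le> K * norm (p - q)" if "q \<in> collar" for p q
      unfolding K_def using reflect_lipschitz[OF that r(1) r\<delta>] .
    have diam: "norm (x - y) \<le> C * r" if "p \<in> P" "x \<in> G p" "y \<in> G p" for p x y
    proof -
      have "norm (x - y) \<le> 4 * r"
        using Gp(1)[OF that(1,2)] Gp(1)[OF that(1,3)] norm_triangle_ineq4[of "x - p" "y - p"] by simp
      also have "\<dots> \<le> C * r" using C r by (intro mult_right_mono) auto
      finally show ?thesis .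
    qed
    have pair: "norm (a - b) \<le> C * (norm (x - y) + r)"
      if "p \<in> P" "q \<in> P" "x \<in> G p" "y \<in> G q" "a \<in> Q p" "b \<in> Q q" for p q x y a b
    proof -
      have "norm (p - q) \<le> norm (x - y) + 4 * r"
        using Gp(1)[OF that(1,3)] Gp(1)[OF that(2,4)] norm_triangle_ineq4[of "x - y" "(x - p) - (y - q)"]
          norm_triangle_ineq4[of "x - p" "y - q"] by (simp add: algebra_simps)
      then have "norm (reflect r p - reflect r q) \<le> K * (norm (x - y) + 4 * r)"
        using refl[OF PE(1)[OF that(2)], of p] K mult_left_mono[of "norm (p - q)" "norm (x - y) + 4 * r" K] by linarith
      moreover have "norm (a - b) \<le> norm (reflect r p - reflect r q) + 2 * r"
        using Qp[OF that(5)] Qp[OF that(6)] norm_triangle_ineq[of "reflect r p - reflect r q" "(a - reflect r p) - (b - reflect r q)"]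
          norm_triangle_ineq4[of "a - reflect r p" "b - reflect r q"] by (simp add: algebra_simps)
      ultimately have "norm (a - b) \<le> K * norm (x - y) + (2 + 4 * K) * r"
        by (simp add: algebra_simps)
      also have "\<dots> \<le> (2 + 4 * K) * norm (x - y) + (2 + 4 * K) * r"
        using K by (intro add_right_mono mult_right_mono) auto
      also have "\<dots> = (2 + 4 * K) * (norm (x - y) + r)" by (simp add: distrib_left)
      also have "\<dots> \<le> C * (norm (x - y) + r)" using C r by (intro mult_right_mono) auto
      finally show ?thesis .
    qed
    have dom: "norm (a - y) \<le> C * (norm (x - y) + r)"
      if "p \<in> P" "x \<in> G p" "a \<in> Q p" "y \<in> \<Omega>" for p x a y
    proof -
      have px: "norm (p - y) \<le> norm (x - y) + 2 * r"
        using Gp(1)[OF that(1,2)] norm_triangle_ineq4[of "x - y" "x - p"] by simp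
      then have "d p \<le> norm (x - y) + 2 * r" using d_le[OF that(4), of p] by simp
      then have "gain * M * (d p + r) \<le> gain * M * (norm (x - y) + 3 * r)"
        using gM by (intro mult_left_mono) auto
      then have "norm (reflect r p - p) \<le> gain * M * (norm (x - y) + 3 * r)"
        using norm_reflect_diff[of r p] r by simp
      moreover have "norm (a - y) \<le> norm (a - reflect r p) + norm (reflect r p - p) + norm (p - y)"
        using norm_triangle_ineq[of "a - reflect r p" "reflect r p - y"]
          norm_triangle_ineq[of "reflect r p - p" "p - y"] by simp
      ultimately have "norm (a - y) \<le> (1 + gain * M) * norm (x - y) + (3 + 3 * (gain * M)) * r"
        using px Qp[OF that(3)] by (simp add: algebra_simps)
      also have "\<dots> \<le> (3 + 3 * (gain * M)) * norm (x - y) + (3 + 3 * (gain * M)) * r"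
      proof (intro add_right_mono mult_right_mono)
        show "1 + gain * M \<le> 3 + 3 * (gain * M)" using gM by linarith
      qed simp
      also have "\<dots> = (3 + 3 * (gain * M)) * (norm (x - y) + r)" by (simp add: distrib_left)
      also have "\<dots> \<le> C * (norm (x - y) + r)" using C r by (intro mult_right_mono) auto
      finally show ?thesis .
    qed
    have overlap: "(\<Sum>p\<in>P. measure lborel (G p) / measure lborel (Q p) * indicator (Q p) z) \<le> C" for z
    proof -
      define H where "H = {p\<in>P. z \<in> Q p}"
      have H: "finite H" "H \<subseteq> P" using P(1) by (auto simp: H_def)
      have "(\<Sum>p\<in>P. measure lborel (G p) / measure lborel (Q p) * indicator (Q p) z)
          = (\<Sum>p\<in>H. measure lborel (G p) / (\<omega> * r ^ DIM('a)))"
        unfolding H_def Qm using P(1) by (intro sum.mono_neutral_cong_right) auto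
      also have "\<dots> = measure lborel (\<Union>p\<in>H. G p) / (\<omega> * r ^ DIM('a))"
      proof -
        have "measure lborel (\<Union>p\<in>H. G p) = (\<Sum>p\<in>H. measure lborel (G p))"
        proof (rule measure_finite_Union)
          show "disjoint_family_on G H" using G(1) H(2) by (rule disjoint_family_on_mono[rotated])
          show "emeasure lborel (G p) \<noteq> \<infinity>" if "p \<in> H" for p
          proof -
            have "bounded (G p)" using Gout[of p] H(2) that by (auto intro: bounded_subset[OF bounded_ball])
            then show ?thesis using emeasure_bounded_finite[of "G p"] by simp
          qed
        qed (use H Gb in auto)
        then show ?thesis by (simp add: sum_divide_distrib)
      qed
      also have "\<dots> \<le> spread ^ DIM('a)"
      proof (cases "(\<Union>p\<in>H. G p) = {}")
        case False
        then obtain p0 x0 where p0: "p0 \<in> H" "x0 \<in> G p0" by blast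
        have "(\<Union>p\<in>H. G p) \<subseteq> cball x0 (spread * r)"
        proof
          fix x assume "x \<in> (\<Union>p\<in>H. G p)"
          then obtain p where p: "p \<in> H" "x \<in> G p" by blast
          have near: "norm (reflect r y - z) \<le> (2 * K + 1) * r" if "q \<in> H" "y \<in> G q" for q y
          proof -
            have "norm (reflect r y - reflect r q) \<le> K * (2 * r)"
            proof -
              have q: "q \<in> P" using that(1) H(2) by blast
              have "K * norm (y - q) \<le> K * (2 * r)"
                using Gp(1)[OF q that(2)] K by (intro mult_left_mono) auto
              then show ?thesis using refl[OF PE(1)[OF q], of y] by linarith
            qed
            moreover have "norm (z - reflect r q) \<le> r" using that(1) Qp by (simp add: H_def)
            ultimately show ?thesis
              using norm_triangle_ineq4[of "reflect r y - reflect r q" "z - reflect r q"]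
              by (simp add: algebra_simps)
          qed
          have "norm (reflect r x0 - reflect r x) \<le> (4 * K + 2) * r"
            using near[OF p] near[OF p0] norm_triangle_ineq4[of "reflect r x0 - z" "reflect r x - z"]
            by (simp add: algebra_simps)
          then have "2 * (gain * M + 1) * norm (reflect r x0 - reflect r x) \<le> 2 * (gain * M + 1) * ((4 * K + 2) * r)"
            using gM by (intro mult_left_mono) auto
          moreover have "norm (x0 - x) \<le> 2 * (gain * M + 1) * norm (reflect r x0 - reflect r x)"
            using reflect_expansive[of x0 x r] Gp(2) p p0 H(2) r r\<delta> by blast
          ultimately have "norm (x0 - x) \<le> spread * r" unfolding spread_def by (simp add: mult.assoc)
          then show "x \<in> cball x0 (spread * r)" by (simp add: dist_norm)
        qed
        then have "measure lborel (\<Union>p\<in>H. G p) \<le> measure lborel (cball x0 (spread * r))"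
        proof (rule measure_mono_fmeasurable)
          show "(\<Union>p\<in>H. G p) \<in> sets lborel" using H Gb by (auto intro!: sets.finite_UN)
        qed (auto intro: bounded_borel_fmeasurable)
        also have "\<dots> = \<omega> * (spread * r) ^ DIM('a)"
          unfolding \<omega>_def using spread_nonneg r by (subst content_cball) auto
        finally show ?thesis using \<omega> r by (simp add: divide_le_eq power_mult_distrib mult_ac)
      qed (use spread_nonneg in simp)
      finally show ?thesis using C(4) by linarith
    qed
    have mass: "measure lborel (\<Omega> \<inter> cball y r) \<le> C * measure lborel (G p)" if p: "p \<in> P" for p y
    proof -
      obtain z where z: "ball z (c2 * r) \<subseteq> (collar - \<Omega>) \<inter> ball p r"
        unfolding c2_def by (rule exterior_ball[OF PE(2)[OF p] r])
      have "\<omega> * (c2 * r) ^ DIM('a) = measure lborel (ball z (c2 * r))"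
        unfolding \<omega>_def using c2 r by (subst content_ball) auto
      also have "\<dots> \<le> measure lborel (G p)"
      proof (rule measure_mono_fmeasurable)
        show "ball z (c2 * r) \<subseteq> G p" using z Gin[OF p] by (auto simp: E_def)
        show "G p \<in> fmeasurable lborel"
          using Gout[OF p] Gb[OF p] by (intro bounded_borel_fmeasurable) (auto intro: bounded_subset)
      qed simp
      finally have A: "\<omega> * (c2 * r) ^ DIM('a) \<le> measure lborel (G p)" .
      have "measure lborel (\<Omega> \<inter> cball y r) \<le> \<omega> * r ^ DIM('a)"
        unfolding \<omega>_def using measure_cball_le[of r \<Omega> y] r open_dom by simp
      also have "\<dots> = 1 / c2 ^ DIM('a) * (\<omega> * (c2 * r) ^ DIM('a))"
        using c2 by (simp add: power_mult_distrib)
      also have "\<dots> \<le> C * measure lborel (G p)"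
        using A C \<omega> c2 r by (intro mult_mono) auto
      finally show ?thesis .
    qed
    have "cell_system \<Omega> E C r P G Q"
      unfolding cell_system_def
    proof (intro conjI ballI)
      fix p assume p: "p \<in> P"
      show "p \<in> G p" using Gin[OF p] P(2) p r by auto
      show "Q p \<subseteq> \<Omega>" unfolding Q_def by (rule cball_reflect_subset[OF PE(1)[OF p] r(1) r\<delta>])
      show "0 < measure lborel (Q p)" unfolding Qm using \<omega> r by simp
    qed (use P G Gb diam pair dom overlap in \<open>auto simp: Q_def\<close>)
    then show "\<exists>P G Q. cell_system \<Omega> (collar - \<Omega>) C r P G Q \<and>
        (\<forall>p\<in>P. \<forall>y. measure lborel (\<Omega> \<inter> cball y r) \<le> C * measure lborel (G p))"
      using mass unfolding E_def by blast
  qed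
qed

lemma cells_exist:
  obtains C where "1 \<le> C"
    "\<And>r. 0 < r \<Longrightarrow> \<exists>P G Q. cell_system \<Omega> (collar - \<Omega>) C r P G Q \<and>
        (\<forall>p\<in>P. \<forall>y. measure lborel (\<Omega> \<inter> cball y r) \<le> C * measure lborel (G p))"
proof -
  obtain C1 where C1: "1 \<le> C1" "\<And>r. \<delta> / 2 < r \<Longrightarrow> \<exists>P G Q. cell_system \<Omega> (collar - \<Omega>) C1 r P G Q \<and>
        (\<forall>p\<in>P. \<forall>y. measure lborel (\<Omega> \<inter> cball y r) \<le> C1 * measure lborel (G p))"
    by (rule cells_large_scale) blast
  obtain C2 where C2: "1 \<le> C2" "\<And>r. 0 < r \<Longrightarrow> r \<le> \<delta> / 2 \<Longrightarrow> \<exists>P G Q. cell_system \<Omega> (collar - \<Omega>) C2 r P G Q \<and>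
        (\<forall>p\<in>P. \<forall>y. measure lborel (\<Omega> \<inter> cball y r) \<le> C2 * measure lborel (G p))"
    by (rule cells_small_scale) blast
  show ?thesis
  proof (rule that[of "max C1 C2"])
    fix r :: real assume r: "0 < r"
    obtain C P G Q where *: "C \<le> max C1 C2" "cell_system \<Omega> (collar - \<Omega>) C r P G Q"
        "\<forall>p\<in>P. \<forall>y. measure lborel (\<Omega> \<inter> cball y r) \<le> C * measure lborel (G p)"
    proof (cases "\<delta> / 2 < r")
      case True
      then show ?thesis using that[of C1] C1(2)[of r] by auto
    next
      case False
      then show ?thesis using that[of C2] C2(2)[of r] r by auto
    qed
    have "measure lborel (\<Omega> \<inter> cball y r) \<le> max C1 C2 * measure lborel (G p)" if "p \<in> P" for p y
      using *(3) that mult_right_mono[OF *(1) measure_nonneg[of lborel "G p"]] by (meson order_trans)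
    then show "\<exists>P G Q. cell_system \<Omega> (collar - \<Omega>) (max C1 C2) r P G Q \<and>
        (\<forall>p\<in>P. \<forall>y. measure lborel (\<Omega> \<inter> cball y r) \<le> max C1 C2 * measure lborel (G p))"
      using cell_system_mono[OF *(2,1) r] by blast
  qed (use C1 in simp)
qed

end

text \<open>
  Cells of volume above \<open>m\<close> are cut into the least number of equal parts of volume at most \<open>m\<close>; these parts
  then have volume at least \<open>m / 2\<close>.  In the overlap clause the parts of one cell add up again.
\<close>

lemma cell_system_refine:
  assumes cs: "cell_system \<Omega> E C r P G Q" and E: "bounded E" and m: "0 < m"
    and pos: "\<And>p. p \<in> P \<Longrightarrow> 0 < measure lborel (G p)"
  obtains P' G' Q' where "cell_system \<Omega> E C r P' G' Q'"
    "\<And>p. p \<in> P' \<Longrightarrow> measure lborel (G' p) \<le> m"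
    "\<And>p. p \<in> P' \<Longrightarrow> m / 2 \<le> measure lborel (G' p) \<or> (\<exists>q\<in>P. G' p = G q)"
proof -
  have P: "finite P" "disjoint_family_on G P" "(\<Union>p\<in>P. G p) = E"
    and Gp: "\<And>p. p \<in> P \<Longrightarrow> p \<in> G p" "\<And>p. p \<in> P \<Longrightarrow> G p \<in> sets borel"
    and Qp: "\<And>p. p \<in> P \<Longrightarrow> Q p \<in> sets borel \<and> Q p \<subseteq> \<Omega> \<and> 0 < measure lborel (Q p)"
    and diam: "\<And>p x y. p \<in> P \<Longrightarrow> x \<in> G p \<Longrightarrow> y \<in> G p \<Longrightarrow> norm (x - y) \<le> C * r"
    and pair: "\<And>p q x y a b. p \<in> P \<Longrightarrow> q \<in> P \<Longrightarrow> x \<in> G p \<Longrightarrow> y \<in> G q \<Longrightarrow> a \<in> Q p \<Longrightarrow> b \<in> Q q \<Longrightarrow>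
                norm (a - b) \<le> C * (norm (x - y) + r)"
    and dom: "\<And>p x a y. p \<in> P \<Longrightarrow> x \<in> G p \<Longrightarrow> a \<in> Q p \<Longrightarrow> y \<in> \<Omega> \<Longrightarrow> norm (a - y) \<le> C * (norm (x - y) + r)"
    and overlap: "\<And>z. z \<in> \<Omega> \<Longrightarrow> (\<Sum>p\<in>P. measure lborel (G p) / measure lborel (Q p) * indicator (Q p) z) \<le> C"
    using cs unfolding cell_system_def by blast+
  have Gf: "G p \<in> fmeasurable lborel" if "p \<in> P" for p
    using Gp(2)[OF that] P(3) that E by (intro bounded_borel_fmeasurable) (auto intro: bounded_subset)
  have split: "\<exists>S B. finite S \<and> disjoint_family_on B S \<and> (\<Union>x\<in>S. B x) = G p \<and>
      (\<forall>x\<in>S. x \<in> B x \<and> B x \<in> sets borel \<and> measure lborel (B x) \<le> m \<and>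
             (m / 2 \<le> measure lborel (B x) \<or> B x = G p))" if p: "p \<in> P" for p
  proof (cases "measure lborel (G p) \<le> m")
    case True
    then show ?thesis using Gp[OF p]
      by (intro exI[of _ "{p}"] exI[of _ "\<lambda>_. G p"]) (auto simp: disjoint_family_on_def)
  next
    case False
    define g where "g = measure lborel (G p)"
    define k where "k = nat \<lceil>g / m\<rceil>"
    have g: "m < g" using False by (simp add: g_def)
    have gm: "1 < g / m" using g m by simp
    have k: "g / m \<le> real k" "real k < g / m + 1" "0 < k"
      unfolding k_def using gm by linarith+
    have gk: "g \<le> real k * m" "real k * m < 2 * g"
      using k(1,2) g m by (simp_all add: field_simps)
    have le: "g / real k \<le> m" "m / 2 \<le> g / real k" "0 < g / real k"
      using gk k(3) g m by (simp_all add: field_simps)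
    have "g = real k * (g / real k)" using k by simp
    then obtain S B where "finite S \<and> disjoint_family_on B S \<and> (\<Union>x\<in>S. B x) = G p \<and>
           (\<forall>x\<in>S. x \<in> B x \<and> B x \<in> sets borel \<and> measure lborel (B x) = g / real k)"
      using lborel_equipartition[OF Gf[OF p] le(3) _ k(3)] unfolding g_def by blast
    then show ?thesis using le by metis
  qed
  obtain S B where SB: "\<And>p. p \<in> P \<Longrightarrow> finite (S p) \<and> disjoint_family_on (B p) (S p) \<and> (\<Union>x\<in>S p. B p x) = G p \<and>
      (\<forall>x\<in>S p. x \<in> B p x \<and> B p x \<in> sets borel \<and> measure lborel (B p x) \<le> m \<and>
             (m / 2 \<le> measure lborel (B p x) \<or> B p x = G p))"
    using split by metis
  have sub: "B p x \<subseteq> G p" if "p \<in> P" "x \<in> S p" for p x using SB that by blast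
  have xB: "x \<in> B p x" if "p \<in> P" "x \<in> S p" for p x using SB that by blast
  have xG: "x \<in> G p" if "p \<in> P" "x \<in> S p" for p x using sub xB that by blast
  have uniq: "p = q" if "p \<in> P" "q \<in> P" "x \<in> G p" "x \<in> G q" for p q x
    using P(2) that unfolding disjoint_family_on_def by blast
  define par where "par x = (SOME p. p \<in> P \<and> x \<in> S p)" for x
  have par: "par x = p" if "p \<in> P" "x \<in> S p" for p x
  proof -
    have "par x \<in> P \<and> x \<in> S (par x)" unfolding par_def by (rule someI) (use that in blast)
    then show ?thesis using uniq xG that by blast
  qed
  define P' where "P' = (\<Union>p\<in>P. S p)"
  have P': "\<exists>p\<in>P. x \<in> S p \<and> par x = p" if "x \<in> P'" for x
    using that par unfolding P'_def by blast
  define G' where "G' x = B (par x) x" for x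
  define Q' where "Q' x = Q (par x)" for x
  have G': "G' x = B p x" "Q' x = Q p" if "p \<in> P" "x \<in> S p" for p x
    using par[OF that] by (auto simp: G'_def Q'_def)
  have G'sub: "G' x \<subseteq> G (par x)" "par x \<in> P" "x \<in> S (par x)" if "x \<in> P'" for x
    using P'[OF that] sub unfolding G'_def by auto
  have "cell_system \<Omega> E C r P' G' Q'"
    unfolding cell_system_def
  proof (intro conjI ballI)
    show "finite P'" unfolding P'_def using P(1) SB by blast
    show "disjoint_family_on G' P'"
      unfolding disjoint_family_on_def
    proof (intro ballI impI)
      fix x y assume xy: "x \<in> P'" "y \<in> P'" "x \<noteq> y"
      show "G' x \<inter> G' y = {}"
      proof (cases "par x = par y")
        case True
        then have "y \<in> S (par x)" using G'sub(3)[OF xy(2)] by simp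
        then show ?thesis
          using SB[OF G'sub(2)[OF xy(1)]] G'sub(3)[OF xy(1)] xy(3) True
          unfolding G'_def disjoint_family_on_def by auto
      next
        case False
        show ?thesis
        proof (rule equals0I)
          fix t assume "t \<in> G' x \<inter> G' y"
          then have "t \<in> G (par x)" "t \<in> G (par y)" using G'sub(1)[OF xy(1)] G'sub(1)[OF xy(2)] by auto
          then show False using uniq[OF G'sub(2)[OF xy(1)] G'sub(2)[OF xy(2)]] False by blast
        qed
      qed
    qed
    show "(\<Union>p\<in>P'. G' p) = E"
    proof -
      have "(\<Union>p\<in>P'. G' p) = (\<Union>p\<in>P. \<Union>x\<in>S p. B p x)"
        unfolding P'_def using G' by auto
      also have "\<dots> = E" using SB P(3) by auto
      finally show ?thesis .
    qed
  next
    fix x assume x: "x \<in> P'"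
    note par_x = G'sub(2,3)[OF x]
    show "x \<in> G' x" "G' x \<in> sets borel" using SB[OF par_x(1)] par_x(2) unfolding G'_def by auto
    show "Q' x \<in> sets borel" "Q' x \<subseteq> \<Omega>" "0 < measure lborel (Q' x)"
      using Qp[OF par_x(1)] by (auto simp: Q'_def)
    fix y z assume "y \<in> G' x" "z \<in> G' x"
    then show "norm (y - z) \<le> C * r" using diam[OF par_x(1)] G'sub(1)[OF x] by blast
  next
    fix x y a b s t assume "x \<in> P'" "y \<in> P'" "a \<in> G' x" "b \<in> G' y" "s \<in> Q' x" "t \<in> Q' y"
    then show "norm (s - t) \<le> C * (norm (a - b) + r)"
      using pair[of "par x" "par y" a b s t] G'sub unfolding Q'_def by blast
  next
    fix x a s y assume "x \<in> P'" "a \<in> G' x" "s \<in> Q' x" "y \<in> \<Omega>"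
    then show "norm (s - y) \<le> C * (norm (a - y) + r)"
      using dom[of "par x" a s y] G'sub unfolding Q'_def by blast
  next
    fix z assume z: "z \<in> \<Omega>"
    have "(\<Sum>x\<in>P'. measure lborel (G' x) / measure lborel (Q' x) * indicator (Q' x) z)
      = (\<Sum>p\<in>P. \<Sum>x\<in>S p. measure lborel (G' x) / measure lborel (Q' x) * indicator (Q' x) z)"
      unfolding P'_def
    proof (rule sum.UNION_disjoint)
      show "\<forall>p\<in>P. \<forall>q\<in>P. p \<noteq> q \<longrightarrow> S p \<inter> S q = {}" using uniq xG by blast
    qed (use P(1) SB in auto)
    also have "\<dots> = (\<Sum>p\<in>P. measure lborel (G p) / measure lborel (Q p) * indicator (Q p) z)"
    proof (rule sum.cong[OF refl])
      fix p assume p: "p \<in> P"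
      have "(\<Sum>x\<in>S p. measure lborel (B p x)) = measure lborel (\<Union>x\<in>S p. B p x)"
      proof (rule measure_finite_Union[symmetric])
        show "emeasure lborel (B p x) \<noteq> \<infinity>" if "x \<in> S p" for x
        proof -
          have "B p x \<in> fmeasurable lborel"
            using fmeasurableI2[OF Gf[OF p] sub[OF p that]] SB[OF p] that by simp
          then show ?thesis by (auto simp: fmeasurable_def)
        qed
      qed (use SB[OF p] in auto)
      then have *: "(\<Sum>x\<in>S p. measure lborel (B p x)) = measure lborel (G p)" using SB[OF p] by simp
      have "(\<Sum>x\<in>S p. measure lborel (G' x) / measure lborel (Q' x) * indicator (Q' x) z)
        = (\<Sum>x\<in>S p. measure lborel (B p x) * (indicator (Q p) z / measure lborel (Q p)))"
        using G'[OF p] by (intro sum.cong) auto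
      also have "\<dots> = measure lborel (G p) / measure lborel (Q p) * indicator (Q p) z"
        unfolding sum_distrib_right[symmetric] * by simp
      finally show "(\<Sum>x\<in>S p. measure lborel (G' x) / measure lborel (Q' x) * indicator (Q' x) z)
        = measure lborel (G p) / measure lborel (Q p) * indicator (Q p) z" .
    qed
    also have "\<dots> \<le> C" by (rule overlap[OF z])
    finally show "(\<Sum>x\<in>P'. measure lborel (G' x) / measure lborel (Q' x) * indicator (Q' x) z) \<le> C" .
  qed
  moreover have "measure lborel (G' x) \<le> m \<and> (m / 2 \<le> measure lborel (G' x) \<or> (\<exists>q\<in>P. G' x = G q))" if "x \<in> P'" for x
    using SB[OF G'sub(2)[OF that]] G'sub(2,3)[OF that] unfolding G'_def by metis
  ultimately show ?thesis using that by blast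
qed

section \<open>Averaging with a Markov kernel\<close>

text \<open>
  Extends the convexity on the positive reals to zero, where \<open>(t * z) powr p \<le> t * z powr p\<close> for
  \<open>t \<le> 1\<close> suffices.
\<close>

lemma convex_on_powr:
  assumes "1 \<le> p"
  shows "convex_on {0..} (\<lambda>x::real. x powr p)"
  unfolding convex_on_def
proof (intro conjI ballI allI impI)
  fix x y u v :: real
  assume xy: "x \<in> {0..}" "y \<in> {0..}" and uv: "0 \<le> u" "0 \<le> v" "u + v = 1"
  have scale: "(t * z) powr p \<le> t * z powr p" if "0 \<le> t" "t \<le> 1" "0 \<le> z" for t z :: real
  proof -
    have "t powr p \<le> t" using powr_mono'[of 1 p t] that assms by simp
    then have "t powr p * z powr p \<le> t * z powr p" using that by (intro mult_right_mono) auto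
    then show ?thesis using that by (simp add: powr_mult)
  qed
  show "(u *\<^sub>R x + v *\<^sub>R y) powr p \<le> u * x powr p + v * y powr p"
  proof (cases "x = 0 \<or> y = 0")
    case True
    then show ?thesis using scale[of u x] scale[of v y] xy uv assms by auto
  next
    case False
    then show ?thesis using powr_convex[OF assms] xy uv unfolding convex_on_def by auto
  qed
qed simp

lemma abs_convex_combination_powr_le:
  fixes a x :: "'i \<Rightarrow> real"
  assumes "finite I" "1 \<le> p" "(\<Sum>i\<in>I. a i) = 1" "\<And>i. i \<in> I \<Longrightarrow> 0 \<le> a i"
  shows "\<bar>\<Sum>i\<in>I. a i * x i\<bar> powr p \<le> (\<Sum>i\<in>I. a i * \<bar>x i\<bar> powr p)"
proof -
  have "I \<noteq> {}" using assms(3) by auto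
  have "\<bar>\<Sum>i\<in>I. a i * x i\<bar> \<le> (\<Sum>i\<in>I. a i * \<bar>x i\<bar>)"
    using assms(4) by (intro order_trans[OF sum_abs] sum_mono) (simp add: abs_mult)
  then have "\<bar>\<Sum>i\<in>I. a i * x i\<bar> powr p \<le> (\<Sum>i\<in>I. a i * \<bar>x i\<bar>) powr p"
    using assms(2) by (intro powr_mono2) auto
  also have "\<dots> \<le> (\<Sum>i\<in>I. a i * \<bar>x i\<bar> powr p)"
    using convex_on_sum[OF assms(1) \<open>I \<noteq> {}\<close> convex_on_powr[OF assms(2)] assms(3,4), of "\<lambda>i. \<bar>x i\<bar>"] by simp
  finally show ?thesis .
qed

text \<open>
  The extension of \<open>u\<close> is \<open>x \<mapsto> \<Sum>z. w x z * u z\<close> for a Markov kernel \<open>w\<close> from \<open>W\<close> to \<open>V\<close> that carries the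
  masses \<open>n\<close> on \<open>W\<close> to at most \<open>M * m\<close> on \<open>V\<close>.  Jensen's inequality and summation over \<open>W\<close> first give the bound.
\<close>

lemma markov_extension_norm_le:
  fixes w :: "'a \<Rightarrow> 'b \<Rightarrow> real"
  assumes "finite V" "finite W" "1 \<le> p"
    and w1: "\<And>x. x \<in> W \<Longrightarrow> (\<Sum>z\<in>V. w x z) = 1" and w0: "\<And>x z. x \<in> W \<Longrightarrow> z \<in> V \<Longrightarrow> 0 \<le> w x z"
    and n0: "\<And>x. x \<in> W \<Longrightarrow> 0 \<le> n x"
    and pull: "\<And>z. z \<in> V \<Longrightarrow> (\<Sum>x\<in>W. n x * w x z) \<le> M * m z"
  shows "(\<Sum>x\<in>W. \<bar>\<Sum>z\<in>V. w x z * u z\<bar> powr p * n x) \<le> M * (\<Sum>z\<in>V. \<bar>u z\<bar> powr p * m z)"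
proof -
  have "(\<Sum>x\<in>W. \<bar>\<Sum>z\<in>V. w x z * u z\<bar> powr p * n x) \<le> (\<Sum>x\<in>W. (\<Sum>z\<in>V. w x z * \<bar>u z\<bar> powr p) * n x)"
    using assms by (intro sum_mono mult_right_mono abs_convex_combination_powr_le) auto
  also have "\<dots> = (\<Sum>x\<in>W. \<Sum>z\<in>V. \<bar>u z\<bar> powr p * (n x * w x z))"
    by (simp add: sum_distrib_left sum_distrib_right mult_ac)
  also have "\<dots> = (\<Sum>z\<in>V. \<bar>u z\<bar> powr p * (\<Sum>x\<in>W. n x * w x z))"
    by (subst sum.swap) (simp add: sum_distrib_left)
  also have "\<dots> \<le> (\<Sum>z\<in>V. \<bar>u z\<bar> powr p * (M * m z))"
    using pull by (intro sum_mono mult_left_mono) auto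
  finally show ?thesis by (simp add: sum_distrib_left mult_ac)
qed

text \<open>
  A difference of two averages is the average of the differences with respect to the product weights,
  so Jensen's inequality applies as for the norm; both marginals are then summed out, each at the cost of a
  factor \<open>M\<close>.  Locality of the kernel is expressed through supports: \<open>N\<close>-related points
  draw their values from \<open>N'\<close>-related points.
\<close>

lemma markov_extension_energy_le:
  fixes w :: "'a \<Rightarrow> 'b \<Rightarrow> real"
  assumes fin: "finite V" "finite W" and p: "1 \<le> p"
    and w1: "\<And>x. x \<in> W \<Longrightarrow> (\<Sum>z\<in>V. w x z) = 1" and w0: "\<And>x z. x \<in> W \<Longrightarrow> z \<in> V \<Longrightarrow> 0 \<le> w x z"
    and n0: "\<And>x. x \<in> W \<Longrightarrow> 0 \<le> n x" and m0: "\<And>z. z \<in> V \<Longrightarrow> 0 \<le> m z" and M0: "0 \<le> M"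
    and pull: "\<And>z. z \<in> V \<Longrightarrow> (\<Sum>x\<in>W. n x * w x z) \<le> M * m z"
    and near: "\<And>x y z z'. x \<in> W \<Longrightarrow> y \<in> W \<Longrightarrow> z \<in> V \<Longrightarrow> z' \<in> V \<Longrightarrow> N x y \<Longrightarrow> 0 < w x z \<Longrightarrow> 0 < w y z' \<Longrightarrow> N' z z'"
  shows "(\<Sum>x\<in>W. \<Sum>y\<in>W. of_bool (N x y) * \<bar>(\<Sum>z\<in>V. w x z * u z) - (\<Sum>z\<in>V. w y z * u z)\<bar> powr p * n x * n y)
    \<le> M\<^sup>2 * (\<Sum>z\<in>V. \<Sum>z'\<in>V. of_bool (N' z z') * \<bar>u z - u z'\<bar> powr p * m z * m z')"
proof -
  define F where "F z z' = of_bool (N' z z') * \<bar>u z - u z'\<bar> powr p" for z z'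
  have F0: "0 \<le> F z z'" for z z' by (simp add: F_def)
  have step: "of_bool (N x y) * \<bar>(\<Sum>z\<in>V. w x z * u z) - (\<Sum>z\<in>V. w y z * u z)\<bar> powr p * n x * n y
      \<le> (\<Sum>z\<in>V. \<Sum>z'\<in>V. (n x * w x z) * (n y * w y z') * F z z')" if x: "x \<in> W" and y: "y \<in> W" for x y
  proof (cases "N x y")
    case True
    have one: "(\<Sum>zz\<in>V \<times> V. w x (fst zz) * w y (snd zz)) = 1"
      using w1[OF x] w1[OF y] by (simp add: sum.cartesian_product' sum_product[symmetric])
    have "(\<Sum>z\<in>V. w x z * u z) - (\<Sum>z\<in>V. w y z * u z)
        = (\<Sum>z\<in>V. w x z * u z) * (\<Sum>z'\<in>V. w y z') - (\<Sum>z\<in>V. w x z) * (\<Sum>z\<in>V. w y z * u z)"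
      using w1[OF x] w1[OF y] by simp
    also have "\<dots> = (\<Sum>zz\<in>V \<times> V. (w x (fst zz) * w y (snd zz)) * (u (fst zz) - u (snd zz)))"
      unfolding sum_product sum.cartesian_product' sum_subtractf[symmetric]
      by (simp add: algebra_simps)
    finally have "\<bar>(\<Sum>z\<in>V. w x z * u z) - (\<Sum>z\<in>V. w y z * u z)\<bar> powr p
        \<le> (\<Sum>zz\<in>V \<times> V. (w x (fst zz) * w y (snd zz)) * \<bar>u (fst zz) - u (snd zz)\<bar> powr p)"
      using abs_convex_combination_powr_le[of "V \<times> V" p "\<lambda>zz. w x (fst zz) * w y (snd zz)"
          "\<lambda>zz. u (fst zz) - u (snd zz)"] fin p one w0 x y by auto
    also have "\<dots> \<le> (\<Sum>z\<in>V. \<Sum>z'\<in>V. w x z * w y z' * F z z')"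
      unfolding sum.cartesian_product' fst_conv snd_conv
    proof (intro sum_mono)
      fix z z' assume z: "z \<in> V" "z' \<in> V"
      show "w x z * w y z' * \<bar>u z - u z'\<bar> powr p \<le> w x z * w y z' * F z z'"
      proof (cases "0 < w x z \<and> 0 < w y z'")
        case pos: True
        then show ?thesis using near[OF x y z True] by (simp add: F_def)
      next
        case False
        then have zero: "w x z * w y z' = 0" using w0[OF x z(1)] w0[OF y z(2)] by auto
        show ?thesis unfolding zero by simp
      qed
    qed
    finally have "\<bar>(\<Sum>z\<in>V. w x z * u z) - (\<Sum>z\<in>V. w y z * u z)\<bar> powr p * (n x * n y)
        \<le> (\<Sum>z\<in>V. \<Sum>z'\<in>V. w x z * w y z' * F z z') * (n x * n y)"
      using n0 x y by (intro mult_right_mono) auto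
    then show ?thesis using True by (simp add: sum_distrib_left sum_distrib_right mult_ac)
  next
    case False
    then show ?thesis using n0 w0 x y F0 by (auto intro!: sum_nonneg mult_nonneg_nonneg)
  qed
  have "(\<Sum>x\<in>W. \<Sum>y\<in>W. of_bool (N x y) * \<bar>(\<Sum>z\<in>V. w x z * u z) - (\<Sum>z\<in>V. w y z * u z)\<bar> powr p * n x * n y)
      \<le> (\<Sum>x\<in>W. \<Sum>y\<in>W. \<Sum>z\<in>V. \<Sum>z'\<in>V. (n x * w x z) * (n y * w y z') * F z z')"
    using step by (intro sum_mono)
  also have "\<dots> = (\<Sum>z\<in>V. \<Sum>z'\<in>V. \<Sum>x\<in>W. \<Sum>y\<in>W. (n x * w x z) * (n y * w y z') * F z z')"
  proof -
    have "(\<Sum>x\<in>W. \<Sum>y\<in>W. \<Sum>z\<in>V. \<Sum>z'\<in>V. (n x * w x z) * (n y * w y z') * F z z')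
        = (\<Sum>x\<in>W. \<Sum>z\<in>V. \<Sum>y\<in>W. \<Sum>z'\<in>V. (n x * w x z) * (n y * w y z') * F z z')"
      by (intro sum.cong[OF refl] sum.swap)
    also have "\<dots> = (\<Sum>z\<in>V. \<Sum>x\<in>W. \<Sum>y\<in>W. \<Sum>z'\<in>V. (n x * w x z) * (n y * w y z') * F z z')"
      by (rule sum.swap)
    also have "\<dots> = (\<Sum>z\<in>V. \<Sum>x\<in>W. \<Sum>z'\<in>V. \<Sum>y\<in>W. (n x * w x z) * (n y * w y z') * F z z')"
      by (intro sum.cong[OF refl] sum.swap)
    also have "\<dots> = (\<Sum>z\<in>V. \<Sum>z'\<in>V. \<Sum>x\<in>W. \<Sum>y\<in>W. (n x * w x z) * (n y * w y z') * F z z')"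
      by (intro sum.cong[OF refl] sum.swap)
    finally show ?thesis .
  qed
  also have "\<dots> = (\<Sum>z\<in>V. \<Sum>z'\<in>V. (\<Sum>x\<in>W. n x * w x z) * (\<Sum>y\<in>W. n y * w y z') * F z z')"
    by (simp only: sum_product) (simp only: sum_distrib_right)
  also have "\<dots> \<le> (\<Sum>z\<in>V. \<Sum>z'\<in>V. (M * m z) * (M * m z') * F z z')"
    using pull n0 w0 m0 M0 F0
    by (intro sum_mono mult_right_mono mult_mono sum_nonneg mult_nonneg_nonneg) auto
  also have "\<dots> = M\<^sup>2 * (\<Sum>z\<in>V. \<Sum>z'\<in>V. of_bool (N' z z') * \<bar>u z - u z'\<bar> powr p * m z * m z')"
    unfolding F_def by (simp add: sum_distrib_left power2_eq_square mult_ac)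
  finally show ?thesis .
qed

section \<open>Extended measure, transport map and weights\<close>

lemma emeasure_density_restrict:
  fixes S A :: "'a::euclidean_space set"
  assumes "S \<in> sets borel" "A \<in> sets borel" "A \<subseteq> S" "f \<in> borel_measurable (restrict_space borel S)"
  shows "emeasure (density (restrict_space lborel S) (\<lambda>x. ennreal (f x))) A
    = (\<integral>\<^sup>+x. ennreal (f x) * indicator A x \<partial>lborel)"
proof -
  have f: "f \<in> borel_measurable (restrict_space lborel S)"
    using assms(4) by (simp cong: measurable_cong_sets sets_restrict_space_cong)
  have A: "A \<in> sets (restrict_space lborel S)"
    using assms by (subst sets_restrict_space_iff) auto
  have "emeasure (density (restrict_space lborel S) (\<lambda>x. ennreal (f x))) A
      = (\<integral>\<^sup>+x. ennreal (f x) * indicator A x \<partial>restrict_space lborel S)"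
    using f A by (subst emeasure_density) auto
  also have "\<dots> = (\<integral>\<^sup>+x. ennreal (f x) * indicator A x * indicator S x \<partial>lborel)"
    using assms(1) by (subst nn_integral_restrict_space) auto
  also have "\<dots> = (\<integral>\<^sup>+x. ennreal (f x) * indicator A x \<partial>lborel)"
    using assms(3) by (intro nn_integral_cong) (auto split: split_indicator)
  finally show ?thesis .
qed

definition extended_density :: "'a set \<Rightarrow> ('a \<Rightarrow> real) \<Rightarrow> real \<Rightarrow> 'a \<Rightarrow> real" where
  "extended_density \<Omega> \<rho> \<alpha> x = (if x \<in> \<Omega> then \<alpha> * \<rho> x else \<alpha>)"

definition extended_measure ::
  "'a::euclidean_space set \<Rightarrow> 'a set \<Rightarrow> ('a \<Rightarrow> real) \<Rightarrow> real \<Rightarrow> 'a measure" where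
  "extended_measure \<Omega> S \<rho> \<alpha> = density (restrict_space lborel S) (\<lambda>x. ennreal (extended_density \<Omega> \<rho> \<alpha> x))"

locale bounded_density =
  fixes \<Omega> :: "'a::euclidean_space set" and \<rho> :: "'a \<Rightarrow> real" and \<mu> :: "'a measure" and D :: real
  assumes dom_borel: "\<Omega> \<in> sets borel"
    and \<rho>_measurable: "\<rho> \<in> borel_measurable (restrict_space borel \<Omega>)"
    and \<mu>_def: "\<mu> = density (restrict_space lborel \<Omega>) (\<lambda>x. ennreal (\<rho> x))"
    and prob_\<mu>: "prob_space \<mu>"
    and D_pos: "0 < D"
    and \<rho>_bounds: "x \<in> \<Omega> \<Longrightarrow> 1 / D \<le> \<rho> x \<and> \<rho> x \<le> D"
begin

sublocale prob_space \<mu> by (rule prob_\<mu>)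

lemma space_\<mu>: "space \<mu> = \<Omega>"
  by (simp add: \<mu>_def space_restrict_space)

lemma sets_\<mu>: "sets \<mu> = sets (restrict_space borel \<Omega>)"
  by (simp add: \<mu>_def cong: sets_restrict_space_cong)

lemma subset_in_sets_\<mu>: "A \<in> sets borel \<Longrightarrow> A \<subseteq> \<Omega> \<Longrightarrow> A \<in> sets \<mu>"
  unfolding sets_\<mu> using dom_borel by (subst sets_restrict_space_iff) auto

lemma emeasure_\<mu>:
  assumes "A \<in> sets borel" "A \<subseteq> \<Omega>"
  shows "emeasure \<mu> A = (\<integral>\<^sup>+x. ennreal (\<rho> x) * indicator A x \<partial>lborel)"
  unfolding \<mu>_def using assms dom_borel \<rho>_measurable by (intro emeasure_density_restrict) auto

lemma measure_\<mu>_le: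
  assumes "A \<in> sets borel" "A \<subseteq> \<Omega>" "emeasure lborel A < \<infinity>"
  shows "measure \<mu> A \<le> D * measure lborel A"
proof -
  have "emeasure \<mu> A \<le> (\<integral>\<^sup>+x. ennreal D * indicator A x \<partial>lborel)"
    unfolding emeasure_\<mu>[OF assms(1,2)] using \<rho>_bounds assms(2)
    by (intro nn_integral_mono) (auto split: split_indicator intro!: ennreal_leI)
  also have "\<dots> = ennreal D * emeasure lborel A"
    using assms(1) by (simp add: nn_integral_cmult_indicator)
  also have "\<dots> = ennreal (D * measure lborel A)"
    using assms(3) D_pos by (simp add: emeasure_eq_ennreal_measure ennreal_mult less_top)
  finally show ?thesis
    using D_pos by (simp add: emeasure_eq_measure)
qed

lemma measure_lborel_le:
  assumes "A \<in> sets borel" "A \<subseteq> \<Omega>"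
  shows "measure lborel A \<le> D * measure \<mu> A"
proof -
  have "ennreal (1 / D) * emeasure lborel A = (\<integral>\<^sup>+x. ennreal (1 / D) * indicator A x \<partial>lborel)"
    using assms(1) by (simp add: nn_integral_cmult_indicator)
  also have "\<dots> \<le> emeasure \<mu> A"
    unfolding emeasure_\<mu>[OF assms] using \<rho>_bounds assms(2)
    by (intro nn_integral_mono) (auto split: split_indicator intro!: ennreal_leI)
  finally have *: "ennreal (1 / D) * emeasure lborel A \<le> emeasure \<mu> A" .
  show ?thesis
  proof (cases "emeasure lborel A = \<infinity>")
    case True
    then show ?thesis using D_pos by (simp add: measure_def)
  next
    case False
    then have "emeasure lborel A = ennreal (measure lborel A)" by (simp add: emeasure_eq_ennreal_measure)
    then have "ennreal (1 / D * measure lborel A) \<le> ennreal (measure \<mu> A)"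
      using * D_pos unfolding emeasure_eq_measure by (simp only: ennreal_mult[OF _ measure_nonneg] zero_le_divide_1_iff less_imp_le)
    then have "1 / D * measure lborel A \<le> measure \<mu> A"
      by (simp only: ennreal_le_iff measure_nonneg)
    then show ?thesis using D_pos by (simp add: field_simps)
  qed
qed

end

text \<open>
  Outside \<open>\<Omega>\<close> a point is sent to the name of its cell; the cells are disjoint, so that the choice is unique.
\<close>

definition extended_map ::
  "'a set \<Rightarrow> 'a set \<Rightarrow> ('a \<Rightarrow> 'a set) \<Rightarrow> ('a \<Rightarrow> 'a) \<Rightarrow> 'a \<Rightarrow> 'a" where
  "extended_map \<Omega> P G T x = (if x \<in> \<Omega> then T x else (SOME p. p \<in> P \<and> x \<in> G p))"

text \<open>
  The Markov kernel of the extension operator: an old atom keeps its value, and a new atom receives the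
  average of \<open>u \<circ> T\<close> over its reservoir, written as a weighted sum over the fibres of \<open>T\<close>.
\<close>

definition transfer_weight ::
  "'a set \<Rightarrow> 'a measure \<Rightarrow> ('a \<Rightarrow> 'a set) \<Rightarrow> ('a \<Rightarrow> 'a) \<Rightarrow> 'a \<Rightarrow> 'a \<Rightarrow> real" where
  "transfer_weight \<Omega> \<mu> Q T x z =
     (if x \<in> \<Omega> then of_bool (x = z) else measure \<mu> {a \<in> Q x. T a = z} / measure \<mu> (Q x))"

locale extended_domain = bounded_density \<Omega> \<rho> \<mu> D
  for \<Omega> :: "'a::euclidean_space set" and \<rho> \<mu> D +
  fixes E :: "'a set" and \<alpha> :: real
  assumes E_borel: "E \<in> sets borel" and E_disjoint: "\<Omega> \<inter> E = {}"
    and \<alpha>: "0 < \<alpha>" "\<alpha> \<le> 1"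
begin

abbreviation S :: "'a set" where "S \<equiv> \<Omega> \<union> E"
abbreviation \<mu>t :: "'a measure" where "\<mu>t \<equiv> extended_measure \<Omega> S \<rho> \<alpha>"

lemma S_borel: "S \<in> sets borel"
  using dom_borel E_borel by simp

lemma space_\<mu>t: "space \<mu>t = S" and sets_\<mu>t: "sets \<mu>t = sets (restrict_space borel S)"
  by (simp_all add: extended_measure_def space_restrict_space cong: sets_restrict_space_cong)

lemma extended_density_measurable:
  "extended_density \<Omega> \<rho> \<alpha> \<in> borel_measurable (restrict_space borel S)"
proof -
  have "(\<lambda>x. if x \<in> \<Omega> then \<alpha> * \<rho> x else \<alpha>) \<in> borel_measurable (restrict_space borel S)"
  proof (rule measurable_If_restrict_space_iff[THEN iffD2, OF _ conjI])
    show "{x \<in> space (restrict_space borel S). x \<in> \<Omega>} \<in> sets (restrict_space borel S)"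
    proof -
      have "{x \<in> space (restrict_space borel S). x \<in> \<Omega>} = \<Omega>" by (auto simp: space_restrict_space)
      then show ?thesis using dom_borel S_borel by (simp add: sets_restrict_space_iff)
    qed
    have "S \<inter> {x. x \<in> \<Omega>} = \<Omega>" by auto
    then show "(\<lambda>x. \<alpha> * \<rho> x) \<in> borel_measurable (restrict_space (restrict_space borel S) {x. x \<in> \<Omega>})"
      using \<rho>_measurable by (subst restrict_restrict_space) (use S_borel dom_borel in auto)
  qed auto
  then show ?thesis by (simp add: extended_density_def[abs_def])
qed

lemma emeasure_\<mu>t:
  assumes "A \<in> sets borel" "A \<subseteq> S"
  shows "emeasure \<mu>t A = (\<integral>\<^sup>+x. ennreal (extended_density \<Omega> \<rho> \<alpha> x) * indicator A x \<partial>lborel)"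
  unfolding extended_measure_def using assms S_borel extended_density_measurable
  by (intro emeasure_density_restrict) auto

lemma emeasure_\<mu>t_dom:
  assumes "A \<in> sets borel" "A \<subseteq> \<Omega>"
  shows "emeasure \<mu>t A = ennreal \<alpha> * emeasure \<mu> A"
proof -
  have "A \<subseteq> S" using assms(2) by blast
  have "emeasure \<mu>t A = (\<integral>\<^sup>+x. ennreal \<alpha> * (ennreal (\<rho> x) * indicator A x) \<partial>lborel)"
    unfolding emeasure_\<mu>t[OF assms(1) \<open>A \<subseteq> S\<close>]
  proof (rule nn_integral_cong)
    fix x show "ennreal (extended_density \<Omega> \<rho> \<alpha> x) * indicator A x = ennreal \<alpha> * (ennreal (\<rho> x) * indicator A x)"
      using assms(2) \<alpha> by (cases "x \<in> A") (auto simp: extended_density_def ennreal_mult')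
  qed
  also have "\<dots> = ennreal \<alpha> * emeasure \<mu> A"
  proof -
    have "(\<lambda>x. ennreal (\<rho> x) * indicator \<Omega> x) \<in> borel_measurable borel"
      using \<rho>_measurable dom_borel borel_measurable_restrict_space_iff_ennreal[of \<Omega> borel "\<lambda>x. ennreal (\<rho> x)"]
      by simp
    then have "(\<lambda>x. (ennreal (\<rho> x) * indicator \<Omega> x) * indicator A x) \<in> borel_measurable borel"
      using assms(1) by simp
    moreover have "(\<lambda>x. (ennreal (\<rho> x) * indicator \<Omega> x) * indicator A x) = (\<lambda>x. ennreal (\<rho> x) * indicator A x)"
      using assms(2) by (auto simp: fun_eq_iff split: split_indicator)
    ultimately show ?thesis
      unfolding emeasure_\<mu>[OF assms] by (intro nn_integral_cmult) simp
  qed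
  finally show ?thesis .
qed

lemma emeasure_\<mu>t_exterior:
  assumes "A \<in> sets borel" "A \<subseteq> E"
  shows "emeasure \<mu>t A = ennreal \<alpha> * emeasure lborel A"
proof -
  have "A \<subseteq> S" using assms(2) by blast
  have "emeasure \<mu>t A = (\<integral>\<^sup>+x. ennreal \<alpha> * indicator A x \<partial>lborel)"
    unfolding emeasure_\<mu>t[OF assms(1) \<open>A \<subseteq> S\<close>]
  proof (rule nn_integral_cong)
    fix x show "ennreal (extended_density \<Omega> \<rho> \<alpha> x) * indicator A x = ennreal \<alpha> * indicator A x"
      using assms(2) E_disjoint by (cases "x \<in> A") (auto simp: extended_density_def)
  qed
  also have "\<dots> = ennreal \<alpha> * emeasure lborel A"
    using assms(1) by (simp add: nn_integral_cmult_indicator)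
  finally show ?thesis .
qed

text \<open>
  The exterior carries Lebesgue measure and \<open>\<Omega>\<close> carries \<open>\<mu>\<close>, of total mass one; the factor \<open>\<alpha>\<close> normalises
  their sum.
\<close>

lemma prob_space_extended:
  assumes "emeasure lborel E < \<infinity>" "\<alpha> = 1 / (1 + measure lborel E)"
  shows "prob_space \<mu>t"
proof
  have sets: "\<Omega> \<in> sets \<mu>t" "E \<in> sets \<mu>t"
    unfolding sets_\<mu>t using dom_borel E_borel S_borel by (auto simp: sets_restrict_space_iff)
  have "emeasure \<mu>t S = emeasure \<mu>t \<Omega> + emeasure \<mu>t E"
    using plus_emeasure[OF sets E_disjoint] by simp
  also have "\<dots> = ennreal \<alpha> * emeasure \<mu> \<Omega> + ennreal \<alpha> * emeasure lborel E"
    using emeasure_\<mu>t_dom[OF dom_borel] emeasure_\<mu>t_exterior[OF E_borel] by simp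
  also have "\<dots> = ennreal \<alpha> * ennreal 1 + ennreal \<alpha> * ennreal (measure lborel E)"
    using emeasure_space_1 assms(1) by (simp add: space_\<mu> emeasure_eq_ennreal_measure less_top)
  also have "\<dots> = ennreal (\<alpha> * (1 + measure lborel E))"
    using \<alpha> by (simp add: distrib_left ennreal_mult')
  also have "\<alpha> * (1 + measure lborel E) = 1"
    using assms(2) measure_nonneg[of lborel E] by (simp add: add_nonneg_eq_0_iff)
  finally show "emeasure \<mu>t (space \<mu>t) = 1" by (simp add: space_\<mu>t)
qed

end

text \<open>
  The data at one step of the sequence.  The scale \<open>r\<close> is a bound for the displacement of the transport map
  \<open>T\<close>, and the new atoms are the names of the cells.
\<close>

locale extension_at_scale = extended_domain \<Omega> \<rho> \<mu> D E \<alpha>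
  for \<Omega> :: "'a::euclidean_space set" and \<rho> \<mu> D E \<alpha> +
  fixes C r :: real and P :: "'a set" and G Q :: "'a \<Rightarrow> 'a set"
    and V :: "'a set" and T :: "'a \<Rightarrow> 'a"
  assumes prob_ext: "prob_space (extended_measure \<Omega> (\<Omega> \<union> E) \<rho> \<alpha>)"
    and cells: "cell_system \<Omega> E C r P G Q"
    and C_ge_1: "1 \<le> C" and r_pos: "0 < r"
    and V: "finite V" "V \<subseteq> \<Omega>"
    and T_measurable: "T \<in> restrict_space borel \<Omega> \<rightarrow>\<^sub>M restrict_space borel \<Omega>"
    and T_into: "x \<in> \<Omega> \<Longrightarrow> T x \<in> V"
    and T_close: "x \<in> \<Omega> \<Longrightarrow> norm (T x - x) \<le> r"
begin

abbreviation \<nu> :: "'a measure" where "\<nu> \<equiv> distr \<mu> (restrict_space borel \<Omega>) T"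

abbreviation Tt :: "'a \<Rightarrow> 'a" where "Tt \<equiv> extended_map \<Omega> P G T"

abbreviation \<nu>t :: "'a measure" where "\<nu>t \<equiv> distr \<mu>t (restrict_space borel S) Tt"

abbreviation w :: "'a \<Rightarrow> 'a \<Rightarrow> real" where "w \<equiv> transfer_weight \<Omega> \<mu> Q T"

lemma P_finite: "finite P" and G_disjoint: "disjoint_family_on G P" and G_cover: "(\<Union>p\<in>P. G p) = E"
  and G_center: "p \<in> P \<Longrightarrow> p \<in> G p" and G_borel: "p \<in> P \<Longrightarrow> G p \<in> sets borel"
  and Q_borel: "p \<in> P \<Longrightarrow> Q p \<in> sets borel" and Q_sub: "p \<in> P \<Longrightarrow> Q p \<subseteq> \<Omega>"
  and Q_pos: "p \<in> P \<Longrightarrow> 0 < measure lborel (Q p)"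
  and G_diam: "p \<in> P \<Longrightarrow> x \<in> G p \<Longrightarrow> y \<in> G p \<Longrightarrow> norm (x - y) \<le> C * r"
  and Q_dist: "p \<in> P \<Longrightarrow> q \<in> P \<Longrightarrow> x \<in> G p \<Longrightarrow> y \<in> G q \<Longrightarrow> a \<in> Q p \<Longrightarrow> b \<in> Q q \<Longrightarrow>
                norm (a - b) \<le> C * (norm (x - y) + r)"
  and Q_dist_dom: "p \<in> P \<Longrightarrow> x \<in> G p \<Longrightarrow> a \<in> Q p \<Longrightarrow> y \<in> \<Omega> \<Longrightarrow> norm (a - y) \<le> C * (norm (x - y) + r)"
  and Q_overlap: "z \<in> \<Omega> \<Longrightarrow> (\<Sum>p\<in>P. measure lborel (G p) / measure lborel (Q p) * indicator (Q p) z) \<le> C"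
  using cells unfolding cell_system_def by blast+

lemma G_sub: "p \<in> P \<Longrightarrow> G p \<subseteq> E"
  using G_cover by blast

lemma P_sub: "P \<subseteq> E"
  using G_center G_sub by blast

lemma Tt_on_dom: "x \<in> \<Omega> \<Longrightarrow> Tt x = T x"
  by (simp add: extended_map_def)

lemma Tt_on_cell:
  assumes "p \<in> P" "x \<in> G p"
  shows "Tt x = p"
proof -
  have "x \<notin> \<Omega>" using G_sub[OF assms(1)] assms(2) E_disjoint by blast
  moreover have "(SOME p. p \<in> P \<and> x \<in> G p) = p"
    using assms G_disjoint unfolding disjoint_family_on_def by (intro some_equality) blast+
  ultimately show ?thesis by (simp add: extended_map_def)
qed

lemma Tt_into: "x \<in> S \<Longrightarrow> Tt x \<in> V \<union> P"
  using Tt_on_dom T_into Tt_on_cell G_cover by (metis UN_E Un_iff)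

lemma Tt_close:
  assumes "x \<in> S"
  shows "norm (Tt x - x) \<le> C * r"
proof (cases "x \<in> \<Omega>")
  case True
  have "r \<le> C * r" using C_ge_1 r_pos by simp
  then show ?thesis using T_close[OF True] True by (simp add: Tt_on_dom)
next
  case False
  then obtain p where "p \<in> P" "x \<in> G p" using assms G_cover by blast
  then show ?thesis using G_diam G_center Tt_on_cell by simp
qed

lemma T_fibre_borel: "{x \<in> \<Omega>. T x = z} \<in> sets borel"
proof -
  have "{x \<in> \<Omega>. T x = z} \<in> sets (restrict_space borel \<Omega>)"
  proof (cases "z \<in> \<Omega>")
    case True
    then have "{z} \<in> sets (restrict_space borel \<Omega>)"
      using dom_borel by (subst sets_restrict_space_iff) auto
    then have "T -` {z} \<inter> \<Omega> \<in> sets (restrict_space borel \<Omega>)"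
      using measurable_sets[OF T_measurable, of "{z}"] by (simp add: space_restrict_space)
    moreover have "T -` {z} \<inter> \<Omega> = {x \<in> \<Omega>. T x = z}" by auto
    ultimately show ?thesis by simp
  next
    case False
    then have empty: "{x \<in> \<Omega>. T x = z} = {}" using T_into V(2) by blast
    show ?thesis unfolding empty by simp
  qed
  then show ?thesis using dom_borel by (subst (asm) sets_restrict_space_iff) auto
qed

lemma Tt_fibre_dom: "x \<in> \<Omega> \<Longrightarrow> {y \<in> S. Tt y = x} = {y \<in> \<Omega>. T y = x}"
proof -
  assume x: "x \<in> \<Omega>"
  have in_dom: "y \<in> \<Omega>" if "y \<in> S" "Tt y = x" for y
  proof (rule ccontr)
    assume "y \<notin> \<Omega>"
    then obtain p where "p \<in> P" "y \<in> G p" using \<open>y \<in> S\<close> G_cover by blast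
    then have "x \<in> P" using Tt_on_cell that(2) by auto
    then show False using x P_sub E_disjoint by blast
  qed
  then have "y \<in> S \<and> Tt y = x \<longleftrightarrow> y \<in> \<Omega> \<and> T y = x" for y
    using Tt_on_dom[of y] in_dom[of y] by (metis UnI1)
  then show ?thesis by blast
qed

lemma Tt_fibre_cell:
  assumes "p \<in> P"
  shows "{y \<in> S. Tt y = p} = G p"
proof
  show "{y \<in> S. Tt y = p} \<subseteq> G p"
  proof
    fix y assume y: "y \<in> {y \<in> S. Tt y = p}"
    have "y \<notin> \<Omega>"
    proof
      assume "y \<in> \<Omega>"
      then have "p \<in> \<Omega>" using y Tt_on_dom T_into V(2) by auto
      then show False using assms P_sub E_disjoint by blast
    qed
    then obtain q where "q \<in> P" "y \<in> G q" using y G_cover by blast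
    then show "y \<in> G p" using Tt_on_cell y by auto
  qed
  show "G p \<subseteq> {y \<in> S. Tt y = p}" using assms Tt_on_cell G_sub by blast
qed

lemma Tt_measurable: "Tt \<in> restrict_space borel S \<rightarrow>\<^sub>M restrict_space borel S"
proof (rule measurable_restrict_space2)
  have sp: "space (restrict_space borel S) = S" by (simp only: space_restrict_space space_borel Int_UNIV_right)
  show "Tt \<in> space (restrict_space borel S) \<rightarrow> S"
    unfolding sp
  proof
    fix x assume "x \<in> S"
    then show "Tt x \<in> S" using Tt_into[of x] V(2) P_sub by blast
  qed
  have fin: "finite (Tt ` S)"
  proof (rule finite_subset)
    show "Tt ` S \<subseteq> V \<union> P" using Tt_into by blast
    show "finite (V \<union> P)" using V(1) P_finite by simp
  qed
  have fib: "Tt -` {y} \<inter> S \<in> sets (restrict_space borel S)" if "y \<in> Tt ` S" for y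
  proof -
    have y: "y \<in> V \<union> P" using Tt_into that by blast
    have eq: "Tt -` {y} \<inter> S = {x \<in> S. Tt x = y}" by blast
    have "{x \<in> S. Tt x = y} \<in> sets borel"
      using y
    proof
      assume "y \<in> V"
      then have "y \<in> \<Omega>" using V(2) by blast
      then show ?thesis using T_fibre_borel[of y] by (simp only: Tt_fibre_dom)
    next
      assume "y \<in> P"
      then show ?thesis using G_borel[of y] by (simp only: Tt_fibre_cell)
    qed
    then show ?thesis unfolding eq using S_borel by (subst sets_restrict_space_iff) auto
  qed
  have "simple_function (restrict_space borel S) Tt"
    unfolding simple_function_def sp using fin fib by blast
  then show "Tt \<in> borel_measurable (restrict_space borel S)"
    by (rule borel_measurable_simple_function)
qed

lemma Tt_measurable_\<mu>t: "Tt \<in> \<mu>t \<rightarrow>\<^sub>M restrict_space borel S"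
  using Tt_measurable sets_\<mu>t measurable_cong_sets by blast

lemma T_measurable_\<mu>: "T \<in> \<mu> \<rightarrow>\<^sub>M restrict_space borel \<Omega>"
  using T_measurable sets_\<mu> measurable_cong_sets by blast

lemma singleton_sets: "x \<in> X \<Longrightarrow> X \<in> sets borel \<Longrightarrow> {x} \<in> sets (restrict_space borel X)" for X :: "'a set"
  by (subst sets_restrict_space_iff) auto

lemma measure_\<nu>: "x \<in> \<Omega> \<Longrightarrow> measure \<nu> {x} = measure \<mu> {y \<in> \<Omega>. T y = x}"
  using singleton_sets[OF _ dom_borel, of x]
  by (subst measure_distr[OF T_measurable_\<mu>]) (auto simp: space_\<mu> intro!: arg_cong[where f = "measure \<mu>"])

lemma measure_\<nu>t: "x \<in> S \<Longrightarrow> measure \<nu>t {x} = measure \<mu>t {y \<in> S. Tt y = x}"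
  using singleton_sets[OF _ S_borel, of x]
  by (subst measure_distr[OF Tt_measurable_\<mu>t]) (auto simp: space_\<mu>t intro!: arg_cong[where f = "measure \<mu>t"])

lemma \<nu>t_dom:
  assumes "x \<in> \<Omega>"
  shows "measure \<nu>t {x} = \<alpha> * measure \<nu> {x}"
proof -
  have "measure \<nu>t {x} = measure \<mu>t {y \<in> \<Omega>. T y = x}"
    using measure_\<nu>t[of x] assms by (simp only: Tt_fibre_dom UnI1)
  also have "\<dots> = \<alpha> * measure \<mu> {y \<in> \<Omega>. T y = x}"
    using emeasure_\<mu>t_dom[OF T_fibre_borel, of x] \<alpha> by (simp add: measure_def enn2real_mult)
  finally show ?thesis by (simp only: measure_\<nu>[OF assms])
qed

lemma \<nu>t_cell:
  assumes "p \<in> P"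
  shows "measure \<nu>t {p} = \<alpha> * measure lborel (G p)"
proof -
  have "p \<in> S" using P_sub assms by blast
  then show ?thesis
    using measure_\<nu>t[of p] assms emeasure_\<mu>t_exterior[OF G_borel G_sub, of p] \<alpha>
    by (simp only: Tt_fibre_cell measure_def enn2real_mult enn2real_ennreal less_imp_le)
qed

lemma prob_\<nu>t: "prob_space \<nu>t"
  by (rule prob_space.prob_space_distr[OF prob_ext Tt_measurable_\<mu>t])

lemma emeasure_\<nu>t_support: "emeasure \<nu>t (V \<union> P) = 1"
proof -
  have "V \<union> P \<in> sets (restrict_space borel S)"
    using V P_finite P_sub S_borel by (subst sets_restrict_space_iff) (auto intro!: borel_closed finite_imp_closed)
  then have "emeasure \<nu>t (V \<union> P) = emeasure \<mu>t (Tt -` (V \<union> P) \<inter> space \<mu>t)"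
    by (rule emeasure_distr[OF Tt_measurable_\<mu>t])
  also have "Tt -` (V \<union> P) \<inter> space \<mu>t = space \<mu>t" using Tt_into by (auto simp: space_\<mu>t)
  finally show ?thesis using prob_space.emeasure_space_1[OF prob_ext] by simp
qed

text \<open>
  The preimage of an atom lies within distance \<open>r\<close> of it.  This bounds the smallest atom by a multiple of
  the volume of any one cell, since the latter dominates \<open>r\<close>-balls.
\<close>

lemma \<nu>_atom_le:
  assumes "z \<in> V"
  shows "measure \<nu> {z} \<le> D * measure lborel (\<Omega> \<inter> cball z r)"
proof -
  have "{y \<in> \<Omega>. T y = z} \<subseteq> \<Omega> \<inter> cball z r"
    using T_close by (auto simp: dist_norm)
  moreover have b: "\<Omega> \<inter> cball z r \<in> sets borel" using dom_borel by auto
  ultimately have "measure \<mu> {y \<in> \<Omega>. T y = z} \<le> measure \<mu> (\<Omega> \<inter> cball z r)"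
    using subset_in_sets_\<mu>[of "\<Omega> \<inter> cball z r"] by (intro finite_measure_mono) auto
  also have "\<dots> \<le> D * measure lborel (\<Omega> \<inter> cball z r)"
    using b emeasure_bounded_finite[of "\<Omega> \<inter> cball z r"] by (intro measure_\<mu>_le) (auto intro: bounded_Int)
  finally show ?thesis using assms V(2) by (auto simp: measure_\<nu>)
qed

lemma w_dom: "x \<in> \<Omega> \<Longrightarrow> w x z = of_bool (x = z)"
  by (simp add: transfer_weight_def)

lemma Q_fibre: "p \<in> P \<Longrightarrow> {a \<in> Q p. T a = z} = Q p \<inter> {x \<in> \<Omega>. T x = z}"
  using Q_sub by blast

lemma Q_fibre_borel: "p \<in> P \<Longrightarrow> {a \<in> Q p. T a = z} \<in> sets borel"
  using Q_fibre[of p z] Q_borel[of p] T_fibre_borel by auto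

lemma w_cell: "p \<in> P \<Longrightarrow> w p z = measure \<mu> {a \<in> Q p. T a = z} / measure \<mu> (Q p)"
  using P_sub E_disjoint by (auto simp: transfer_weight_def)

lemma w_nonneg: "0 \<le> w x z"
  by (simp add: transfer_weight_def)

lemma \<mu>_Q_pos: "p \<in> P \<Longrightarrow> 0 < measure \<mu> (Q p)"
  using measure_lborel_le[OF Q_borel Q_sub, of p] Q_pos[of p] D_pos
  by (metis less_le_trans zero_less_mult_pos)

lemma w_sum:
  assumes "x \<in> V \<union> P"
  shows "(\<Sum>z\<in>V. w x z) = 1"
proof (cases "x \<in> \<Omega>")
  case True
  then have "x \<in> V" using assms P_sub E_disjoint by blast
  then show ?thesis using True V(1) by (simp add: w_dom sum.delta of_bool_def)
next
  case False
  then have x: "x \<in> P" using assms V(2) by blast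
  have "(\<Sum>z\<in>V. measure \<mu> {a \<in> Q x. T a = z}) = measure \<mu> (\<Union>z\<in>V. {a \<in> Q x. T a = z})"
    using V(1) Q_fibre_borel[OF x] Q_sub[OF x]
    by (intro finite_measure_finite_Union[symmetric]) (auto simp: disjoint_family_on_def intro!: subset_in_sets_\<mu>)
  also have "(\<Union>z\<in>V. {a \<in> Q x. T a = z}) = Q x"
    using Q_sub[OF x] T_into by blast
  finally show ?thesis
    using \<mu>_Q_pos[OF x] by (simp add: w_cell[OF x] sum_divide_distrib[symmetric])
qed

lemma w_support:
  assumes "p \<in> P" "0 < w p z"
  obtains a where "a \<in> Q p" "T a = z"
proof -
  have "{a \<in> Q p. T a = z} \<noteq> {}"
  proof
    assume empty: "{a \<in> Q p. T a = z} = {}"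
    show False using assms(2) unfolding w_cell[OF assms(1)] empty by simp
  qed
  then show ?thesis using that by blast
qed

text \<open>
  The mass of the new atoms is returned to the old ones.  Pulled back to \<open>\<Omega>\<close>, the reservoirs carry density at
  most \<open>D * C\<close> with respect to \<open>\<mu>\<close> by the overlap clause, and \<open>T\<close> pushes this density to at most
  \<open>D * C * \<nu>\<close>; the old atoms account for the summand \<open>1\<close>.
\<close>

lemma w_pull:
  assumes z: "z \<in> V"
  shows "(\<Sum>x\<in>V \<union> P. measure \<nu>t {x} * w x z) \<le> (1 + D * C) * measure \<nu> {z}"
proof -
  define F where "F = {x \<in> \<Omega>. T x = z}"
  have F: "F \<in> sets \<mu>" unfolding F_def by (intro subset_in_sets_\<mu> T_fibre_borel) auto
  have \<nu>F: "measure \<nu> {z} = measure \<mu> F" using z V(2) by (auto simp: measure_\<nu> F_def)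
  have Qs: "Q p \<in> sets \<mu>" if "p \<in> P" for p using Q_borel Q_sub that by (intro subset_in_sets_\<mu>)
  have "(\<Sum>x\<in>P. measure lborel (G x) * w x z) \<le> (\<Sum>x\<in>P. D * (measure lborel (G x) / measure lborel (Q x) * measure \<mu> (Q x \<inter> F)))"
  proof (rule sum_mono)
    fix x assume x: "x \<in> P"
    have "1 / measure \<mu> (Q x) \<le> D / measure lborel (Q x)"
      using measure_lborel_le[OF Q_borel Q_sub, of x] x Q_pos[OF x] \<mu>_Q_pos[OF x] by (simp add: field_simps)
    then have "measure lborel (G x) * measure \<mu> (Q x \<inter> F) * (1 / measure \<mu> (Q x))
        \<le> measure lborel (G x) * measure \<mu> (Q x \<inter> F) * (D / measure lborel (Q x))"
      by (intro mult_left_mono) auto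
    then show "measure lborel (G x) * w x z \<le> D * (measure lborel (G x) / measure lborel (Q x) * measure \<mu> (Q x \<inter> F))"
      using Q_fibre[OF x, of z] by (simp add: w_cell[OF x] F_def mult_ac)
  qed
  also have "\<dots> = D * (\<integral>a. (\<Sum>x\<in>P. measure lborel (G x) / measure lborel (Q x) * indicator (Q x \<inter> F) a) \<partial>\<mu>)"
  proof -
    have "(\<integral>a. (\<Sum>x\<in>P. measure lborel (G x) / measure lborel (Q x) * indicator (Q x \<inter> F) a) \<partial>\<mu>)
        = (\<Sum>x\<in>P. \<integral>a. measure lborel (G x) / measure lborel (Q x) * indicator (Q x \<inter> F) a \<partial>\<mu>)"
      using Qs F by (intro Bochner_Integration.integral_sum integrable_mult_right) (auto simp: emeasure_eq_measure)
    also have "\<dots> = (\<Sum>x\<in>P. measure lborel (G x) / measure lborel (Q x) * measure \<mu> (Q x \<inter> F))"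
      using Qs F by (intro sum.cong refl) (simp add: Int_absorb2 sets.sets_into_space)
    finally show ?thesis by (simp add: sum_distrib_left)
  qed
  also have "\<dots> \<le> D * (\<integral>a. C * indicator F a \<partial>\<mu>)"
  proof (intro mult_left_mono integral_mono)
    show "integrable \<mu> (\<lambda>a. \<Sum>x\<in>P. measure lborel (G x) / measure lborel (Q x) * indicator (Q x \<inter> F) a)"
      using Qs F by (intro Bochner_Integration.integrable_sum integrable_mult_right) (auto simp: emeasure_eq_measure)
    show "integrable \<mu> (\<lambda>a. C * indicator F a)"
      using F by (intro integrable_mult_right) (auto simp: emeasure_eq_measure)
    fix a assume "a \<in> space \<mu>"
    then have "(\<Sum>x\<in>P. measure lborel (G x) / measure lborel (Q x) * indicator (Q x) a) * indicator F a \<le> C * indicator F a"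
      using Q_overlap[of a] by (intro mult_right_mono) (auto simp: space_\<mu>)
    then show "(\<Sum>x\<in>P. measure lborel (G x) / measure lborel (Q x) * indicator (Q x \<inter> F) a) \<le> C * indicator F a"
      by (simp add: sum_distrib_right indicator_inter_arith mult.assoc)
  qed (use D_pos in simp)
  also have "\<dots> = D * C * measure \<nu> {z}"
    using F by (simp add: \<nu>F Int_absorb2 sets.sets_into_space)
  finally have "(\<Sum>x\<in>P. measure lborel (G x) * w x z) \<le> D * C * measure \<nu> {z}" .
  then have "\<alpha> * (\<Sum>x\<in>P. measure lborel (G x) * w x z) \<le> 1 * (D * C * measure \<nu> {z})"
    using \<alpha> w_nonneg by (intro mult_mono) (auto intro!: sum_nonneg)
  then have "(\<Sum>x\<in>P. measure \<nu>t {x} * w x z) \<le> D * C * measure \<nu> {z}"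
    by (simp add: \<nu>t_cell sum_distrib_left mult_ac)
  moreover have "(\<Sum>x\<in>V. measure \<nu>t {x} * w x z) \<le> measure \<nu> {z}"
  proof -
    have "(\<Sum>x\<in>V. measure \<nu>t {x} * w x z) = (\<Sum>x\<in>V. if x = z then \<alpha> * measure \<nu> {z} else 0)"
      using V(2) by (intro sum.cong) (auto simp: w_dom \<nu>t_dom)
    also have "\<dots> = \<alpha> * measure \<nu> {z}" using V(1) z by simp
    also have "\<dots> \<le> measure \<nu> {z}" using \<alpha> by (simp add: mult_left_le_one_le)
    finally show ?thesis .
  qed
  moreover have "(\<Sum>x\<in>V \<union> P. measure \<nu>t {x} * w x z) = (\<Sum>x\<in>V. measure \<nu>t {x} * w x z) + (\<Sum>x\<in>P. measure \<nu>t {x} * w x z)"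
    using V P_finite P_sub E_disjoint by (intro sum.union_disjoint) auto
  ultimately show ?thesis by (simp add: distrib_right)
qed

text \<open>
  Two atoms at distance at most \<open>h\<close> have reservoirs at distance at most \<open>2 * C * h\<close>, because \<open>r \<le> h\<close>, and
  passing from a reservoir to the atoms that \<open>T\<close> assigns to it costs another \<open>r\<close> at each end.
\<close>

lemma w_near:
  assumes xy: "x \<in> V \<union> P" "y \<in> V \<union> P" and h: "norm (x - y) \<le> h" "r \<le> h"
    and w: "0 < w x z" "0 < w y z'"
  shows "norm (z - z') \<le> (2 * C + 2) * h"
proof -
  have hh: "C * (norm (x - y) + r) \<le> 2 * C * h"
    using C_ge_1 h mult_left_mono[of "norm (x - y) + r" "2 * h" C] by simp
  have h0: "0 \<le> h" using h r_pos by simp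
  have inV: "z = x" if "x \<in> V" "0 < w x z" for x z
    using that V(2) w_dom[of x z] by (cases "x = z") auto
  consider "x \<in> V" "y \<in> V" | "x \<in> V" "y \<in> P" | "x \<in> P" "y \<in> V" | "x \<in> P" "y \<in> P" using xy by blast
  then show ?thesis
  proof cases
    case 1
    then have "norm (z - z') \<le> 1 * h" using inV w h by auto
    also have "\<dots> \<le> (2 * C + 2) * h" using C_ge_1 h0 by (intro mult_right_mono) auto
    finally show ?thesis .
  next
    case 2
    obtain a where a: "a \<in> Q y" "T a = z'" using w_support[OF 2(2) w(2)] .
    have zx: "z = x" "x \<in> \<Omega>" using inV[OF 2(1) w(1)] 2(1) V(2) by auto
    have "norm (a - x) \<le> C * (norm (y - x) + r)"
      using Q_dist_dom[OF 2(2) G_center[OF 2(2)] a(1) zx(2)] .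
    moreover have "norm (z' - a) \<le> r" using T_close a Q_sub[OF 2(2)] by blast
    ultimately have "norm (z - z') \<le> 2 * C * h + h"
      using norm_triangle_ineq[of "z' - a" "a - x"] hh h zx(1) by (simp add: norm_minus_commute)
    then show ?thesis using h0 by (simp add: distrib_right)
  next
    case 3
    obtain a where a: "a \<in> Q x" "T a = z" using w_support[OF 3(1) w(1)] .
    have zy: "z' = y" "y \<in> \<Omega>" using inV[OF 3(2) w(2)] 3(2) V(2) by auto
    have "norm (a - y) \<le> C * (norm (x - y) + r)"
      using Q_dist_dom[OF 3(1) G_center[OF 3(1)] a(1) zy(2)] .
    moreover have "norm (z - a) \<le> r" using T_close a Q_sub[OF 3(1)] by blast
    ultimately have "norm (z - z') \<le> 2 * C * h + h"
      using norm_triangle_ineq[of "z - a" "a - y"] hh h zy(1) by simp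
    then show ?thesis using h0 by (simp add: distrib_right)
  next
    case 4
    obtain a where a: "a \<in> Q x" "T a = z" using w_support[OF 4(1) w(1)] .
    obtain b where b: "b \<in> Q y" "T b = z'" using w_support[OF 4(2) w(2)] .
    have "norm (a - b) \<le> C * (norm (x - y) + r)"
      using Q_dist[OF 4 G_center[OF 4(1)] G_center[OF 4(2)] a(1) b(1)] .
    moreover have "norm (z - a) \<le> r" "norm (z' - b) \<le> r" using T_close a b Q_sub 4 by blast+
    ultimately have "norm (z - z') \<le> 2 * C * h + 2 * h"
      using norm_triangle_ineq[of "z - a" "a - b"] norm_triangle_ineq4[of "z - b" "z' - b"] hh h by simp
    then show ?thesis by (simp add: distrib_right)
  qed
qed

end

section \<open>Comparison of atoms and the extension theorem\<close>

lemma min_atom_le: "finite V \<Longrightarrow> x \<in> V \<Longrightarrow> min_atom V \<nu> \<le> measure \<nu> {x}"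
  unfolding min_atom_def by simp

lemma max_atom_ge: "finite V \<Longrightarrow> x \<in> V \<Longrightarrow> measure \<nu> {x} \<le> max_atom V \<nu>"
  unfolding max_atom_def by simp

lemma min_atom_greatest: "finite V \<Longrightarrow> V \<noteq> {} \<Longrightarrow> (\<And>x. x \<in> V \<Longrightarrow> a \<le> measure \<nu> {x}) \<Longrightarrow> a \<le> min_atom V \<nu>"
  unfolding min_atom_def by simp

lemma max_atom_least: "finite V \<Longrightarrow> V \<noteq> {} \<Longrightarrow> (\<And>x. x \<in> V \<Longrightarrow> measure \<nu> {x} \<le> a) \<Longrightarrow> max_atom V \<nu> \<le> a"
  unfolding max_atom_def by simp

lemma min_atom_attained: "finite V \<Longrightarrow> V \<noteq> {} \<Longrightarrow> \<exists>x\<in>V. min_atom V \<nu> = measure \<nu> {x}"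
  unfolding min_atom_def by (metis (no_types, lifting) Min_in finite_imageI image_is_empty imageE)

lemma max_atom_attained: "finite V \<Longrightarrow> V \<noteq> {} \<Longrightarrow> \<exists>x\<in>V. max_atom V \<nu> = measure \<nu> {x}"
  unfolding max_atom_def by (metis (no_types, lifting) Max_in finite_imageI image_is_empty imageE)

lemma discrete_prob_on_sum_atoms:
  assumes "discrete_prob_on X V \<nu>" "X \<in> sets borel"
  shows "(\<Sum>x\<in>V. measure \<nu> {x}) = 1"
proof -
  interpret prob_space \<nu> using assms by (simp add: discrete_prob_on_def)
  have V: "finite V" "V \<subseteq> X" "sets \<nu> = sets (restrict_space borel X)" "emeasure \<nu> V = 1"
    using assms by (auto simp: discrete_prob_on_def)
  have "measure \<nu> V = (\<Sum>x\<in>V. measure \<nu> {x})"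
    using V assms(2) by (intro finite_measure_eq_sum_singleton) (auto simp: sets_restrict_space_iff)
  then show ?thesis using V(4) by (simp add: measure_def)
qed

lemma extended_atoms_comparable:
  assumes fin: "finite V" "V \<noteq> {}" "finite P" and \<alpha>: "0 < \<alpha>" "\<alpha> \<le> 1" and c: "0 < c"
    and onV: "\<And>x. x \<in> V \<Longrightarrow> measure \<nu>t {x} = \<alpha> * measure \<nu> {x}"
    and onP: "\<And>p. p \<in> P \<Longrightarrow> measure \<nu>t {p} \<le> max_atom V \<nu>"
      "\<And>p. p \<in> P \<Longrightarrow> max_atom V \<nu> / 2 \<le> measure \<nu>t {p} \<or> c * min_atom V \<nu> \<le> measure \<nu>t {p}"
    and k: "k = min \<alpha> (min (1/2) c)"
  shows "k * min_atom V \<nu> \<le> min_atom (V \<union> P) \<nu>t" "min_atom (V \<union> P) \<nu>t \<le> 1 / k * min_atom V \<nu>"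
    "k * max_atom V \<nu> \<le> max_atom (V \<union> P) \<nu>t" "max_atom (V \<union> P) \<nu>t \<le> 1 / k * max_atom V \<nu>"
proof -
  have k: "0 < k" "k \<le> 1" "k \<le> \<alpha>" "k \<le> 1/2" "k \<le> c" using k \<alpha> c by auto
  have W: "finite (V \<union> P)" "V \<union> P \<noteq> {}" using fin by auto
  obtain a where a: "a \<in> V" "min_atom V \<nu> = measure \<nu> {a}" using min_atom_attained fin by blast
  obtain b where b: "b \<in> V" "max_atom V \<nu> = measure \<nu> {b}" using max_atom_attained fin by blast
  have mn0: "0 \<le> min_atom V \<nu>" "0 \<le> max_atom V \<nu>" using a b by auto
  have mm: "min_atom V \<nu> \<le> max_atom V \<nu>" using min_atom_le[OF fin(1) b(1)] b(2) by simp
  have up: "t \<le> 1 / k * t" "\<alpha> * t \<le> t" if "0 \<le> t" for t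
    using that k \<alpha> mult_right_mono[of 1 "1 / k" t] mult_right_mono[of \<alpha> 1 t] by auto
  show "k * min_atom V \<nu> \<le> min_atom (V \<union> P) \<nu>t"
  proof (rule min_atom_greatest[OF W])
    fix x assume "x \<in> V \<union> P"
    then consider "x \<in> V" | "x \<in> P" by blast
    then show "k * min_atom V \<nu> \<le> measure \<nu>t {x}"
    proof cases
      case 1
      have "k * min_atom V \<nu> \<le> \<alpha> * measure \<nu> {x}"
        using k \<alpha> min_atom_le[OF fin(1) 1] mn0 by (intro mult_mono) auto
      then show ?thesis using onV[OF 1] by simp
    next
      case 2
      have "k * min_atom V \<nu> \<le> 1/2 * max_atom V \<nu>" "k * min_atom V \<nu> \<le> c * min_atom V \<nu>"
        using k mm mn0 by (auto intro!: mult_mono simp del: times_divide_eq_left)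
      then show ?thesis using onP(2)[OF 2] by auto
    qed
  qed
  have "min_atom (V \<union> P) \<nu>t \<le> \<alpha> * min_atom V \<nu>"
    using min_atom_le[OF W(1), of a \<nu>t] a onV by simp
  then show "min_atom (V \<union> P) \<nu>t \<le> 1 / k * min_atom V \<nu>" using up[OF mn0(1)] by linarith
  have "\<alpha> * max_atom V \<nu> \<le> max_atom (V \<union> P) \<nu>t"
    using max_atom_ge[OF W(1), of b \<nu>t] b onV by simp
  then show "k * max_atom V \<nu> \<le> max_atom (V \<union> P) \<nu>t"
    using mult_right_mono[OF k(3) mn0(2)] by linarith
  have "max_atom (V \<union> P) \<nu>t \<le> max_atom V \<nu>"
  proof (rule max_atom_least[OF W])
    fix x assume "x \<in> V \<union> P"
    then show "measure \<nu>t {x} \<le> max_atom V \<nu>"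
      using onV[of x] onP(1)[of x] up(2)[of "measure \<nu> {x}"] max_atom_ge[OF fin(1), of x \<nu>] by force
  qed
  then show "max_atom (V \<union> P) \<nu>t \<le> 1 / k * max_atom V \<nu>" using up(1)[OF mn0(2)] by linarith
qed

text \<open>
  If the atoms on \<open>V\<close> are comparable to \<open>1 / card V\<close>, so are those on \<open>W\<close>; since the latter sum to one, the
  two cardinalities are comparable as well.
\<close>

lemma uniform_atoms_transfer:
  assumes fin: "finite V" "V \<noteq> {}" "finite W" "W \<noteq> {}"
    and sum: "(\<Sum>x\<in>W. measure \<nu>t {x}) = 1"
    and k: "0 < k" and D: "0 < D"
    and cmp: "k * min_atom V \<nu> \<le> min_atom W \<nu>t" "max_atom W \<nu>t \<le> 1 / k * max_atom V \<nu>"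
    and unif: "\<And>x. x \<in> V \<Longrightarrow> 1 / (D * real (card V)) \<le> measure \<nu> {x} \<and> measure \<nu> {x} \<le> D / real (card V)"
    and x: "x \<in> W"
  shows "1 / ((D\<^sup>2 / k\<^sup>2) * real (card W)) \<le> measure \<nu>t {x} \<and> measure \<nu>t {x} \<le> (D\<^sup>2 / k\<^sup>2) / real (card W)"
proof -
  define N where "N = real (card V)"
  define N' where "N' = real (card W)"
  have N: "0 < N" "0 < N'" using fin by (auto simp: N_def N'_def card_gt_0_iff)
  have lo: "k / (D * N) \<le> measure \<nu>t {y}" and hi: "measure \<nu>t {y} \<le> D / (k * N)" if y: "y \<in> W" for y
  proof -
    have "1 / (D * N) \<le> min_atom V \<nu>" using unif by (intro min_atom_greatest fin) (auto simp: N_def)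
    then have "k * (1 / (D * N)) \<le> k * min_atom V \<nu>" using k by (intro mult_left_mono) auto
    then show "k / (D * N) \<le> measure \<nu>t {y}" using cmp(1) min_atom_le[OF fin(3) y, of \<nu>t] by simp
    have "max_atom V \<nu> \<le> D / N" using unif by (intro max_atom_least fin) (auto simp: N_def)
    then have "1 / k * max_atom V \<nu> \<le> 1 / k * (D / N)" using k by (intro mult_left_mono) auto
    then show "measure \<nu>t {y} \<le> D / (k * N)" using cmp(2) max_atom_ge[OF fin(3) y, of \<nu>t] by simp
  qed
  \<comment> \<open>comparing the total mass one with the smallest and the largest atom bounds the ratio of the cardinalities\<close>
  have "N' * (k / (D * N)) \<le> 1"
    using sum_mono[of W "\<lambda>_. k / (D * N)" "\<lambda>y. measure \<nu>t {y}"] lo sum by (simp add: N'_def)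
  then have A: "N' * k \<le> D * N" using N D by (simp add: field_simps)
  have "1 \<le> N' * (D / (k * N))"
    using sum_mono[of W "\<lambda>y. measure \<nu>t {y}" "\<lambda>_. D / (k * N)"] hi sum by (simp add: N'_def)
  then have B: "k * N \<le> N' * D" using N k by (simp add: field_simps)
  have "1 / ((D\<^sup>2 / k\<^sup>2) * N') \<le> k / (D * N)"
  proof -
    have "k\<^sup>2 * (D * N) = (k * D) * (k * N)" by (simp add: power2_eq_square)
    also have "\<dots> \<le> (k * D) * (N' * D)" using B k D by (intro mult_left_mono) auto
    finally have "k\<^sup>2 * (D * N) \<le> k * (D\<^sup>2 * N')" by (simp add: power2_eq_square mult_ac)
    then show ?thesis using N k D by (simp add: divide_simps mult_ac)
  qed
  moreover have "D / (k * N) \<le> (D\<^sup>2 / k\<^sup>2) / N'"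
  proof -
    have "D * k * (N' * k) \<le> D * k * (D * N)" using A k D by (intro mult_left_mono) auto
    then have "D * (k\<^sup>2 * N') \<le> D\<^sup>2 * (k * N)" by (simp add: power2_eq_square mult_ac)
    then show ?thesis using N k D by (simp add: divide_simps mult_ac)
  qed
  ultimately show ?thesis using lo[OF x] hi[OF x] unfolding N'_def by linarith
qed

theorem lemma5p4:
  fixes \<Omega> :: "(real ^ 'd) set"
    and \<rho> :: "real ^ 'd \<Rightarrow> real"
    and \<mu> :: "(real ^ 'd) measure"
    and \<epsilon> :: "nat \<Rightarrow> real"
    and \<eta> :: "real \<Rightarrow> real"
    and p :: real
  assumes "open \<Omega>" and "bounded \<Omega>" and "lipschitz_boundary \<Omega>"
    and "continuous_on \<Omega> \<rho>"
    and "\<mu> = density (restrict_space lborel \<Omega>) (\<lambda>x. ennreal (\<rho> x))"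
    and "prob_space \<mu>"
    and "\<And>n. \<epsilon> n > 0" and "\<epsilon> \<longlonglongrightarrow> 0"
    and "p \<ge> 1"
    and "\<And>r. r \<ge> 0 \<Longrightarrow> \<eta> r \<ge> 0"
    and "continuous (at 0 within {0..}) \<eta>" and "antimono_on {0..} \<eta>" and "\<eta> 0 > 0"
    and "\<exists>D>0. \<forall>x\<in>\<Omega>. 1 / D \<le> \<rho> x \<and> \<rho> x \<le> D"
    and "\<exists>q>p. kernel_moment CARD('d) \<eta> q < \<infinity>"
  shows
    "\<exists>\<theta>\<ge>1. \<exists>A'>0. \<exists>B'\<ge>1. \<exists>C'>0.
     \<forall>(V :: nat \<Rightarrow> (real ^ 'd) set) (\<mu>n :: nat \<Rightarrow> (real ^ 'd) measure) K T.
       (\<forall>n. discrete_prob_on \<Omega> (V n) (\<mu>n n)) \<longrightarrow>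
       K > 0 \<longrightarrow>
       (\<forall>n. T n \<in> restrict_space borel \<Omega> \<rightarrow>\<^sub>M restrict_space borel \<Omega> \<and>
            T n ` \<Omega> \<subseteq> V n \<and>
            distr \<mu> (restrict_space borel \<Omega>) (T n) = \<mu>n n \<and>
            (\<forall>x\<in>\<Omega>. norm (T n x - x) \<le> K * \<epsilon> n)) \<longrightarrow>
       (\<exists>(S :: (real ^ 'd) set) \<delta> (Vt :: nat \<Rightarrow> (real ^ 'd) set) (\<mu>nt :: nat \<Rightarrow> (real ^ 'd) measure)
          (\<mu>t :: (real ^ 'd) measure) (\<rho>t :: real ^ 'd \<Rightarrow> real) Tt
          (X :: nat \<Rightarrow> (real ^ 'd \<Rightarrow> real) \<Rightarrow> (real ^ 'd \<Rightarrow> real)).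
          open S \<and> \<Omega> \<subseteq> S \<and> \<delta> > 0 \<and> (\<Union>x\<in>\<Omega>. ball x \<delta>) \<subseteq> S \<and>
          (\<forall>n. discrete_prob_on S (Vt n) (\<mu>nt n) \<and> Vt n \<inter> \<Omega> = V n) \<and>
          (\<exists>\<alpha>. 0 < \<alpha> \<and> \<alpha> < 1 \<and> (\<forall>n. \<forall>x\<in>\<Omega>. measure (\<mu>nt n) {x} = \<alpha> * measure (\<mu>n n) {x})) \<and>
          (\<exists>\<beta>>0. \<forall>n. 1 / \<beta> * min_atom (V n) (\<mu>n n) \<le> min_atom (Vt n) (\<mu>nt n) \<and>
                     min_atom (Vt n) (\<mu>nt n) \<le> \<beta> * min_atom (V n) (\<mu>n n)) \<and>
          (\<exists>\<gamma>>0. \<forall>n. 1 / \<gamma> * max_atom (V n) (\<mu>n n) \<le> max_atom (Vt n) (\<mu>nt n) \<and>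
                     max_atom (Vt n) (\<mu>nt n) \<le> \<gamma> * max_atom (V n) (\<mu>n n)) \<and>
          \<rho>t \<in> borel_measurable (restrict_space borel S) \<and>
          \<mu>t = density (restrict_space lborel S) (\<lambda>x. ennreal (\<rho>t x)) \<and>
          prob_space \<mu>t \<and>
          (\<exists>\<kappa>>0. \<forall>x\<in>S. 1 / \<kappa> \<le> \<rho>t x \<and> \<rho>t x \<le> \<kappa>) \<and>
          (\<exists>c. \<forall>x\<in>\<Omega>. \<rho>t x = c * \<rho> x) \<and>
          (\<forall>n. Tt n \<in> restrict_space borel S \<rightarrow>\<^sub>M restrict_space borel S \<and>
               distr \<mu>t (restrict_space borel S) (Tt n) = \<mu>nt n \<and>
               (\<forall>x\<in>\<Omega>. Tt n x = T n x) \<and>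
               (\<forall>x\<in>S. norm (Tt n x - x) \<le> \<theta> * K * \<epsilon> n)) \<and>
          (\<forall>n. X n \<in> Lp_fun (V n) \<rightarrow> Lp_fun (Vt n) \<and>
               (\<forall>u\<in>Lp_fun (V n). \<forall>x\<in>V n. X n u x = u x)) \<and>
          (\<forall>s\<ge>K. \<forall>n. \<forall>u\<in>Lp_fun (V n).
               nonlocal_energy p (\<epsilon> n) s (Vt n) (\<mu>nt n) (X n u)
                 \<le> A' * (Lp_norm p (V n) (\<mu>n n) u powr p
                          + nonlocal_energy p (\<epsilon> n) (s * B') (V n) (\<mu>n n) u)) \<and>
          (\<forall>n. \<forall>u\<in>Lp_fun (V n).
               Lp_norm p (Vt n) (\<mu>nt n) (X n u) \<le> C' * Lp_norm p (V n) (\<mu>n n) u) \<and>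
          ((\<exists>D>0. \<forall>n. \<forall>x\<in>V n. 1 / (D * real (card (V n))) \<le> measure (\<mu>n n) {x} \<and>
                              measure (\<mu>n n) {x} \<le> D / real (card (V n))) \<longrightarrow>
           (\<exists>Dt>0. \<forall>n. \<forall>x\<in>Vt n. 1 / (Dt * real (card (Vt n))) \<le> measure (\<mu>nt n) {x} \<and>
                               measure (\<mu>nt n) {x} \<le> Dt / real (card (Vt n)))) \<and>
          ((\<lambda>n. (SUP x\<in>\<Omega>. norm (T n x - x)) / \<epsilon> n) \<longlonglongrightarrow> 0 \<longrightarrow>
           (\<lambda>n. (SUP x\<in>S. norm (Tt n x - x)) / \<epsilon> n) \<longlonglongrightarrow> 0))"
proof -
  note openO = assms(1) and bddO = assms(2) and \<epsilon>_pos = assms(7) and p1 = assms(9)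
  have \<Omega>b: "\<Omega> \<in> sets borel" using openO by simp
  have "space \<mu> = \<Omega>" unfolding assms(5) by (simp add: space_restrict_space)
  then have ne: "\<Omega> \<noteq> {}" using prob_space.not_empty[OF assms(6)] by simp
  obtain v c \<tau> L M where "inward_field \<Omega> v c \<tau> L M"
    using lipschitz_domain_inward_field[OF openO bddO assms(3) ne] by blast
  then interpret F: inward_field \<Omega> v c \<tau> L M .
  define E where "E = F.collar - \<Omega>"
  have SE: "F.collar = \<Omega> \<union> E" using F.dom_subset_collar by (auto simp: E_def)
  have E_bounded: "bounded E" using F.bounded_collar by (auto simp: E_def intro: bounded_subset)
  have E_borel: "E \<in> sets borel" using F.exterior_borel by (simp add: E_def)
  have E_pos: "0 < measure lborel E" using F.measure_exterior_pos by (simp add: E_def)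
  obtain C where C: "1 \<le> C" "\<And>r. 0 < r \<Longrightarrow> \<exists>P G Q. cell_system \<Omega> E C r P G Q \<and>
        (\<forall>p\<in>P. \<forall>y. measure lborel (\<Omega> \<inter> cball y r) \<le> C * measure lborel (G p))"
    using F.cells_exist unfolding E_def by metis
  obtain D where D: "0 < D" "\<And>x. x \<in> \<Omega> \<Longrightarrow> 1 / D \<le> \<rho> x \<and> \<rho> x \<le> D" using assms(14) by blast
  define \<alpha> where "\<alpha> = 1 / (1 + measure lborel E)"
  have \<alpha>: "0 < \<alpha>" "\<alpha> < 1" using E_pos by (auto simp: \<alpha>_def)
  have \<rho>_meas: "\<rho> \<in> borel_measurable (restrict_space borel \<Omega>)"
    by (rule borel_measurable_continuous_on_restrict[OF assms(4)])
  have disj: "\<Omega> \<inter> E = {}" by (auto simp: E_def)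
  interpret X: extended_domain \<Omega> \<rho> \<mu> D E \<alpha>
    by (intro extended_domain.intro bounded_density.intro extended_domain_axioms.intro)
      (fact \<Omega>b \<rho>_meas assms(5) assms(6) D E_borel disj \<alpha>(1) less_imp_le[OF \<alpha>(2)])+
  define \<mu>t where "\<mu>t = extended_measure \<Omega> (\<Omega> \<union> E) \<rho> \<alpha>"
  have prob_ext: "prob_space \<mu>t"
    unfolding \<mu>t_def using emeasure_bounded_finite[OF E_bounded] by (intro X.prob_space_extended) (simp_all add: \<alpha>_def)
  define A where "A = 1 + D * C"
  have A1: "1 \<le> A" using D C by (simp add: A_def)
  show ?thesis
  \<comment> \<open>in the order of the statement: displacement, energy, range and norm constants\<close>
  proof (rule exI[of _ C], rule conjI[OF C(1)], rule exI[of _ "A\<^sup>2"], rule conjI,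
      use A1 in simp, rule exI[of _ "2 * C + 2"], rule conjI, use C(1) in simp,
      rule exI[of _ A], rule conjI, use A1 in simp, intro allI impI)
    fix V :: "nat \<Rightarrow> (real ^ 'd) set" and \<mu>n :: "nat \<Rightarrow> (real ^ 'd) measure" and K T
    assume disc: "\<forall>n. discrete_prob_on \<Omega> (V n) (\<mu>n n)" and K: "0 < K"
      and T: "\<forall>n. T n \<in> restrict_space borel \<Omega> \<rightarrow>\<^sub>M restrict_space borel \<Omega> \<and>
            T n ` \<Omega> \<subseteq> V n \<and> distr \<mu> (restrict_space borel \<Omega>) (T n) = \<mu>n n \<and>
            (\<forall>x\<in>\<Omega>. norm (T n x - x) \<le> K * \<epsilon> n)"
    have Vfin: "finite (V n)" and Vsub: "V n \<subseteq> \<Omega>" for n using disc by (auto simp: discrete_prob_on_def)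
    have Vne: "V n \<noteq> {}" for n using T ne by blast
    \<comment> \<open>the true displacement, rather than its bound \<open>K * \<epsilon> n\<close>, is what makes the displacement of \<open>Tt\<close> vanish relative to \<open>\<epsilon>\<close>\<close>
    define r where "r n = (SUP x\<in>\<Omega>. norm (T n x - x))" for n
    have r_upper: "norm (T n x - x) \<le> r n" if "x \<in> \<Omega>" for n x
      unfolding r_def using T that by (intro cSUP_upper bdd_aboveI2[of _ _ "K * \<epsilon> n"]) auto
    have r_le: "r n \<le> K * \<epsilon> n" for n
      unfolding r_def using T ne by (intro cSUP_least) auto
    have r_pos: "0 < r n" for n
    proof -
      have "infinite \<Omega>" using openO ne finite_imp_not_open by blast
      then obtain x where x: "x \<in> \<Omega>" "x \<notin> V n" using Vfin[of n] by (meson finite_subset subsetI)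
      then have "T n x \<noteq> x" using T by (metis image_subset_iff)
      then have "0 < norm (T n x - x)" by simp
      then show ?thesis using r_upper[OF x(1), of n] by linarith
    qed
    define top_atom where "top_atom n = max_atom (V n) (\<mu>n n)" for n
    define low_atom where "low_atom n = min_atom (V n) (\<mu>n n)" for n
    have sum_atoms: "(\<Sum>x\<in>V n. measure (\<mu>n n) {x}) = 1" for n
      using disc \<Omega>b by (blast intro: discrete_prob_on_sum_atoms)
    have top_atom_pos: "0 < top_atom n" for n
    proof (rule ccontr)
      assume "\<not> 0 < top_atom n"
      then have "measure (\<mu>n n) {x} \<le> 0" if "x \<in> V n" for x
        using max_atom_ge[OF Vfin that, of "\<mu>n n"] by (simp add: top_atom_def)
      then have "(\<Sum>x\<in>V n. measure (\<mu>n n) {x}) \<le> 0" by (rule sum_nonpos)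
      then show False using sum_atoms[of n] by simp
    qed
    have cells: "\<exists>P G Q. extension_at_scale \<Omega> \<rho> \<mu> D E \<alpha> C (r n) P G Q (V n) (T n) \<and>
        (\<forall>p\<in>P. \<alpha> * measure lborel (G p) \<le> top_atom n \<and>
          (top_atom n / 2 \<le> \<alpha> * measure lborel (G p) \<or> \<alpha> / (D * C) * low_atom n \<le> \<alpha> * measure lborel (G p)))" for n
    proof -
      obtain P0 G0 Q0 where c0: "cell_system \<Omega> E C (r n) P0 G0 Q0"
        "\<And>p y. p \<in> P0 \<Longrightarrow> measure lborel (\<Omega> \<inter> cball y (r n)) \<le> C * measure lborel (G0 p)"
        using C(2)[OF r_pos] by blast
      have ext: "extension_at_scale \<Omega> \<rho> \<mu> D E \<alpha> C (r n) P G Q (V n) (T n)"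
        if "cell_system \<Omega> E C (r n) P G Q" for P G Q
      proof (intro extension_at_scale.intro extension_at_scale_axioms.intro X.extended_domain_axioms)
        show "prob_space (extended_measure \<Omega> (\<Omega> \<union> E) \<rho> \<alpha>)" using prob_ext by (simp add: \<mu>t_def)
        show "T n \<in> restrict_space borel \<Omega> \<rightarrow>\<^sub>M restrict_space borel \<Omega>" using T by blast
        show "T n x \<in> V n" if "x \<in> \<Omega>" for x using T that by blast
      qed (fact that C(1) r_pos Vfin Vsub r_upper)+
      interpret I0: extension_at_scale \<Omega> \<rho> \<mu> D E \<alpha> C "r n" P0 G0 Q0 "V n" "T n"
        by (rule ext[OF c0(1)])
      have \<mu>nT: "\<mu>n n = distr \<mu> (restrict_space borel \<Omega>) (T n)" using T by simp
      obtain z where z: "z \<in> V n" using Vne by blast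
      \<comment> \<open>the comparison is made for the undivided cells, which alone are known to be as heavy as \<open>r\<close>-balls\<close>
      have lower: "low_atom n \<le> D * (C * measure lborel (G0 p))" if "p \<in> P0" for p
      proof -
        have "low_atom n \<le> measure (\<mu>n n) {z}" unfolding low_atom_def by (rule min_atom_le[OF Vfin z])
        also have "\<dots> \<le> D * measure lborel (\<Omega> \<inter> cball z (r n))" unfolding \<mu>nT by (rule I0.\<nu>_atom_le[OF z])
        also have "\<dots> \<le> D * (C * measure lborel (G0 p))" using c0(2)[OF that] D(1) by (intro mult_left_mono) auto
        finally show ?thesis .
      qed
      have G0_pos: "0 < measure lborel (G0 p)" if "p \<in> P0" for p
      proof -
        have "z \<in> \<Omega>" using z Vsub by blast
        then obtain e where e: "0 < e" "ball z e \<subseteq> \<Omega>" using openO open_contains_ball by blast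
        have "0 < measure lborel (ball z (min e (r n)))" using e(1) r_pos by (subst content_ball_gt_0_iff) simp
        also have "\<dots> \<le> measure lborel (\<Omega> \<inter> cball z (r n))"
          using e(2) \<Omega>b bddO by (intro measure_mono_fmeasurable bounded_borel_fmeasurable) (auto intro: bounded_Int)
        also have "\<dots> \<le> C * measure lborel (G0 p)" by (rule c0(2)[OF that])
        finally show ?thesis using C(1) by (metis less_le_trans mult_pos_pos zero_less_mult_pos zero_less_one)
      qed
      obtain P G Q where PGQ: "cell_system \<Omega> E C (r n) P G Q"
        "\<And>p. p \<in> P \<Longrightarrow> measure lborel (G p) \<le> top_atom n / \<alpha>"
        "\<And>p. p \<in> P \<Longrightarrow> top_atom n / \<alpha> / 2 \<le> measure lborel (G p) \<or> (\<exists>q\<in>P0. G p = G0 q)"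
        by (rule cell_system_refine[OF c0(1) E_bounded _ G0_pos, of "top_atom n / \<alpha>"]) (use top_atom_pos \<alpha> in auto)
      have "\<alpha> * measure lborel (G p) \<le> top_atom n \<and>
          (top_atom n / 2 \<le> \<alpha> * measure lborel (G p) \<or> \<alpha> / (D * C) * low_atom n \<le> \<alpha> * measure lborel (G p))" if p: "p \<in> P" for p
      proof
        show "\<alpha> * measure lborel (G p) \<le> top_atom n" using PGQ(2)[OF p] \<alpha> by (simp add: field_simps)
        show "top_atom n / 2 \<le> \<alpha> * measure lborel (G p) \<or> \<alpha> / (D * C) * low_atom n \<le> \<alpha> * measure lborel (G p)"
          using PGQ(3)[OF p]
        proof
          assume "top_atom n / \<alpha> / 2 \<le> measure lborel (G p)"
          then show ?thesis using \<alpha> by (simp add: field_simps)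
        next
          assume "\<exists>q\<in>P0. G p = G0 q"
          then have "low_atom n \<le> D * C * measure lborel (G p)" using lower by (auto simp: mult.assoc)
          then have "\<alpha> / (D * C) * low_atom n \<le> \<alpha> / (D * C) * (D * C * measure lborel (G p))"
            using \<alpha> D(1) C(1) by (intro mult_left_mono) auto
          then show ?thesis using D(1) C(1) by simp
        qed
      qed
      then show ?thesis using ext[OF PGQ(1)] by blast
    qed
    obtain P G Q where ext: "\<And>n. extension_at_scale \<Omega> \<rho> \<mu> D E \<alpha> C (r n) (P n) (G n) (Q n) (V n) (T n)"
      and mass: "\<And>n p. p \<in> P n \<Longrightarrow> \<alpha> * measure lborel (G n p) \<le> top_atom n"
        "\<And>n p. p \<in> P n \<Longrightarrow> top_atom n / 2 \<le> \<alpha> * measure lborel (G n p) \<or>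
                \<alpha> / (D * C) * low_atom n \<le> \<alpha> * measure lborel (G n p)"
      using cells by metis
    define Tt where "Tt n = extended_map \<Omega> (P n) (G n) (T n)" for n
    define w where "w n = transfer_weight \<Omega> \<mu> (Q n) (T n)" for n
    define Vt where "Vt n = V n \<union> P n" for n
    define \<mu>nt where "\<mu>nt n = distr \<mu>t (restrict_space borel (\<Omega> \<union> E)) (Tt n)" for n
    define X where "X n u = restrict (\<lambda>x. \<Sum>z\<in>V n. w n x z * u z) (Vt n)" for n and u :: "real ^ 'd \<Rightarrow> real"
    note defs = Tt_def w_def \<mu>nt_def \<mu>t_def
    have \<mu>nT: "\<mu>n n = distr \<mu> (restrict_space borel \<Omega>) (T n)" for n using T by simp
    have P_fin: "finite (P n)" for n by (rule extension_at_scale.P_finite[OF ext])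
    have P_sub: "P n \<subseteq> E" for n by (rule extension_at_scale.P_sub[OF ext])
    have atom_dom: "measure (\<mu>nt n) {x} = \<alpha> * measure (\<mu>n n) {x}" if "x \<in> \<Omega>" for n x
      unfolding \<mu>nT defs by (rule extension_at_scale.\<nu>t_dom[OF ext that])
    have atom_cell: "measure (\<mu>nt n) {x} = \<alpha> * measure lborel (G n x)" if "x \<in> P n" for n x
      unfolding defs by (rule extension_at_scale.\<nu>t_cell[OF ext that])
    have Vt_fin: "finite (Vt n)" "Vt n \<noteq> {}" for n using Vfin P_fin Vne by (auto simp: Vt_def)
    have disc_t: "discrete_prob_on F.collar (Vt n) (\<mu>nt n)" for n
      unfolding discrete_prob_on_def SE
    proof (intro conjI)
      show "Vt n \<subseteq> \<Omega> \<union> E" using Vsub P_sub by (auto simp: Vt_def)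
      show "prob_space (\<mu>nt n)" unfolding defs by (rule extension_at_scale.prob_\<nu>t[OF ext])
      show "emeasure (\<mu>nt n) (Vt n) = 1" unfolding defs Vt_def by (rule extension_at_scale.emeasure_\<nu>t_support[OF ext])
    qed (use Vt_fin in \<open>simp_all add: \<mu>nt_def\<close>)
    \<comment> \<open>the factors lost on old atoms, on parts of divided cells, and on undivided cells\<close>
    define k where "k = min \<alpha> (min (1/2) (\<alpha> / (D * C)))"
    have k: "0 < k" using \<alpha> D(1) C(1) by (simp add: k_def)
    have atoms: "k * min_atom (V n) (\<mu>n n) \<le> min_atom (Vt n) (\<mu>nt n)"
      "min_atom (Vt n) (\<mu>nt n) \<le> 1 / k * min_atom (V n) (\<mu>n n)"
      "k * max_atom (V n) (\<mu>n n) \<le> max_atom (Vt n) (\<mu>nt n)"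
      "max_atom (Vt n) (\<mu>nt n) \<le> 1 / k * max_atom (V n) (\<mu>n n)" for n
    proof -
      note * = extended_atoms_comparable[of "V n" "P n" \<alpha> "\<alpha> / (D * C)" "\<mu>nt n" "\<mu>n n" k]
      have c: "0 < \<alpha> / (D * C)" using \<alpha> D(1) C(1) by simp
      have onV: "measure (\<mu>nt n) {x} = \<alpha> * measure (\<mu>n n) {x}" if "x \<in> V n" for x
        using atom_dom Vsub that by blast
      have onP: "measure (\<mu>nt n) {p} \<le> max_atom (V n) (\<mu>n n)"
        "max_atom (V n) (\<mu>n n) / 2 \<le> measure (\<mu>nt n) {p} \<or> \<alpha> / (D * C) * min_atom (V n) (\<mu>n n) \<le> measure (\<mu>nt n) {p}"
        if "p \<in> P n" for p
        using mass[OF that] atom_cell[OF that] by (simp_all add: top_atom_def low_atom_def)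
      show "k * min_atom (V n) (\<mu>n n) \<le> min_atom (Vt n) (\<mu>nt n)"
      "min_atom (Vt n) (\<mu>nt n) \<le> 1 / k * min_atom (V n) (\<mu>n n)"
      "k * max_atom (V n) (\<mu>n n) \<le> max_atom (Vt n) (\<mu>nt n)"
      "max_atom (Vt n) (\<mu>nt n) \<le> 1 / k * max_atom (V n) (\<mu>n n)"
        unfolding Vt_def
        using *[OF Vfin Vne P_fin \<alpha>(1) less_imp_le[OF \<alpha>(2)] c onV onP k_def] by blast+
    qed
    have Tt_close: "norm (Tt n x - x) \<le> C * r n" if "x \<in> F.collar" for n x
      using that unfolding SE defs by (rule extension_at_scale.Tt_close[OF ext])
    have w_sum: "(\<Sum>z\<in>V n. w n x z) = 1" if "x \<in> Vt n" for n x
      using that unfolding Vt_def defs by (rule extension_at_scale.w_sum[OF ext])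
    have w_nonneg: "0 \<le> w n x z" for n x z
      unfolding defs by (rule extension_at_scale.w_nonneg[OF ext])
    have w_pull: "(\<Sum>x\<in>Vt n. measure (\<mu>nt n) {x} * w n x z) \<le> A * measure (\<mu>n n) {z}" if "z \<in> V n" for n z
      unfolding \<mu>nT A_def Vt_def defs by (rule extension_at_scale.w_pull[OF ext that])
    have X_on_V: "X n u x = u x" if "x \<in> V n" for n u x
    proof -
      have "x \<in> \<Omega>" using that Vsub by blast
      then have "X n u x = (\<Sum>z\<in>V n. if x = z then u z else 0)"
        unfolding X_def Vt_def using that
        by (auto simp: w_def transfer_weight_def intro!: sum.cong)
      then show ?thesis using Vfin that by simp
    qed
    have energy: "nonlocal_energy p (\<epsilon> n) s (Vt n) (\<mu>nt n) (X n u)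
        \<le> A\<^sup>2 * nonlocal_energy p (\<epsilon> n) (s * (2 * C + 2)) (V n) (\<mu>n n) u" if s: "K \<le> s" for s n u
    proof -
      have rs: "r n \<le> s * \<epsilon> n" using r_le[of n] mult_right_mono[OF s less_imp_le[OF \<epsilon>_pos[of n]]] by linarith
      have near: "norm (z - z') \<le> s * (2 * C + 2) * \<epsilon> n"
        if "x \<in> Vt n" "y \<in> Vt n" "z \<in> V n" "z' \<in> V n" "norm (x - y) \<le> s * \<epsilon> n" "0 < w n x z" "0 < w n y z'" for x y z z'
        using extension_at_scale.w_near[OF ext, of x n y "s * \<epsilon> n" z z'] that rs
        by (simp add: Vt_def defs mult_ac)
      have "(\<Sum>x\<in>Vt n. \<Sum>y\<in>Vt n. of_bool (norm (x - y) \<le> s * \<epsilon> n) * \<bar>X n u x - X n u y\<bar> powr p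
            * measure (\<mu>nt n) {x} * measure (\<mu>nt n) {y})
        = (\<Sum>x\<in>Vt n. \<Sum>y\<in>Vt n. of_bool (norm (x - y) \<le> s * \<epsilon> n) *
            \<bar>(\<Sum>z\<in>V n. w n x z * u z) - (\<Sum>z\<in>V n. w n y z * u z)\<bar> powr p
            * measure (\<mu>nt n) {x} * measure (\<mu>nt n) {y})"
        by (intro sum.cong refl) (simp add: X_def)
      also have "\<dots> \<le> A\<^sup>2 * (\<Sum>z\<in>V n. \<Sum>z'\<in>V n. of_bool (norm (z - z') \<le> s * (2 * C + 2) * \<epsilon> n) * \<bar>u z - u z'\<bar> powr p
            * measure (\<mu>n n) {z} * measure (\<mu>n n) {z'})"
        using A1 by (intro markov_extension_energy_le Vfin Vt_fin p1 w_sum w_nonneg w_pull near) auto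
      finally show ?thesis
        unfolding nonlocal_energy_def
        using mult_left_mono[of _ _ "1 / \<epsilon> n powr (real CARD('d) + p)"] by (simp add: mult.left_commute)
    qed
    have norm_X: "Lp_norm p (Vt n) (\<mu>nt n) (X n u) \<le> A * Lp_norm p (V n) (\<mu>n n) u" for n u
    proof -
      have "(\<Sum>x\<in>Vt n. \<bar>X n u x\<bar> powr p * measure (\<mu>nt n) {x})
          = (\<Sum>x\<in>Vt n. \<bar>\<Sum>z\<in>V n. w n x z * u z\<bar> powr p * measure (\<mu>nt n) {x})"
        by (intro sum.cong refl) (simp add: X_def)
      also have "\<dots> \<le> A * (\<Sum>z\<in>V n. \<bar>u z\<bar> powr p * measure (\<mu>n n) {z})"
        by (intro markov_extension_norm_le Vfin Vt_fin p1 w_sum w_nonneg w_pull measure_nonneg)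
      finally have "Lp_norm p (Vt n) (\<mu>nt n) (X n u)
          \<le> (A * (\<Sum>z\<in>V n. \<bar>u z\<bar> powr p * measure (\<mu>n n) {z})) powr (1 / p)"
        unfolding Lp_norm_def using p1 by (intro powr_mono2) (auto intro!: sum_nonneg)
      also have "\<dots> = A powr (1 / p) * Lp_norm p (V n) (\<mu>n n) u"
        unfolding Lp_norm_def by (rule powr_mult)
      also have "\<dots> \<le> A * Lp_norm p (V n) (\<mu>n n) u"
      proof (rule mult_right_mono)
        show "A powr (1 / p) \<le> A" using powr_mono[of "1 / p" 1 A] p1 A1 by simp
      qed (simp add: Lp_norm_def)
      finally show ?thesis .
    qed
    have uniform: "\<exists>Dt>0. \<forall>n. \<forall>x\<in>Vt n. 1 / (Dt * real (card (Vt n))) \<le> measure (\<mu>nt n) {x} \<and>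
                               measure (\<mu>nt n) {x} \<le> Dt / real (card (Vt n))"
      if unif: "\<exists>D>0. \<forall>n. \<forall>x\<in>V n. 1 / (D * real (card (V n))) \<le> measure (\<mu>n n) {x} \<and>
                              measure (\<mu>n n) {x} \<le> D / real (card (V n))"
    proof -
      obtain D' where D': "0 < D'" "\<And>n x. x \<in> V n \<Longrightarrow> 1 / (D' * real (card (V n))) \<le> measure (\<mu>n n) {x} \<and>
                              measure (\<mu>n n) {x} \<le> D' / real (card (V n))" using unif by blast
      have "(\<Sum>x\<in>Vt n. measure (\<mu>nt n) {x}) = 1" for n
        using disc_t F.open_collar by (blast intro: discrete_prob_on_sum_atoms borel_open)
      then have "1 / ((D'\<^sup>2 / k\<^sup>2) * real (card (Vt n))) \<le> measure (\<mu>nt n) {x} \<and>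
          measure (\<mu>nt n) {x} \<le> (D'\<^sup>2 / k\<^sup>2) / real (card (Vt n))" if "x \<in> Vt n" for n x
        using that by (intro uniform_atoms_transfer[OF Vfin Vne Vt_fin _ k D'(1) atoms(1,4) D'(2)])
      then show ?thesis using D'(1) k by (intro exI[of _ "D'\<^sup>2 / k\<^sup>2"]) simp
    qed
    have vanish: "(\<lambda>n. (SUP x\<in>F.collar. norm (Tt n x - x)) / \<epsilon> n) \<longlonglongrightarrow> 0"
      if lim: "(\<lambda>n. (SUP x\<in>\<Omega>. norm (T n x - x)) / \<epsilon> n) \<longlonglongrightarrow> 0"
    proof (rule Lim_null_comparison)
      show "(\<lambda>n. C * (r n / \<epsilon> n)) \<longlonglongrightarrow> 0"
        using tendsto_mult_right_zero[OF lim[folded r_def]] .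
      show "\<forall>\<^sub>F n in sequentially. norm ((SUP x\<in>F.collar. norm (Tt n x - x)) / \<epsilon> n) \<le> C * (r n / \<epsilon> n)"
      proof (rule always_eventually, rule allI)
        fix n
        obtain x0 where x0: "x0 \<in> F.collar" using ne F.dom_subset_collar by blast
        have up: "(SUP x\<in>F.collar. norm (Tt n x - x)) \<le> C * r n"
          using Tt_close x0 by (intro cSUP_least) auto
        have "norm (Tt n x0 - x0) \<le> (SUP x\<in>F.collar. norm (Tt n x - x))"
          using Tt_close x0 by (intro cSUP_upper bdd_aboveI2[of _ _ "C * r n"]) auto
        then have "0 \<le> (SUP x\<in>F.collar. norm (Tt n x - x))" using norm_ge_zero order_trans by blast
        then show "norm ((SUP x\<in>F.collar. norm (Tt n x - x)) / \<epsilon> n) \<le> C * (r n / \<epsilon> n)"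
          using up \<epsilon>_pos[of n] by (simp add: divide_right_mono)
      qed
    qed
    show "\<exists>S \<delta> Vt \<mu>nt \<mu>t \<rho>t Tt X.
          open S \<and> \<Omega> \<subseteq> S \<and> \<delta> > 0 \<and> (\<Union>x\<in>\<Omega>. ball x \<delta>) \<subseteq> S \<and>
          (\<forall>n. discrete_prob_on S (Vt n) (\<mu>nt n) \<and> Vt n \<inter> \<Omega> = V n) \<and>
          (\<exists>\<alpha>. 0 < \<alpha> \<and> \<alpha> < 1 \<and> (\<forall>n. \<forall>x\<in>\<Omega>. measure (\<mu>nt n) {x} = \<alpha> * measure (\<mu>n n) {x})) \<and>
          (\<exists>\<beta>>0. \<forall>n. 1 / \<beta> * min_atom (V n) (\<mu>n n) \<le> min_atom (Vt n) (\<mu>nt n) \<and>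
                     min_atom (Vt n) (\<mu>nt n) \<le> \<beta> * min_atom (V n) (\<mu>n n)) \<and>
          (\<exists>\<gamma>>0. \<forall>n. 1 / \<gamma> * max_atom (V n) (\<mu>n n) \<le> max_atom (Vt n) (\<mu>nt n) \<and>
                     max_atom (Vt n) (\<mu>nt n) \<le> \<gamma> * max_atom (V n) (\<mu>n n)) \<and>
          \<rho>t \<in> borel_measurable (restrict_space borel S) \<and>
          \<mu>t = density (restrict_space lborel S) (\<lambda>x. ennreal (\<rho>t x)) \<and>
          prob_space \<mu>t \<and>
          (\<exists>\<kappa>>0. \<forall>x\<in>S. 1 / \<kappa> \<le> \<rho>t x \<and> \<rho>t x \<le> \<kappa>) \<and>
          (\<exists>c. \<forall>x\<in>\<Omega>. \<rho>t x = c * \<rho> x) \<and>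
          (\<forall>n. Tt n \<in> restrict_space borel S \<rightarrow>\<^sub>M restrict_space borel S \<and>
               distr \<mu>t (restrict_space borel S) (Tt n) = \<mu>nt n \<and>
               (\<forall>x\<in>\<Omega>. Tt n x = T n x) \<and>
               (\<forall>x\<in>S. norm (Tt n x - x) \<le> C * K * \<epsilon> n)) \<and>
          (\<forall>n. X n \<in> Lp_fun (V n) \<rightarrow> Lp_fun (Vt n) \<and>
               (\<forall>u\<in>Lp_fun (V n). \<forall>x\<in>V n. X n u x = u x)) \<and>
          (\<forall>s\<ge>K. \<forall>n. \<forall>u\<in>Lp_fun (V n).
               nonlocal_energy p (\<epsilon> n) s (Vt n) (\<mu>nt n) (X n u)
                 \<le> A\<^sup>2 * (Lp_norm p (V n) (\<mu>n n) u powr p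
                          + nonlocal_energy p (\<epsilon> n) (s * (2 * C + 2)) (V n) (\<mu>n n) u)) \<and>
          (\<forall>n. \<forall>u\<in>Lp_fun (V n).
               Lp_norm p (Vt n) (\<mu>nt n) (X n u) \<le> A * Lp_norm p (V n) (\<mu>n n) u) \<and>
          ((\<exists>D>0. \<forall>n. \<forall>x\<in>V n. 1 / (D * real (card (V n))) \<le> measure (\<mu>n n) {x} \<and>
                              measure (\<mu>n n) {x} \<le> D / real (card (V n))) \<longrightarrow>
           (\<exists>Dt>0. \<forall>n. \<forall>x\<in>Vt n. 1 / (Dt * real (card (Vt n))) \<le> measure (\<mu>nt n) {x} \<and>
                               measure (\<mu>nt n) {x} \<le> Dt / real (card (Vt n)))) \<and>
          ((\<lambda>n. (SUP x\<in>\<Omega>. norm (T n x - x)) / \<epsilon> n) \<longlonglongrightarrow> 0 \<longrightarrow>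
           (\<lambda>n. (SUP x\<in>S. norm (Tt n x - x)) / \<epsilon> n) \<longlonglongrightarrow> 0)"
    proof (rule exI[of _ F.collar], rule exI[of _ F.\<delta>], rule exI[of _ Vt], rule exI[of _ \<mu>nt],
        rule exI[of _ \<mu>t], rule exI[of _ "extended_density \<Omega> \<rho> \<alpha>"], rule exI[of _ Tt], rule exI[of _ X],
        intro conjI)
      show "(\<Union>x\<in>\<Omega>. ball x F.\<delta>) \<subseteq> F.collar"
        unfolding F.collar_def by (auto simp: dist_commute intro: le_less_trans[OF infdist_le])
      show "\<forall>n. discrete_prob_on F.collar (Vt n) (\<mu>nt n) \<and> Vt n \<inter> \<Omega> = V n"
        using disc_t Vsub P_sub X.E_disjoint unfolding Vt_def by blast
      show "\<exists>\<alpha>. 0 < \<alpha> \<and> \<alpha> < 1 \<and> (\<forall>n. \<forall>x\<in>\<Omega>. measure (\<mu>nt n) {x} = \<alpha> * measure (\<mu>n n) {x})"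
        using \<alpha> atom_dom by blast
      show "\<exists>\<beta>>0. \<forall>n. 1 / \<beta> * min_atom (V n) (\<mu>n n) \<le> min_atom (Vt n) (\<mu>nt n) \<and>
                     min_atom (Vt n) (\<mu>nt n) \<le> \<beta> * min_atom (V n) (\<mu>n n)"
        using atoms(1,2) k by (intro exI[of _ "1 / k"]) simp
      show "\<exists>\<gamma>>0. \<forall>n. 1 / \<gamma> * max_atom (V n) (\<mu>n n) \<le> max_atom (Vt n) (\<mu>nt n) \<and>
                     max_atom (Vt n) (\<mu>nt n) \<le> \<gamma> * max_atom (V n) (\<mu>n n)"
        using atoms(3,4) k by (intro exI[of _ "1 / k"]) simp
      show "extended_density \<Omega> \<rho> \<alpha> \<in> borel_measurable (restrict_space borel F.collar)"
        unfolding SE by (rule X.extended_density_measurable)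
      show "\<mu>t = density (restrict_space lborel F.collar) (\<lambda>x. ennreal (extended_density \<Omega> \<rho> \<alpha> x))"
        unfolding SE \<mu>t_def extended_measure_def ..
      show "\<exists>\<kappa>>0. \<forall>x\<in>F.collar. 1 / \<kappa> \<le> extended_density \<Omega> \<rho> \<alpha> x \<and> extended_density \<Omega> \<rho> \<alpha> x \<le> \<kappa>"
      proof (intro exI[of _ "(D + 1) / \<alpha>"] conjI ballI)
        show "0 < (D + 1) / \<alpha>" using D(1) \<alpha> by simp
        fix x
        have bounds: "\<alpha> / (D + 1) \<le> \<alpha> * (1 / D)" "\<alpha> / (D + 1) \<le> \<alpha>" using D(1) \<alpha> by (auto simp: field_simps)
        have "\<alpha> * D \<le> 1 * D" using D(1) \<alpha> by (intro mult_right_mono) auto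
        moreover have "(D + 1) * \<alpha> \<le> (D + 1) * 1" using D(1) \<alpha> by (intro mult_left_mono) auto
        then have "D + 1 \<le> (D + 1) / \<alpha>" using \<alpha> by (simp add: pos_le_divide_eq)
        ultimately have upper: "\<alpha> * D \<le> (D + 1) / \<alpha>" "\<alpha> \<le> (D + 1) / \<alpha>" using D(1) \<alpha> by linarith+
        have "1 / ((D + 1) / \<alpha>) \<le> extended_density \<Omega> \<rho> \<alpha> x \<and> extended_density \<Omega> \<rho> \<alpha> x \<le> (D + 1) / \<alpha>"
        proof (cases "x \<in> \<Omega>")
          case True
          then have "\<alpha> * (1 / D) \<le> \<alpha> * \<rho> x" "\<alpha> * \<rho> x \<le> \<alpha> * D"
            using D(2)[OF True] \<alpha> by (auto intro!: mult_left_mono simp del: times_divide_eq_right)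
          then have "\<alpha> / (D + 1) \<le> \<alpha> * \<rho> x \<and> \<alpha> * \<rho> x \<le> (D + 1) / \<alpha>" using bounds upper by linarith
          then show ?thesis using True by (simp add: extended_density_def)
        next
          case False
          then show ?thesis using bounds(2) upper(2) by (simp add: extended_density_def)
        qed
        then show "1 / ((D + 1) / \<alpha>) \<le> extended_density \<Omega> \<rho> \<alpha> x" "extended_density \<Omega> \<rho> \<alpha> x \<le> (D + 1) / \<alpha>"
          by blast+
      qed
      show "\<exists>c. \<forall>x\<in>\<Omega>. extended_density \<Omega> \<rho> \<alpha> x = c * \<rho> x"
        by (auto simp: extended_density_def)
      show "\<forall>n. Tt n \<in> restrict_space borel F.collar \<rightarrow>\<^sub>M restrict_space borel F.collar \<and>
               distr \<mu>t (restrict_space borel F.collar) (Tt n) = \<mu>nt n \<and>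
               (\<forall>x\<in>\<Omega>. Tt n x = T n x) \<and>
               (\<forall>x\<in>F.collar. norm (Tt n x - x) \<le> C * K * \<epsilon> n)"
      proof (intro allI conjI ballI)
        fix n
        show "Tt n \<in> restrict_space borel F.collar \<rightarrow>\<^sub>M restrict_space borel F.collar"
          unfolding SE defs by (rule extension_at_scale.Tt_measurable[OF ext])
        show "distr \<mu>t (restrict_space borel F.collar) (Tt n) = \<mu>nt n" unfolding SE \<mu>nt_def ..
        show "Tt n x = T n x" if "x \<in> \<Omega>" for x using that by (simp add: Tt_def extended_map_def)
        show "norm (Tt n x - x) \<le> C * K * \<epsilon> n" if "x \<in> F.collar" for x
          using Tt_close[OF that, of n] mult_left_mono[OF r_le[of n], of C] C(1) unfolding mult.assoc by linarith
      qed
      show "\<forall>n. X n \<in> Lp_fun (V n) \<rightarrow> Lp_fun (Vt n) \<and> (\<forall>u\<in>Lp_fun (V n). \<forall>x\<in>V n. X n u x = u x)"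
        using X_on_V by (auto simp: Lp_fun_def X_def)
      show "\<forall>s\<ge>K. \<forall>n. \<forall>u\<in>Lp_fun (V n). nonlocal_energy p (\<epsilon> n) s (Vt n) (\<mu>nt n) (X n u)
                 \<le> A\<^sup>2 * (Lp_norm p (V n) (\<mu>n n) u powr p
                          + nonlocal_energy p (\<epsilon> n) (s * (2 * C + 2)) (V n) (\<mu>n n) u)"
        using energy by (auto simp: distrib_left intro: order_trans add_increasing)
    qed (use F.open_collar F.dom_subset_collar F.\<delta>_pos prob_ext norm_X uniform vanish in \<open>auto\<close>)
  qed
qed

end
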